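(* Let $T=(1,2,\ldots,d,t_d,\ldots,t_{\mathsf j},0)$ with $d\ge t_d\ge\cdots\ge t_{\mathsf j}>0$, and for $d\le i\le\mathsf j$ let $T_i=(1,2,\ldots,t_{i-1}-t_{i+1},\,t_i-t_{i+1},0)$, where $t_{d-1}=d$, $t_{\mathsf j+1}=0$. Let $A_i$ be the total number of partitions of diagonal lengths $T_i$ and $S_i$ the number of special partitions of diagonal lengths $T_i$. Then the number $S$ of special partitions of diagonal lengths $T$ is $$S=\sum_{i=1}^{\mathsf j-d+1}(-1)^{i+1}\left(\sum_{\lambda\subseteq\{d,\ldots,\mathsf j\},\ |\lambda|=i}S_\lambda\,A_{\{d,\ldots,\mathsf j\}\setminus\lambda}\right),$$ where $S_\lambda=\prod_{i\in\lambda}S_i$ and $A_{\{d,\ldots,\mathsf j\}\setminus\lambda}=\prod_{i\in\{d,\ldots,\mathsf j\}\setminus\lambda}A_i$.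
   Context: Let $R=\mathsf k[x,y]$ with its standard grading, where the field $\mathsf k$ has characteristic zero, or is infinite of characteristic $p>\mathsf j$. For a partition $P=(p_1\ge\cdots\ge p_m)$ let $C_P$ be the set of monomials $x^ay^b$ with $0\le b<m$, $0\le a<p_{b+1}$, and $E_P$ the set of monomials not in $C_P$, and also the monomial ideal they generate. The diagonal lengths of $P$ is the Hilbert function of $R/E_P$. The initial monomial of a form is its monomial of highest $y$-degree with nonzero coefficient; $\mathrm{in}(I)$ is generated by the initial monomials of elements of $I$; the Jordan cell $\mathbb V(E_P)$ is the affine variety (an affine space) parametrizing all graded ideals $I\subset R$ with $\mathrm{in}(I)=E_P$. $\kappa(P)$ is the minimum number of generators of a generic ideal $I\in\mathbb V(E_P)$ (generic: in a suitable nonempty Zariski-open dense subset). $\mathrm G_T$ is the irreducible projective variety parametrizing graded ideals $I\subset R$ such that $R/I$ has Hilbert function $T$, and $\kappa(T)$ is the minimum number of generators of a generic $I\in\mathrm G_T$. A partition $P$ of diagonal lengths $T$ is special if $\kappa(P)>\kappa(T)$ (equivalently $\kappa(P)\ne\kappa(T)$). If $t_{i-1}=t_{i+1}$, $T_i$ is the zero sequence, whose only partition is the empty one (non-special). If $t_i=t_{i+1}$, then $T_i=(1,2,\ldots,t_{i-1}-t_i,0)$. *)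

theory Defs
  imports "HOL-Analysis.Analysis" "HOL-Library.Poly_Mapping"
begin

section \<open>Graded ideals of k[x,y]\<close>

text \<open>
  The polynomial ring k[x,y] is the monoid algebra of nat \<times> nat (with its convolution
  product): the monomial x^a y^b is the key (a,b).
\<close>

type_synonym 'k bipoly = "(nat \<times> nat) \<Rightarrow>\<^sub>0 'k"

definition mdeg :: "nat \<times> nat \<Rightarrow> nat" where
  "mdeg m = fst m + snd m"

definition monom2 :: "nat \<times> nat \<Rightarrow> 'k::field bipoly" where
  "monom2 m = Poly_Mapping.single m 1"

definition cscale :: "'k::field \<Rightarrow> 'k bipoly \<Rightarrow> 'k bipoly" where
  "cscale c f = Poly_Mapping.single 0 c * f"

global_interpretation pvs: vector_space "cscale :: 'k::field \<Rightarrow> 'k bipoly \<Rightarrow> 'k bipoly"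
proof
  fix a b :: 'k and f g :: "'k bipoly"
  show "cscale a (f + g) = cscale a f + cscale a g"
    by (simp add: cscale_def distrib_left)
  show "cscale (a + b) f = cscale a f + cscale b f"
    by (simp add: cscale_def single_add distrib_right)
  show "cscale a (cscale b f) = cscale (a * b) f"
    by (simp add: cscale_def mult_single flip: mult.assoc)
  show "cscale 1 f = f"
    by (simp add: cscale_def)
qed

text \<open>Ideals of a commutative ring are the submodules of the ring over itself; \<open>ideals.span G\<close>
  is the ideal generated by \<open>G\<close>.\<close>

global_interpretation ideals: module "(*) :: 'a::comm_ring_1 \<Rightarrow> 'a \<Rightarrow> 'a"
  by standard (simp_all add: algebra_simps)

definition forms :: "nat \<Rightarrow> 'k::field bipoly set" where
  "forms i = {f. \<forall>m\<in>Poly_Mapping.keys f. mdeg m = i}"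

definition hom_component :: "nat \<Rightarrow> 'k::field bipoly \<Rightarrow> 'k bipoly" where
  "hom_component i f =
     (\<Sum>m\<in>{m \<in> Poly_Mapping.keys f. mdeg m = i}. Poly_Mapping.single m (Poly_Mapping.lookup f m))"

definition graded_ideal :: "'k::field bipoly set \<Rightarrow> bool" where
  "graded_ideal I \<longleftrightarrow> ideals.subspace I \<and> (\<forall>f\<in>I. \<forall>i. hom_component i f \<in> I)"

text \<open>The Hilbert function of R/I for a graded ideal I: dim R_i = i + 1.\<close>

definition hilbert_fun :: "'k::field bipoly set \<Rightarrow> nat \<Rightarrow> nat" where
  "hilbert_fun I i = (i + 1) - pvs.dim (I \<inter> forms i)"

definition min_gens :: "'k::field bipoly set \<Rightarrow> nat" where
  "min_gens I = (LEAST n. \<exists>G. finite G \<and> card G = n \<and> ideals.span G = I)"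

definition init_mon :: "'k::field bipoly \<Rightarrow> nat \<times> nat" where
  "init_mon f = (ARG_MAX snd m. m \<in> Poly_Mapping.keys f)"

text \<open>The initial monomial is defined for nonzero forms, where the key of highest y-degree is
  unique; hence the restriction to homogeneous elements.\<close>

definition init_ideal :: "'k::field bipoly set \<Rightarrow> 'k bipoly set" where
  "init_ideal I = ideals.span {monom2 (init_mon f) | f. f \<in> I \<and> f \<noteq> 0 \<and> (\<exists>i. f \<in> forms i)}"

section \<open>Zariski topology and generic ideals\<close>

definition G_T :: "(nat \<Rightarrow> nat) \<Rightarrow> 'k::field bipoly set set" where
  "G_T T = {I. graded_ideal I \<and> hilbert_fun I = T}"

text \<open>
  \<open>G_T T\<close> sits inside the product over i of the Grassmannians of subspaces of dimension
  i + 1 - T i of R_i (a point for all large i), via I \<mapsto> (I \<inter> R_i)_i.  Its set of k-points carries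
  the Zariski topology, where the Grassmannian is the quotient of the space of matrices of full
  rank by the general linear group: a set of ideals is closed iff the set of the coefficient
  matrices of all bases of its members is cut out by polynomial equations.
  A frame \<open>B\<close> of \<open>I\<close> lists a basis \<open>B i 0, B i 1, \<dots>\<close> of I \<inter> R_i for each i.
\<close>

definition frame :: "(nat \<Rightarrow> nat) \<Rightarrow> 'k::field bipoly set \<Rightarrow> (nat \<Rightarrow> nat \<Rightarrow> 'k bipoly) \<Rightarrow> bool" where
  "frame T I B \<longleftrightarrow>
     (\<forall>i. inj_on (B i) {..<i + 1 - T i} \<and> pvs.independent (B i ` {..<i + 1 - T i}) \<and>
          pvs.span (B i ` {..<i + 1 - T i}) = I \<inter> forms i)"

inductive_set frame_polys :: "(nat \<Rightarrow> nat) \<Rightarrow> ((nat \<Rightarrow> nat \<Rightarrow> 'k::field bipoly) \<Rightarrow> 'k) set"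
  for T :: "nat \<Rightarrow> nat" where
  const: "(\<lambda>B. c) \<in> frame_polys T"
| coord: "r < i + 1 - T i \<Longrightarrow> mdeg m = i \<Longrightarrow> (\<lambda>B. Poly_Mapping.lookup (B i r) m) \<in> frame_polys T"
| add: "p \<in> frame_polys T \<Longrightarrow> q \<in> frame_polys T \<Longrightarrow> (\<lambda>B. p B + q B) \<in> frame_polys T"
| mult: "p \<in> frame_polys T \<Longrightarrow> q \<in> frame_polys T \<Longrightarrow> (\<lambda>B. p B * q B) \<in> frame_polys T"

definition zariski_closed :: "(nat \<Rightarrow> nat) \<Rightarrow> 'k::field bipoly set set \<Rightarrow> bool" where
  "zariski_closed T Z \<longleftrightarrow> Z \<subseteq> G_T T \<and>
     (\<exists>F \<subseteq> frame_polys T. \<forall>I\<in>G_T T. \<forall>B. frame T I B \<longrightarrow> (I \<in> Z \<longleftrightarrow> (\<forall>p\<in>F. p B = 0)))"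

definition zariski :: "(nat \<Rightarrow> nat) \<Rightarrow> 'k::field bipoly set topology" where
  "zariski T = topology (\<lambda>U. U \<subseteq> G_T T \<and> zariski_closed T (G_T T - U))"

lemma zariski_closedI:
  assumes "Z \<subseteq> G_T T" "F \<subseteq> frame_polys T"
    "\<And>I B. I \<in> G_T T \<Longrightarrow> frame T I B \<Longrightarrow> I \<in> Z \<longleftrightarrow> (\<forall>p\<in>F. p B = 0)"
  shows "zariski_closed T Z"
  unfolding zariski_closed_def by (intro conjI exI[of _ F] ballI allI impI assms)

lemma zariski_closedD:
  assumes "zariski_closed T Z"
  shows "\<exists>F \<subseteq> frame_polys T. \<forall>I\<in>G_T T. \<forall>B. frame T I B \<longrightarrow> (I \<in> Z \<longleftrightarrow> (\<forall>p\<in>F. p B = 0))"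
  using assms unfolding zariski_closed_def by (rule conjunct2)

lemma zariski_closed_subset: "zariski_closed T Z \<Longrightarrow> Z \<subseteq> G_T T"
  unfolding zariski_closed_def by (rule conjunct1)

lemma zariski_closed_Un:
  fixes Y Z :: "'k::field bipoly set set"
  assumes "zariski_closed T Y" "zariski_closed T Z"
  shows "zariski_closed T (Y \<union> Z)"
proof -
  obtain F where F: "F \<subseteq> frame_polys T"
    "\<forall>I\<in>G_T T. \<forall>B. frame T I B \<longrightarrow> (I \<in> Y \<longleftrightarrow> (\<forall>p\<in>F. p B = 0))"
    using zariski_closedD[OF assms(1)] by (elim exE conjE)
  obtain H where H: "H \<subseteq> frame_polys T"
    "\<forall>I\<in>G_T T. \<forall>B. frame T I B \<longrightarrow> (I \<in> Z \<longleftrightarrow> (\<forall>p\<in>H. p B = 0))"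
    using zariski_closedD[OF assms(2)] by (elim exE conjE)
  let ?K = "(\<lambda>(p, q). \<lambda>B. p B * q B) ` (F \<times> H)"
  show ?thesis
  proof (rule zariski_closedI)
    show "Y \<union> Z \<subseteq> G_T T"
      using assms[THEN zariski_closed_subset] by (rule Un_least)
    show "?K \<subseteq> frame_polys T"
    proof (clarify)
      fix p q assume "p \<in> F" "q \<in> H"
      then show "(\<lambda>B. p B * q B) \<in> frame_polys T"
        using F(1) H(1) by (intro frame_polys.mult) (erule (1) subsetD)+
    qed
    fix I :: "'k bipoly set" and B assume I: "I \<in> G_T T" "frame T I B"
    have "(\<forall>p\<in>?K. p B = 0) \<longleftrightarrow> (\<forall>p\<in>F. \<forall>q\<in>H. p B = 0 \<or> q B = 0)"
      by simp
    also have "\<dots> \<longleftrightarrow> (\<forall>p\<in>F. p B = 0) \<or> (\<forall>q\<in>H. q B = 0)" by blast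
    finally show "I \<in> Y \<union> Z \<longleftrightarrow> (\<forall>p\<in>?K. p B = 0)"
      by (simp only: Un_iff F(2)[rule_format, OF I] H(2)[rule_format, OF I])
  qed
qed

lemma zariski_closed_Inter:
  fixes \<Z> :: "'k::field bipoly set set set"
  assumes closed: "\<And>Z. Z \<in> \<Z> \<Longrightarrow> zariski_closed T Z"
  shows "zariski_closed T (G_T T \<inter> \<Inter>\<Z>)"
proof -
  let ?H = "{p \<in> frame_polys T :: ((nat \<Rightarrow> nat \<Rightarrow> 'k bipoly) \<Rightarrow> 'k) set.
    \<exists>Z\<in>\<Z>. \<forall>I\<in>Z. \<forall>B. frame T I B \<longrightarrow> p B = 0}"
  show ?thesis
  proof (rule zariski_closedI)
    show "G_T T \<inter> \<Inter>\<Z> \<subseteq> G_T T" by (rule Int_lower1)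
    show "?H \<subseteq> frame_polys T" by (rule Collect_restrict)
    fix I :: "'k bipoly set" and B assume I: "I \<in> G_T T" "frame T I B"
    show "I \<in> G_T T \<inter> \<Inter>\<Z> \<longleftrightarrow> (\<forall>p\<in>?H. p B = 0)"
    proof
      assume "I \<in> G_T T \<inter> \<Inter>\<Z>"
      then show "\<forall>p\<in>?H. p B = 0" using I(2) by blast
    next
      assume H: "\<forall>p\<in>?H. p B = 0"
      have "I \<in> Z" if Z: "Z \<in> \<Z>" for Z
      proof -
        obtain F where F: "F \<subseteq> frame_polys T"
          "\<forall>I\<in>G_T T. \<forall>B. frame T I B \<longrightarrow> (I \<in> Z \<longleftrightarrow> (\<forall>p\<in>F. p B = 0))"
          using zariski_closedD[OF closed[OF Z]] by (elim exE conjE)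
        have "p B = 0" if p: "p \<in> F" for p
        proof -
          have "q B' = 0" if "J \<in> Z" "frame T J B'" "q \<in> F" for J B' q
            using F(2)[rule_format, OF subsetD[OF zariski_closed_subset[OF closed[OF Z]] that(1)] that(2)] that
            by simp
          then have "p \<in> ?H" using subsetD[OF F(1) p] Z p by blast
          then show ?thesis using H by (rule bspec[rotated])
        qed
        then show ?thesis using F(2)[rule_format, OF I] by simp
      qed
      then show "I \<in> G_T T \<inter> \<Inter>\<Z>" using I(1) by simp
    qed
  qed
qed

lemma zariski_closed_empty: "zariski_closed T {}"
  by (rule zariski_closedI[where F = "{\<lambda>B. 1}"]) (simp_all add: frame_polys.const)

lemma istopology_zariski:
  "istopology (\<lambda>U. U \<subseteq> G_T T \<and> zariski_closed T (G_T T - U))"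
  unfolding istopology_def
proof (intro conjI allI impI; (elim conjE)?)
  fix U V :: "'a bipoly set set"
  assume U: "U \<subseteq> G_T T" and c: "zariski_closed T (G_T T - U)" "zariski_closed T (G_T T - V)"
  show "U \<inter> V \<subseteq> G_T T" using U by (rule le_infI1)
  show "zariski_closed T (G_T T - U \<inter> V)"
    unfolding Diff_Int by (rule zariski_closed_Un[OF c])
next
  fix \<U> :: "'a bipoly set set set"
  assume U: "\<forall>K\<in>\<U>. K \<subseteq> G_T T \<and> zariski_closed T (G_T T - K)"
  then show "\<Union>\<U> \<subseteq> G_T T" by blast
  have eq: "G_T T - \<Union>\<U> = G_T T \<inter> \<Inter>((\<lambda>K. G_T T - K) ` \<U>)" by auto
  show "zariski_closed T (G_T T - \<Union>\<U>)"
    unfolding eq by (rule zariski_closed_Inter) (use U in force)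
qed

lemma openin_zariski:
  "openin (zariski T) U \<longleftrightarrow> U \<subseteq> G_T T \<and> zariski_closed T (G_T T - U)"
  unfolding zariski_def topology_inverse'[OF istopology_zariski] ..

lemma topspace_zariski [simp]: "topspace (zariski T) = G_T T"
proof
  show "topspace (zariski T) \<subseteq> G_T T"
    using openin_topspace[of "zariski T"] unfolding openin_zariski by (rule conjunct1)
  have "openin (zariski T) (G_T T)"
    unfolding openin_zariski using zariski_closed_empty by simp
  then show "G_T T \<subseteq> topspace (zariski T)"
    by (rule openin_subset)
qed

text \<open>The minimum number of generators shared by all ideals of a nonempty dense open subset (any
  two dense open subsets of a nonempty space meet, so there is at most one such number).\<close>

definition generic_gens :: "'k::field bipoly set topology \<Rightarrow> nat" where
  "generic_gens X = (THE n. \<exists>U. openin X U \<and> U \<noteq> {} \<and> X closure_of U = topspace X \<and>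
     (\<forall>I\<in>U. min_gens I = n))"

section \<open>Partitions, Jordan cells, special partitions\<close>

text \<open>A partition is the list of its positive parts in weakly decreasing order, so that
  \<open>P ! b\<close> is the part p_(b+1).\<close>

definition is_partition :: "nat list \<Rightarrow> bool" where
  "is_partition P \<longleftrightarrow> sorted_wrt (\<ge>) P \<and> (\<forall>p\<in>set P. 0 < p)"

definition C_mons :: "nat list \<Rightarrow> (nat \<times> nat) set" where
  "C_mons P = {(a, b). b < length P \<and> a < P ! b}"

definition E_ideal :: "nat list \<Rightarrow> 'k::field bipoly set" where
  "E_ideal P = ideals.span (monom2 ` (- C_mons P))"

definition diagonal_lengths :: "'k::field itself \<Rightarrow> nat list \<Rightarrow> nat \<Rightarrow> nat" where
  "diagonal_lengths _ P = hilbert_fun (E_ideal P :: 'k bipoly set)"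

definition jordan_cell :: "nat list \<Rightarrow> 'k::field bipoly set set" where
  "jordan_cell P = {I. graded_ideal I \<and> init_ideal I = E_ideal P}"

text \<open>An ideal and its initial ideal have the same Hilbert function, so the cell is a subvariety of
  G_T for T the diagonal lengths of P and carries the subspace topology.\<close>

definition kappa_P :: "'k::field itself \<Rightarrow> nat list \<Rightarrow> nat" where
  "kappa_P K P =
     generic_gens (subtopology (zariski (diagonal_lengths K P)) (jordan_cell P :: 'k bipoly set set))"

definition kappa_T :: "'k::field itself \<Rightarrow> (nat \<Rightarrow> nat) \<Rightarrow> nat" where
  "kappa_T _ T = generic_gens (zariski T :: 'k bipoly set topology)"

definition partitions_of_diag :: "'k::field itself \<Rightarrow> (nat \<Rightarrow> nat) \<Rightarrow> nat list set" where
  "partitions_of_diag K T = {P. is_partition P \<and> diagonal_lengths K P = T}"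

definition special_partitions :: "'k::field itself \<Rightarrow> (nat \<Rightarrow> nat) \<Rightarrow> nat list set" where
  "special_partitions K T = {P \<in> partitions_of_diag K T. kappa_P K P > kappa_T K T}"

text \<open>
  T_i = (1, 2, \<dots>, t_(i-1) - t_(i+1), t_i - t_(i+1), 0).  If t_(i-1) = t_(i+1) this is the zero
  sequence, and if t_i = t_(i+1) it is (1, 2, \<dots>, t_(i-1) - t_i, 0).
\<close>

definition T_slice :: "(nat \<Rightarrow> nat) \<Rightarrow> nat \<Rightarrow> nat \<Rightarrow> nat" where
  "T_slice t i k =
     (if k < t (i - 1) - t (i + 1) then k + 1
      else if k = t (i - 1) - t (i + 1) then t i - t (i + 1)
      else 0)"

end

theory Submission
  imports Defs "HOL-Computational_Algebra.Polynomial"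
begin

text \<open>
  Let \<open>n b\<close> be the least degree of a monomial \<open>x^a y^b\<close> in \<open>E_P\<close>.  Setting \<open>x = 1\<close> turns initial
  monomials of forms into leading monomials of polynomials in \<open>y\<close>, and an ideal of the cell of \<open>P\<close>
  acquires monic polynomials \<open>g_b\<close> of degree \<open>b\<close> such that its part of degree \<open>i\<close> is spanned by the
  \<open>g_b\<close> with \<open>n b \<le> i\<close>.  Stability under \<open>y\<close> means that \<open>y g_b\<close> is \<open>g_(b+1)\<close> plus a combination
  of the \<open>g_c\<close> with \<open>c \<le> b\<close> and \<open>n c \<le> n b + 1\<close>.  Every choice of coefficients gives an ideal of the
  cell, and every ideal of the cell arises (\<open>cell_ideal_in_jordan_cell\<close>,
  \<open>jordan_cell_is_cell_ideal\<close>).  So the cell is the image of an affine space, and two nonempty open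
  subsets of it meet (\<open>cell_meets_both\<close>).

  By Nakayama's lemma (\<open>min_gens_eq\<close>) the number of generators is the sum over all degrees of the
  codimension of \<open>(x, y) I\<close> in \<open>I\<close>.  From degree \<open>i\<close> to \<open>i + 1\<close> this codimension is the number of
  columns minus the rank of the matrix with rows \<open>n c = i\<close>, columns \<open>n b = i + 1\<close>, ones at \<open>b = c + 1\<close>, zeros for larger
  \<open>b\<close>, and free entries elsewhere.  Since different degrees use different coefficients, the generic
  number of generators of the cell is obtained by maximising each rank separately (\<open>kappa_P_eq\<close>).

  In \<open>G_T\<close> the cell whose initial monomials are those of highest degree in \<open>y\<close> is dense, because the
  substitution of \<open>x + s y\<close> for \<open>x\<close> moves a generic ideal of every cell into it; this is where the
  characteristic matters (\<open>fewnomial_zero\<close>, \<open>kappa_T_eq\<close>).  In this cell all the matrices have full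
  generic rank (\<open>full_rank_big_cell\<close>).  Therefore a partition is special if and only if one of its
  matrices does not (\<open>special_iff_not_full_rank\<close>).

  The rest is counting.  A partition is the word \<open>n 0, n 1, ...\<close>, in which letters grow by at most
  one at a time and the multiplicity of each letter is prescribed by \<open>T\<close>.  The subwords of the pairs
  of letters \<open>i\<close>, \<open>i + 1\<close> determine the word and can be chosen independently (\<open>card_words\<close>), and
  full rank in degree \<open>i\<close> depends on one of them only (\<open>full_rank_pair_word\<close>).  The slice \<open>T_i\<close>
  prescribes the same multiplicities for a single such pair (\<open>hilbert_seq_slice\<close>).  So the numbers of
  all partitions and of nonspecial partitions of \<open>T\<close> are the products of the \<open>A_i\<close> and of the
  \<open>A_i - S_i\<close>, and their difference is expanded by inclusion and exclusion.
\<close>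

section \<open>Forms in two variables\<close>

text \<open>As a rewrite rule this reverses associativity, against \<open>ac_simps\<close> and \<open>algebra_simps\<close>.\<close>

declare ideals.scale_scale [simp del]

abbreviation lookup :: "('a \<Rightarrow>\<^sub>0 'b::zero) \<Rightarrow> 'a \<Rightarrow> 'b" where
  "lookup \<equiv> Poly_Mapping.lookup"

lemma lookup_cscale [simp]: "lookup (cscale c f) m = c * lookup f m"
  unfolding cscale_def mult_map_scale_conv_mult[symmetric]
  by (simp add: Poly_Mapping.map.rep_eq when_def)

lemma lookup_monom2_mult:
  "lookup (monom2 (u, v) * f) (a, b) =
     (if u \<le> a \<and> v \<le> b then lookup f (a - u, b - v) else 0)"
proof (induction f rule: update_induct)
  case const
  then show ?case by simp
next
  case (update f m c)
  have "Poly_Mapping.update m c f = f + Poly_Mapping.single m c"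
    using update by (intro poly_mapping_eqI)
      (auto simp: lookup_update lookup_add lookup_single in_keys_iff when_def)
  moreover have "lookup (monom2 (u, v) * Poly_Mapping.single m c) (a, b) =
     (if u \<le> a \<and> v \<le> b then lookup (Poly_Mapping.single m c) (a - u, b - v) else 0)"
    by (cases m) (auto simp: monom2_def mult_single lookup_single when_def)
  ultimately show ?case
    using update.IH by (simp add: distrib_left lookup_add)
qed

definition varx :: "'k::field bipoly" where "varx = monom2 (1, 0)"
definition vary :: "'k::field bipoly" where "vary = monom2 (0, 1)"

lemma lookup_varx_mult:
  "lookup (varx * f) (a, b) = (if a = 0 then 0 else lookup f (a - 1, b))"
  by (auto simp: varx_def lookup_monom2_mult)

lemma lookup_vary_mult:
  "lookup (vary * f) (a, b) = (if b = 0 then 0 else lookup f (a, b - 1))"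
  by (auto simp: vary_def lookup_monom2_mult)

lemma monom2_mult: "monom2 (a, b) * monom2 (c, d) = (monom2 (a + c, b + d) :: 'k::field bipoly)"
  by (simp add: monom2_def mult_single)

lemma cscale_mult: "f * cscale c g = cscale c (f * g)" "cscale c f * g = cscale c (f * g)"
  unfolding cscale_def by (rule mult.left_commute, rule mult.assoc)

lemma ideal_mult_induct:
  assumes "pvs.subspace W" "\<And>f. f \<in> W \<Longrightarrow> varx * f \<in> W" "\<And>f. f \<in> W \<Longrightarrow> vary * f \<in> W" "f \<in> W"
  shows "p * f \<in> W"
proof -
  have Y: "monom2 (0, b) * f \<in> W" for b
  proof (induction b)
    case 0
    then show ?case using assms(4) by (simp add: monom2_def flip: zero_prod_def)
  next
    case (Suc b)
    have "monom2 (0, Suc b) * f = vary * (monom2 (0, b) * f)"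
      by (simp add: mult.assoc[symmetric] monom2_mult varx_def vary_def)
    then show ?case using assms(3)[OF Suc] by simp
  qed
  have m: "monom2 (a, b) * f \<in> W" for a b
  proof (induction a)
    case 0
    then show ?case using Y by simp
  next
    case (Suc a)
    have "monom2 (Suc a, b) * f = varx * (monom2 (a, b) * f)"
      by (simp add: mult.assoc[symmetric] monom2_mult varx_def vary_def)
    then show ?case using assms(2)[OF Suc] by simp
  qed
  show ?thesis
  proof (induction p rule: update_induct)
    case const
    then show ?case using assms(1) by (simp add: pvs.subspace_0)
  next
    case (update p k c)
    have eq: "Poly_Mapping.update k c p = p + cscale c (monom2 k)"
      using update.hyps by (intro poly_mapping_eqI)
        (auto simp: lookup_update lookup_add lookup_single in_keys_iff when_def monom2_def)
    have "cscale c (monom2 k * f) \<in> W"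
      using m[of "fst k" "snd k"] by (intro pvs.subspace_scale[OF assms(1)]) simp
    then have "p * f + cscale c (monom2 k * f) \<in> W"
      by (intro pvs.subspace_add[OF assms(1)] update.IH)
    then show ?case unfolding eq distrib_right cscale_mult .
  qed
qed

lemma ideal_subspaceI:
  assumes "pvs.subspace W" "\<And>f. f \<in> W \<Longrightarrow> varx * f \<in> W" "\<And>f. f \<in> W \<Longrightarrow> vary * f \<in> W"
  shows "ideals.subspace W"
  unfolding ideals.subspace_def
proof (intro conjI ballI allI)
  show "0 \<in> W" using assms(1) by (rule pvs.subspace_0)
  show "f + g \<in> W" if "f \<in> W" "g \<in> W" for f g
    using assms(1) that by (rule pvs.subspace_add)
  show "p * f \<in> W" if "f \<in> W" for p f
    using assms that by (rule ideal_mult_induct)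
qed

lemma ideal_subspaceD:
  assumes "ideals.subspace W"
  shows "pvs.subspace W"
  using assms unfolding ideals.subspace_def pvs.subspace_def by (simp add: cscale_def)

lemma lookup_hom_component:
  "lookup (hom_component i f) m = (if mdeg m = i then lookup f m else 0)"
  unfolding hom_component_def lookup_sum
  by (auto simp: lookup_single when_def in_keys_iff sum.delta' cong: if_cong)

lemma forms_iff: "f \<in> forms i \<longleftrightarrow> (\<forall>m. mdeg m \<noteq> i \<longrightarrow> lookup f m = 0)"
  by (auto simp: forms_def in_keys_iff)

lemma forms_eqI:
  assumes "f \<in> forms i" "g \<in> forms i"
    and "\<And>b. b \<le> i \<Longrightarrow> lookup f (i - b, b) = lookup g (i - b, b)"
  shows "f = g"
proof (rule poly_mapping_eqI)
  fix m :: "nat \<times> nat"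
  show "lookup f m = lookup g m"
  proof (cases "mdeg m = i")
    case True
    then have "m = (i - snd m, snd m)" "snd m \<le> i" by (auto simp: mdeg_def prod_eq_iff)
    then show ?thesis using assms(3)[of "snd m"] by metis
  next
    case False
    then show ?thesis using assms(1,2) unfolding forms_iff by metis
  qed
qed

lemma subspace_forms: "pvs.subspace (forms i)"
  by (auto simp: pvs.subspace_def forms_iff lookup_add)

lemma hom_component_in_forms: "hom_component i f \<in> forms i"
  by (simp add: forms_iff lookup_hom_component)

lemma hom_component_forms: "f \<in> forms j \<Longrightarrow> hom_component i f = (if i = j then f else 0)"
  by (intro poly_mapping_eqI) (auto simp: lookup_hom_component forms_iff)

lemma hom_component_add: "hom_component i (f + g) = hom_component i f + hom_component i g"
  by (intro poly_mapping_eqI) (simp add: lookup_hom_component lookup_add)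

lemma hom_component_cscale: "hom_component i (cscale c f) = cscale c (hom_component i f)"
  by (intro poly_mapping_eqI) (simp add: lookup_hom_component)

lemma hom_component_0 [simp]: "hom_component i 0 = 0"
  by (intro poly_mapping_eqI) (simp add: lookup_hom_component)

lemma hom_component_sum: "hom_component i (sum f A) = (\<Sum>a\<in>A. hom_component i (f a))"
  by (induction A rule: infinite_finite_induct) (simp_all add: hom_component_add)

lemma mult_var_forms:
  assumes "f \<in> forms i"
  shows "varx * f \<in> forms (Suc i)" "vary * f \<in> forms (Suc i)"
  using assms by (auto simp: forms_iff lookup_varx_mult lookup_vary_mult mdeg_def)

lemma hom_component_var_mult:
  "hom_component (Suc i) (varx * f) = varx * hom_component i f"
  "hom_component (Suc i) (vary * f) = vary * hom_component i f"
  by (auto intro!: poly_mapping_eqI simp: lookup_varx_mult lookup_vary_mult lookup_hom_component mdeg_def)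

lemma hom_component_0_var_mult:
  "hom_component 0 (varx * f) = 0" "hom_component 0 (vary * f) = 0"
  by (auto intro!: poly_mapping_eqI simp: lookup_varx_mult lookup_vary_mult lookup_hom_component mdeg_def)

lemma sum_hom_components:
  assumes "\<And>m. m \<in> Poly_Mapping.keys f \<Longrightarrow> mdeg m < N"
  shows "f = (\<Sum>i<N. hom_component i f)"
proof (rule poly_mapping_eqI)
  fix m
  show "lookup f m = lookup (\<Sum>i<N. hom_component i f) m"
    using assms[of m] by (auto simp: lookup_sum lookup_hom_component in_keys_iff)
qed

lemma ex_degree_bound: "\<exists>N. \<forall>m \<in> Poly_Mapping.keys f. mdeg m < N"
proof -
  have "finite (mdeg ` Poly_Mapping.keys f)" by simp
  then show ?thesis using finite_nat_set_iff_bounded by auto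
qed

lemma in_subspace_if_components:
  assumes "pvs.subspace W" "\<And>i. hom_component i f \<in> W"
  shows "f \<in> W"
proof -
  obtain N where "\<forall>m \<in> Poly_Mapping.keys f. mdeg m < N" using ex_degree_bound by blast
  then have "f = (\<Sum>i<N. hom_component i f)" by (intro sum_hom_components) auto
  then show ?thesis using assms by (metis (no_types, lifting) pvs.subspace_sum)
qed

lemma graded_ideal_iff_components:
  assumes "graded_ideal I"
  shows "f \<in> I \<longleftrightarrow> (\<forall>i. hom_component i f \<in> I \<inter> forms i)"
  using assms in_subspace_if_components[of I f] ideal_subspaceD[of I]
  by (auto simp: graded_ideal_def hom_component_in_forms)

text \<open>Graded ideals are the same as chains of spaces of forms that are closed under
  multiplication by the two variables.\<close>

definition chain_ideal :: "(nat \<Rightarrow> 'k::field bipoly set) \<Rightarrow> 'k bipoly set" where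
  "chain_ideal W = {f. \<forall>i. hom_component i f \<in> W i}"

lemma chain_ideal:
  assumes sub: "\<And>i. pvs.subspace (W i)" and deg: "\<And>i. W i \<subseteq> forms i"
    and x: "\<And>i f. f \<in> W i \<Longrightarrow> varx * f \<in> W (Suc i)"
    and y: "\<And>i f. f \<in> W i \<Longrightarrow> vary * f \<in> W (Suc i)"
  shows "graded_ideal (chain_ideal W)" and "chain_ideal W \<inter> forms i = W i"
proof -
  have 0: "0 \<in> W i" for i using sub by (rule pvs.subspace_0)
  have "ideals.subspace (chain_ideal W)"
  proof (rule ideal_subspaceI)
    show "pvs.subspace (chain_ideal W)"
      using sub unfolding chain_ideal_def
      by (auto simp: pvs.subspace_def hom_component_add hom_component_cscale)
    fix f assume f: "f \<in> chain_ideal W"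
    have "hom_component i (varx * f) \<in> W i \<and> hom_component i (vary * f) \<in> W i" for i
      using f x y 0 unfolding chain_ideal_def
      by (cases i) (auto simp: hom_component_0_var_mult hom_component_var_mult)
    then show "varx * f \<in> chain_ideal W" "vary * f \<in> chain_ideal W"
      unfolding chain_ideal_def by auto
  qed
  moreover have "W j \<subseteq> chain_ideal W" for j
    using deg[of j] 0 unfolding chain_ideal_def by (auto simp: hom_component_forms)
  ultimately show "graded_ideal (chain_ideal W)"
    unfolding graded_ideal_def chain_ideal_def by blast
  show "chain_ideal W \<inter> forms i = W i"
  proof
    show "chain_ideal W \<inter> forms i \<subseteq> W i"
      unfolding chain_ideal_def by (auto dest: spec[of _ i] simp: hom_component_forms)
    show "W i \<subseteq> chain_ideal W \<inter> forms i"
      using \<open>W i \<subseteq> chain_ideal W\<close> deg[of i] by blast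
  qed
qed

lemma graded_ideal_eqI:
  assumes "graded_ideal I" "graded_ideal J" "\<And>i. I \<inter> forms i = J \<inter> forms i"
  shows "I = J"
  using graded_ideal_iff_components[OF assms(1)] graded_ideal_iff_components[OF assms(2)] assms(3)
  by blast

lemma graded_ideal_component:
  assumes "graded_ideal I"
  shows "pvs.subspace (I \<inter> forms i)"
    and "f \<in> I \<inter> forms i \<Longrightarrow> varx * f \<in> I \<inter> forms (Suc i)"
    and "f \<in> I \<inter> forms i \<Longrightarrow> vary * f \<in> I \<inter> forms (Suc i)"
proof -
  have I: "ideals.subspace I" using assms by (simp add: graded_ideal_def)
  show "pvs.subspace (I \<inter> forms i)"
    by (intro pvs.subspace_inter ideal_subspaceD I subspace_forms)
  show "f \<in> I \<inter> forms i \<Longrightarrow> varx * f \<in> I \<inter> forms (Suc i)"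
    "f \<in> I \<inter> forms i \<Longrightarrow> vary * f \<in> I \<inter> forms (Suc i)"
    using ideals.subspace_scale[OF I] mult_var_forms by blast+
qed

subsection \<open>Homogenisation\<close>

text \<open>A form of degree \<open>i\<close> is recorded by the polynomial in \<open>y\<close> obtained from \<open>x = 1\<close>; then the
  initial monomial becomes the leading monomial, and multiplication by \<open>x\<close> becomes invisible.\<close>

definition homog :: "nat \<Rightarrow> 'k::field poly \<Rightarrow> 'k bipoly" where
  "homog i g = (\<Sum>b\<le>i. Poly_Mapping.single (i - b, b) (coeff g b))"

lemma lookup_homog:
  "lookup (homog i g) m = (if mdeg m = i then coeff g (snd m) else 0)"
proof -
  have "(\<Sum>b\<le>i. lookup (Poly_Mapping.single (i - b, b) (coeff g b)) m) =
     (\<Sum>b\<le>i. if b = snd m \<and> mdeg m = i then coeff g b else 0)"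
    by (intro sum.cong) (auto simp: lookup_single when_def mdeg_def)
  also have "\<dots> = (if mdeg m = i then coeff g (snd m) else 0)"
    by (auto simp: mdeg_def)
  finally show ?thesis by (simp add: homog_def lookup_sum)
qed

lemma homog_in_forms: "homog i g \<in> forms i"
  by (simp add: forms_iff lookup_homog)

lemma homog_add: "homog i (f + g) = homog i f + homog i g"
  and homog_diff: "homog i (f - g) = homog i f - homog i g"
  and homog_smult: "homog i (smult c f) = cscale c (homog i f)"
  and homog_0 [simp]: "homog i 0 = 0"
  by (auto intro!: poly_mapping_eqI simp: lookup_homog lookup_add lookup_minus)

lemma homog_sum: "homog i (sum f A) = (\<Sum>a\<in>A. homog i (f a))"
  by (induction A rule: infinite_finite_induct) (simp_all add: homog_add)

lemma homog_eq_iff: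
  assumes "degree f \<le> i" "degree g \<le> i"
  shows "homog i f = homog i g \<longleftrightarrow> f = g"
proof
  assume eq: "homog i f = homog i g"
  show "f = g"
  proof (rule poly_eqI)
    fix b
    show "coeff f b = coeff g b"
    proof (cases "b \<le> i")
      case True
      then show ?thesis
        using arg_cong[OF eq, of "\<lambda>h. lookup h (i - b, b)"]
        by (simp add: lookup_homog mdeg_def)
    next
      case False
      then show ?thesis using assms by (simp add: coeff_eq_0)
    qed
  qed
qed simp

lemma homog_eq_0_iff: "degree f \<le> i \<Longrightarrow> homog i f = 0 \<longleftrightarrow> f = 0"
  using homog_eq_iff[of f i 0] by simp

lemma varx_homog: "degree g \<le> i \<Longrightarrow> varx * homog i g = homog (Suc i) g"
proof (rule poly_mapping_eqI)
  fix m assume "degree g \<le> i"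
  then show "lookup (varx * homog i g) m = lookup (homog (Suc i) g) m"
    by (cases m) (auto simp: lookup_varx_mult lookup_vary_mult lookup_homog mdeg_def intro!: coeff_eq_0)
qed

lemma vary_homog: "vary * homog i g = homog (Suc i) (pCons 0 g)"
proof (rule poly_mapping_eqI)
  fix m
  show "lookup (vary * homog i g) m = lookup (homog (Suc i) (pCons 0 g)) m"
    by (cases m; cases "snd m") (auto simp: lookup_varx_mult lookup_vary_mult lookup_homog mdeg_def)
qed

lemma forms_homogE:
  assumes "f \<in> forms i"
  obtains g where "degree g \<le> i" "f = homog i g"
proof
  let ?g = "\<Sum>b\<le>i. monom (lookup f (i - b, b)) b"
  show "degree ?g \<le> i"
    by (intro degree_sum_le) (auto intro: order_trans[OF degree_monom_le])
  show "f = homog i ?g"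
    using assms homog_in_forms
    by (rule forms_eqI) (auto simp: lookup_homog mdeg_def coeff_sum)
qed

text \<open>The exponents of \<open>y\<close> in the initial monomials of the forms of degree \<open>i\<close> in \<open>I\<close>.\<close>

definition lead_exps :: "'k::field bipoly set \<Rightarrow> nat \<Rightarrow> nat set" where
  "lead_exps I i = {degree g | g. g \<noteq> 0 \<and> degree g \<le> i \<and> homog i g \<in> I}"

lemma lead_exps_le: "b \<in> lead_exps I i \<Longrightarrow> b \<le> i"
  by (auto simp: lead_exps_def)

lemma finite_lead_exps [simp]: "finite (lead_exps I i)"
  using lead_exps_le finite_subset[of "lead_exps I i" "{..i}"] by blast

lemma lead_exps_monicE:
  assumes "pvs.subspace (I \<inter> forms i)" "b \<in> lead_exps I i"
  obtains g where "degree g = b" "lead_coeff g = 1" "homog i g \<in> I"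
proof -
  obtain g where g: "g \<noteq> 0" "degree g = b" "homog i g \<in> I"
    using assms(2) by (auto simp: lead_exps_def)
  have "homog i (smult (inverse (lead_coeff g)) g) \<in> I \<inter> forms i"
    unfolding homog_smult using g homog_in_forms by (intro pvs.subspace_scale[OF assms(1)]) auto
  with g show ?thesis
    by (intro that[of "smult (inverse (lead_coeff g)) g"]) auto
qed

text \<open>Elements with prescribed leading exponents span, by division with remainder.\<close>

lemma in_span_of_lead_exps:
  assumes sub: "pvs.subspace (I \<inter> forms i)"
    and G: "\<And>b. b \<in> lead_exps I i \<Longrightarrow> degree (G b) = b \<and> lead_coeff (G b) = 1 \<and> homog i (G b) \<in> I"
    and g: "degree g \<le> i" "homog i g \<in> I" "degree g \<le> k"
  shows "homog i g \<in> pvs.span ((\<lambda>b. homog i (G b)) ` {b \<in> lead_exps I i. b \<le> k})"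
  using g
proof (induction "degree g" arbitrary: g k rule: less_induct)
  case less
  let ?S = "(\<lambda>b. homog i (G b)) ` {b \<in> lead_exps I i. b \<le> k}"
  show ?case
  proof (cases "g = 0")
    case True
    then show ?thesis by (simp add: pvs.span_zero)
  next
    case False
    let ?b = "degree g" and ?c = "lead_coeff g"
    have b: "?b \<in> lead_exps I i" using less.prems False by (auto simp: lead_exps_def)
    have Gb: "degree (G ?b) = ?b" "lead_coeff (G ?b) = 1" "homog i (G ?b) \<in> I" using G[OF b] by auto
    define h where "h = g - smult ?c (G ?b)"
    have "homog i h = homog i g - cscale ?c (homog i (G ?b))"
      by (simp add: h_def homog_diff homog_smult)
    also have "\<dots> \<in> I \<inter> forms i"
      using less.prems Gb homog_in_forms
      by (intro pvs.subspace_diff[OF sub] pvs.subspace_scale[OF sub]) auto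
    finally have hI: "homog i h \<in> I" by simp
    have base: "homog i (G ?b) \<in> pvs.span ?S"
      using b less.prems by (intro pvs.span_base) auto
    have "homog i h \<in> pvs.span ?S"
    proof (cases "h = 0")
      case True
      then show ?thesis by (simp add: pvs.span_zero)
    next
      case False
      have "degree h \<le> ?b"
        unfolding h_def using Gb by (intro degree_diff_le) auto
      moreover have "coeff h ?b = 0" using Gb by (simp add: h_def)
      ultimately have "degree h < ?b"
        using False by (metis le_neq_implies_less leading_coeff_0_iff)
      then show ?thesis
        using less.prems hI by (intro less.hyps) auto
    qed
    then have "homog i h + cscale ?c (homog i (G ?b)) \<in> pvs.span ?S"
      using base by (intro pvs.span_add pvs.span_scale)
    then show ?thesis by (simp add: h_def homog_diff homog_smult)
  qed
qed

text \<open>Families rather than sets, so that a repeated vector counts as a dependence, and coordinates of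
  any kind, so that projections and rows of matrices are covered.\<close>

definition indep_fam :: "'i set \<Rightarrow> ('i \<Rightarrow> 'm \<Rightarrow> 'k::field) \<Rightarrow> bool" where
  "indep_fam S v \<longleftrightarrow> (\<forall>u. (\<forall>m. (\<Sum>r\<in>S. u r * v r m) = 0) \<longrightarrow> (\<forall>r\<in>S. u r = 0))"

lemma indep_famD:
  "indep_fam S v \<Longrightarrow> (\<And>m. (\<Sum>r\<in>S. u r * v r m) = 0) \<Longrightarrow> r \<in> S \<Longrightarrow> u r = 0"
  unfolding indep_fam_def by blast

lemma indep_fam_iff_independent:
  assumes "finite S"
  shows "indep_fam S (\<lambda>r. lookup (F r)) \<longleftrightarrow> inj_on F S \<and> pvs.independent (F ` S)"
proof
  assume *: "indep_fam S (\<lambda>r. lookup (F r))"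
  have sum0: "u r = 0" if "(\<Sum>r\<in>S. cscale (u r) (F r)) = 0" "r \<in> S" for u r
  proof (rule indep_famD[OF * _ that(2)])
    fix m
    show "(\<Sum>r\<in>S. u r * lookup (F r) m) = 0"
      using arg_cong[OF that(1), of "\<lambda>f. lookup f m"] by (simp add: lookup_sum)
  qed
  have inj: "inj_on F S"
  proof (rule inj_onI, rule ccontr)
    fix r s assume rs: "r \<in> S" "s \<in> S" "F r = F s" "r \<noteq> s"
    let ?u = "\<lambda>q. if q = r then 1 else if q = s then -1 else (0::'b)"
    have "(\<Sum>q\<in>S. cscale (?u q) (F q)) = (\<Sum>q\<in>{r, s}. cscale (?u q) (F q))"
      using rs assms by (intro sum.mono_neutral_right) auto
    also have "\<dots> = 0" using rs by simp
    finally show False using sum0[of ?u r] rs by simp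
  qed
  moreover have "pvs.independent (F ` S)"
  proof (rule pvs.independent_if_scalars_zero)
    fix u f assume u: "(\<Sum>f\<in>F ` S. cscale (u f) f) = 0" and f: "f \<in> F ` S"
    obtain r where r: "r \<in> S" "f = F r" using f by (rule imageE)
    have "(\<Sum>r\<in>S. cscale (u (F r)) (F r)) = 0"
      using u unfolding sum.reindex[OF inj] comp_def .
    then show "u f = 0" using sum0[of "\<lambda>r. u (F r)"] r by simp
  qed (use assms in simp)
  ultimately show "inj_on F S \<and> pvs.independent (F ` S)" by blast
next
  assume *: "inj_on F S \<and> pvs.independent (F ` S)"
  show "indep_fam S (\<lambda>r. lookup (F r))"
    unfolding indep_fam_def
  proof (intro allI impI ballI)
    fix u r assume u: "\<forall>m. (\<Sum>r\<in>S. u r * lookup (F r) m) = 0" and r: "r \<in> S"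
    have inv: "the_inv_into S F (F r) = r" if "r \<in> S" for r
      using that * by (simp add: the_inv_into_f_f)
    have "(\<Sum>r\<in>S. cscale (u r) (F r)) = 0"
      using u by (intro poly_mapping_eqI) (simp add: lookup_sum del: split_paired_All)
    then have "(\<Sum>f\<in>F ` S. cscale (u (the_inv_into S F f)) f) = 0"
      using * inv by (simp add: sum.reindex)
    then have "u (the_inv_into S F (F r)) = 0"
      using * r assms pvs.independentD[of "F ` S" "F ` S" "\<lambda>f. u (the_inv_into S F f)" "F r"] by simp
    then show "u r = 0" using inv r by simp
  qed
qed

lemma indep_fam_card_eq_dim:
  assumes "finite S" "indep_fam S (\<lambda>r. lookup (F r))"
  shows "pvs.dim (pvs.span (F ` S)) = card S"
  using assms indep_fam_iff_independent[OF assms(1), of F]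
  by (simp add: pvs.dim_span_eq_card_independent card_image del: pvs.dim_span)

lemma indep_fam_homog:
  assumes "\<And>r. r \<in> S \<Longrightarrow> degree (g r) \<le> i"
  shows "indep_fam S (\<lambda>r. lookup (homog i (g r))) \<longleftrightarrow> indep_fam S (\<lambda>r. coeff (g r))"
proof -
  have "(\<forall>m. (\<Sum>r\<in>S. u r * lookup (homog i (g r)) m) = 0) \<longleftrightarrow>
      (\<forall>b. (\<Sum>r\<in>S. u r * coeff (g r) b) = 0)" (is "?L \<longleftrightarrow> ?R") for u
  proof
    assume L: ?L
    show ?R
    proof
      fix b
      show "(\<Sum>r\<in>S. u r * coeff (g r) b) = 0"
      proof (cases "b \<le> i")
        case True
        then show ?thesis using L[rule_format, of "(i - b, b)"] by (simp add: lookup_homog mdeg_def)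
      next
        case False
        then show ?thesis
          using assms by (intro sum.neutral ballI) (simp add: coeff_eq_0 le_less_trans[of _ i b])
      qed
    qed
  next
    assume R: ?R
    show ?L
    proof
      fix m
      show "(\<Sum>r\<in>S. u r * lookup (homog i (g r)) m) = 0"
        using R by (cases "mdeg m = i") (simp_all add: lookup_homog)
    qed
  qed
  then show ?thesis unfolding indep_fam_def by simp
qed

text \<open>The term of largest index with nonzero coefficient would be alone in its degree.\<close>

lemma indep_fam_distinct_degrees:
  assumes "finite S" "\<And>b. b \<in> S \<Longrightarrow> degree (g b) = b \<and> g b \<noteq> 0"
  shows "indep_fam S (\<lambda>b. coeff (g b))"
  unfolding indep_fam_def
proof (intro allI impI ballI, rule ccontr)
  fix u r assume u: "\<forall>m. (\<Sum>r\<in>S. u r * coeff (g r) m) = 0" and r: "r \<in> S" "u r \<noteq> 0"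
  define M where "M = Max {b \<in> S. u b \<noteq> 0}"
  have M: "M \<in> S" "u M \<noteq> 0" and le: "\<And>b. b \<in> S \<Longrightarrow> u b \<noteq> 0 \<Longrightarrow> b \<le> M"
    using Max_in[of "{b \<in> S. u b \<noteq> 0}"] assms(1) r unfolding M_def by auto
  have "(\<Sum>r\<in>S. u r * coeff (g r) M) = (\<Sum>r\<in>{M}. u r * coeff (g r) M)"
  proof (intro sum.mono_neutral_right ballI)
    fix b assume b: "b \<in> S - {M}"
    show "u b * coeff (g b) M = 0"
    proof (cases "u b = 0")
      case False
      then have "degree (g b) < M" using b le[of b] assms(2)[of b] by auto
      then show ?thesis by (simp add: coeff_eq_0)
    qed simp
  qed (use M assms in auto)
  then show False using u M assms(2)[of M] by (metis (no_types, lifting) finite.emptyI leading_coeff_0_iff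
    mult_eq_0_iff sum.insert sum.empty add.right_neutral empty_iff)
qed

text \<open>Monic elements with the different leading exponents form a basis.\<close>

lemma card_lead_exps:
  assumes "graded_ideal I"
  shows "pvs.dim (I \<inter> forms i) = card (lead_exps I i)"
proof -
  note sub = graded_ideal_component(1)[OF assms, of i]
  have "\<exists>g. degree g = b \<and> lead_coeff g = 1 \<and> homog i g \<in> I" if "b \<in> lead_exps I i" for b
    using lead_exps_monicE[OF sub that] by metis
  then obtain G where G: "\<And>b. b \<in> lead_exps I i \<Longrightarrow> degree (G b) = b \<and> lead_coeff (G b) = 1 \<and> homog i (G b) \<in> I"
    by metis
  let ?F = "\<lambda>b. homog i (G b)"
  have "pvs.span (?F ` lead_exps I i) = I \<inter> forms i"
  proof
    show "pvs.span (?F ` lead_exps I i) \<subseteq> I \<inter> forms i"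
      using G homog_in_forms by (intro pvs.span_minimal sub) auto
    show "I \<inter> forms i \<subseteq> pvs.span (?F ` lead_exps I i)"
    proof
      fix f assume f: "f \<in> I \<inter> forms i"
      then obtain g where g: "degree g \<le> i" "f = homog i g" by (auto elim: forms_homogE)
      have "f \<in> pvs.span (?F ` {b \<in> lead_exps I i. b \<le> i})"
        using in_span_of_lead_exps[OF sub G g(1) _ g(1)] f g by auto
      also have "{b \<in> lead_exps I i. b \<le> i} = lead_exps I i" using lead_exps_le by blast
      finally show "f \<in> pvs.span (?F ` lead_exps I i)" .
    qed
  qed
  moreover have "indep_fam (lead_exps I i) (\<lambda>b. lookup (?F b))"
    using G lead_exps_le
    by (subst indep_fam_homog) (fastforce intro!: indep_fam_distinct_degrees)+
  ultimately show ?thesis using indep_fam_card_eq_dim[of "lead_exps I i" ?F] by simp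
qed

lemma hilbert_fun_lead_exps:
  "graded_ideal I \<Longrightarrow> hilbert_fun I i = i + 1 - card (lead_exps I i)"
  by (simp add: hilbert_fun_def card_lead_exps)

section \<open>Open conditions and curves\<close>

lemma frame_polys_sum:
  assumes "\<And>r. r \<in> S \<Longrightarrow> p r \<in> frame_polys T"
  shows "(\<lambda>B. \<Sum>r\<in>S. p r B) \<in> frame_polys T"
  using assms
  by (induction S rule: infinite_finite_induct)
     (auto intro: frame_polys.const frame_polys.add)

lemma frame_polys_cmult: "p \<in> frame_polys T \<Longrightarrow> (\<lambda>B. c * p B) \<in> frame_polys T"
  by (rule frame_polys.mult[OF frame_polys.const])

lemma frame_polys_diff:
  assumes "p \<in> frame_polys T" "q \<in> frame_polys T"
  shows "(\<lambda>B. p B - q B) \<in> frame_polys T"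
  using frame_polys.add[OF assms(1) frame_polys_cmult[OF assms(2), of "-1"]] by simp

text \<open>Gaussian elimination shows that independence is an open condition: some coordinate of one
  vector is nonzero, it clears this coordinate in the others, and the remaining vectors are
  polynomial in the frame again.\<close>

lemma indep_fam_open:
  fixes v :: "'i \<Rightarrow> (nat \<Rightarrow> nat \<Rightarrow> 'k::field bipoly) \<Rightarrow> 'm \<Rightarrow> 'k"
  assumes "finite S" "\<And>r m. r \<in> S \<Longrightarrow> (\<lambda>B. v r B m) \<in> frame_polys T" "indep_fam S (\<lambda>r. v r B0)"
  shows "\<exists>p \<in> frame_polys T. p B0 \<noteq> 0 \<and> (\<forall>B. p B \<noteq> 0 \<longrightarrow> indep_fam S (\<lambda>r. v r B))"
  using assms
proof (induction S arbitrary: v rule: finite_induct)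
  case empty
  show ?case
    by (rule bexI[of _ "\<lambda>B. 1"]) (auto simp: indep_fam_def intro: frame_polys.const)
next
  case (insert s S)
  have "\<exists>m. v s B0 m \<noteq> 0"
  proof (rule ccontr)
    assume *: "\<nexists>m. v s B0 m \<noteq> 0"
    have "(\<Sum>r\<in>insert s S. (if r = s then 1 else 0) * v r B0 m) = 0" for m
      using * insert.hyps by (intro sum.neutral) auto
    then have "(if s = s then 1 else 0 :: 'k) = 0"
      by (rule indep_famD[OF insert.prems(2)]) simp
    then show False by simp
  qed
  then obtain m0 where m0: "v s B0 m0 \<noteq> 0" by blast
  define w where "w = (\<lambda>r B m. v s B m0 * v r B m - v r B m0 * v s B m)"
  have key: "(\<Sum>r\<in>insert s S. (if r = s then - (\<Sum>q\<in>S. u q * v q B m0) else u r * v s B m0) * v r B m)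
      = (\<Sum>r\<in>S. u r * w r B m)" for u B m
  proof -
    have "(\<Sum>r\<in>S. (if r = s then - (\<Sum>q\<in>S. u q * v q B m0) else u r * v s B m0) * v r B m)
        = (\<Sum>r\<in>S. u r * v s B m0 * v r B m)"
      using insert.hyps by (intro sum.cong) auto
    then have "(\<Sum>r\<in>insert s S. (if r = s then - (\<Sum>q\<in>S. u q * v q B m0) else u r * v s B m0) * v r B m)
        = (\<Sum>r\<in>S. u r * v s B m0 * v r B m) - (\<Sum>q\<in>S. u q * v q B m0) * v s B m"
      using insert.hyps by simp
    also have "\<dots> = (\<Sum>r\<in>S. u r * w r B m)"
      unfolding sum_distrib_right sum_subtractf[symmetric] w_def
      by (intro sum.cong refl) (simp add: algebra_simps)
    finally show ?thesis .
  qed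
  have "indep_fam S (\<lambda>r. w r B0)"
    unfolding indep_fam_def
  proof (intro allI impI ballI)
    fix u r assume u: "\<forall>m. (\<Sum>r\<in>S. u r * w r B0 m) = 0" and r: "r \<in> S"
    let ?u = "\<lambda>r. if r = s then - (\<Sum>q\<in>S. u q * v q B0 m0) else u r * v s B0 m0"
    have "?u r = 0"
      by (rule indep_famD[OF insert.prems(2)]) (use u r key in auto)
    then show "u r = 0" using m0 r insert.hyps by (auto split: if_splits)
  qed
  moreover have "(\<lambda>B. w r B m) \<in> frame_polys T" if "r \<in> S" for r m
    unfolding w_def using insert.prems(1) that
    by (intro frame_polys_diff frame_polys.mult) auto
  ultimately obtain p where p: "p \<in> frame_polys T" "p B0 \<noteq> 0"
      and pw: "\<And>B. p B \<noteq> 0 \<Longrightarrow> indep_fam S (\<lambda>r. w r B)"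
    using insert.IH[of w] by blast
  show ?case
  proof (intro bexI conjI allI impI)
    show "(\<lambda>B. p B * v s B m0) \<in> frame_polys T"
      using p(1) insert.prems(1) by (intro frame_polys.mult) auto
    show "p B0 * v s B0 m0 \<noteq> 0" using p m0 by simp
    fix B assume B: "p B * v s B m0 \<noteq> 0"
    show "indep_fam (insert s S) (\<lambda>r. v r B)"
      unfolding indep_fam_def
    proof (intro allI impI)
      fix u assume u: "\<forall>m. (\<Sum>r\<in>insert s S. u r * v r B m) = 0"
      have eq: "u s * v s B m = - (\<Sum>r\<in>S. u r * v r B m)" for m
        using u[rule_format, of m] insert.hyps by (simp add: add_eq_0_iff2)
      have "(\<Sum>r\<in>S. u r * w r B m) = 0" for m
      proof -
        have "(\<Sum>r\<in>S. u r * w r B m)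
            = v s B m0 * (\<Sum>r\<in>S. u r * v r B m) - (\<Sum>r\<in>S. u r * v r B m0) * v s B m"
          unfolding sum_distrib_left sum_distrib_right sum_subtractf[symmetric] w_def
          by (intro sum.cong refl) (simp add: algebra_simps)
        also have "\<dots> = - (v s B m0 * (u s * v s B m)) + (u s * v s B m0) * v s B m"
          by (simp only: eq mult_minus_left mult_minus_right minus_minus diff_conv_add_uminus)
        also have "\<dots> = 0" by (simp add: algebra_simps)
        finally show ?thesis .
      qed
      note w0 = this
      have "p B \<noteq> 0" using B by simp
      note u0 = indep_famD[OF pw[OF this] w0]
      then have "u s * v s B m0 = 0" using eq[of m0] by simp
      then show "\<forall>r\<in>insert s S. u r = 0" using B u0 by (metis insertE mult_eq_0_iff)
    qed
  qed
qed

text \<open>The complement is cut out by all frame polynomials that vanish on it.\<close>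

lemma openin_zariskiI:
  fixes U :: "'k::field bipoly set set"
  assumes "U \<subseteq> G_T T"
    and "\<And>I B. I \<in> U \<Longrightarrow> frame T I B \<Longrightarrow> \<exists>p \<in> frame_polys T. p B \<noteq> 0 \<and>
       (\<forall>J\<in>G_T T. \<forall>B'. frame T J B' \<longrightarrow> p B' \<noteq> 0 \<longrightarrow> J \<in> U)"
  shows "openin (zariski T) U"
proof -
  let ?F = "{p \<in> frame_polys T. \<forall>J \<in> G_T T - U. \<forall>B. frame T J B \<longrightarrow> p B = 0}"
  have "zariski_closed T (G_T T - U)"
  proof (rule zariski_closedI[where F = ?F])
    fix I :: "'k bipoly set" and B assume I: "I \<in> G_T T" "frame T I B"
    show "I \<in> G_T T - U \<longleftrightarrow> (\<forall>p\<in>?F. p B = 0)"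
    proof
      assume "I \<in> G_T T - U"
      then show "\<forall>p\<in>?F. p B = 0" using I by blast
    next
      assume 0: "\<forall>p\<in>?F. p B = 0"
      show "I \<in> G_T T - U"
      proof (rule ccontr)
        assume "I \<notin> G_T T - U"
        then have IU: "I \<in> U" using I by blast
        obtain p where p: "p \<in> frame_polys T" "p B \<noteq> 0"
          and pU: "\<forall>J\<in>G_T T. \<forall>B'. frame T J B' \<longrightarrow> p B' \<noteq> 0 \<longrightarrow> J \<in> U"
          using assms(2)[OF IU I(2)] by (elim bexE conjE)
        have "p \<in> ?F" using p(1) pU by blast
        then show False using 0 p(2) by (metis (lifting))
      qed
    qed
  qed auto
  then show ?thesis using assms(1) by (simp add: openin_zariski)
qed

text \<open>Functions of the parameter of a curve, rather than polynomials, so that the coordinates of frames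
  can be combined pointwise.\<close>

definition polyfun :: "('k::field \<Rightarrow> 'k) \<Rightarrow> bool" where
  "polyfun f \<longleftrightarrow> (\<exists>q. \<forall>s. f s = poly q s)"

lemma polyfun_const: "polyfun (\<lambda>s. c)"
  unfolding polyfun_def by (rule exI[of _ "[:c:]"]) simp

lemma polyfun_id: "polyfun (\<lambda>s. s)"
  unfolding polyfun_def by (rule exI[of _ "[:0, 1:]"]) simp

lemma polyfun_add: "polyfun f \<Longrightarrow> polyfun g \<Longrightarrow> polyfun (\<lambda>s. f s + g s)"
  unfolding polyfun_def by (metis poly_add)

lemma polyfun_mult: "polyfun f \<Longrightarrow> polyfun g \<Longrightarrow> polyfun (\<lambda>s. f s * g s)"
  unfolding polyfun_def by (metis poly_mult)

lemma polyfun_diff: "polyfun f \<Longrightarrow> polyfun g \<Longrightarrow> polyfun (\<lambda>s. f s - g s)"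
  unfolding polyfun_def by (metis poly_diff)

lemma polyfun_power: "polyfun f \<Longrightarrow> polyfun (\<lambda>s. f s ^ n)"
  unfolding polyfun_def by (metis poly_power)

lemma polyfun_sum: "(\<And>r. r \<in> S \<Longrightarrow> polyfun (f r)) \<Longrightarrow> polyfun (\<lambda>s. \<Sum>r\<in>S. f r s)"
  by (induction S rule: infinite_finite_induct) (simp_all add: polyfun_const polyfun_add)

lemma polyfun_frame_poly:
  assumes "p \<in> frame_polys T"
    and "\<And>i r m. r < i + 1 - T i \<Longrightarrow> polyfun (\<lambda>s. lookup (B s i r) m)"
  shows "polyfun (\<lambda>s. p (B s))"
  using assms(1)
proof induction
  case (coord r i m)
  show ?case using coord(1) by (rule assms(2))
next
  case (const c)
  show ?case by (rule polyfun_const)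
next
  case (add p q)
  show ?case using add.IH by (rule polyfun_add)
next
  case (mult p q)
  show ?case using mult.IH by (rule polyfun_mult)
qed

text \<open>Each of the two conditions can only fail at the zeros of a nonzero polynomial in the parameter, and
  finitely many values do not exhaust an infinite field.\<close>

lemma curve_meets_both:
  fixes U W :: "'k::field bipoly set set"
  assumes inf: "infinite (UNIV :: 'k set)"
    and U: "openin (zariski T) U" and W: "openin (zariski T) W"
    and J: "\<And>s. J s \<in> G_T T" "\<And>s. frame T (J s) (B s)"
    and pol: "\<And>i r m. r < i + 1 - T i \<Longrightarrow> polyfun (\<lambda>s. lookup (B s i r) m)"
    and hit: "J s0 \<in> U" "J s1 \<in> W"
  shows "\<exists>s. J s \<in> U \<inter> W"
proof -
  have ex: "\<exists>p. polyfun p \<and> p s \<noteq> 0 \<and> (\<forall>s. p s \<noteq> 0 \<longrightarrow> J s \<in> X)"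
    if X: "openin (zariski T) X" "J s \<in> X" for X s
  proof -
    have cl: "zariski_closed T (G_T T - X)" using X(1) unfolding openin_zariski by (rule conjunct2)
    obtain F where F: "F \<subseteq> frame_polys T"
      and FX: "\<forall>I\<in>G_T T. \<forall>B. frame T I B \<longrightarrow> (I \<in> G_T T - X \<longleftrightarrow> (\<forall>p\<in>F. p B = 0))"
      using zariski_closedD[OF cl] by (elim exE conjE)
    have FJ: "J s \<in> X \<longleftrightarrow> (\<exists>p\<in>F. p (B s) \<noteq> 0)" for s
      using FX[rule_format, OF J(1,2), of s] J(1)[of s] by (simp, metis)
    obtain p where p: "p \<in> F" "p (B s) \<noteq> 0" using FJ X(2) by blast
    have "p \<in> frame_polys T" using F p(1) by (rule subsetD)
    then have "polyfun (\<lambda>s. p (B s))" using pol by (rule polyfun_frame_poly)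
    moreover have "\<forall>s. p (B s) \<noteq> 0 \<longrightarrow> J s \<in> X" using FJ p(1) by blast
    ultimately show ?thesis using p(2) by (intro exI[of _ "\<lambda>s. p (B s)"]) simp
  qed
  obtain p where p: "polyfun p" "p s0 \<noteq> 0" "\<forall>s. p s \<noteq> 0 \<longrightarrow> J s \<in> U"
    using ex[OF U hit(1)] by metis
  obtain q where q: "polyfun q" "q s1 \<noteq> 0" "\<forall>s. q s \<noteq> 0 \<longrightarrow> J s \<in> W"
    using ex[OF W hit(2)] by metis
  obtain p' q' where p': "\<And>s. p s = poly p' s" and q': "\<And>s. q s = poly q' s"
    using p(1) q(1) unfolding polyfun_def by metis
  have "p' \<noteq> 0" "q' \<noteq> 0" using p(2) q(2) unfolding p' q' by auto
  then have "finite {s. poly (p' * q') s = 0}" by (intro poly_roots_finite) simp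
  then obtain s where "poly (p' * q') s \<noteq> 0" using inf by (metis (mono_tags, lifting) UNIV_eq_I mem_Collect_eq)
  then have "p s \<noteq> 0" "q s \<noteq> 0" unfolding p' q' by auto
  then show ?thesis using p(3) q(3) by blast
qed

text \<open>A dense open set meets every nonempty open set, hence the number described is unique.\<close>

lemma generic_gens_eqI:
  assumes "openin X U" "U \<noteq> {}" "X closure_of U = topspace X" "\<And>I. I \<in> U \<Longrightarrow> min_gens I = n"
  shows "generic_gens X = n"
  unfolding generic_gens_def
proof (rule the_equality)
  show "\<exists>U. openin X U \<and> U \<noteq> {} \<and> X closure_of U = topspace X \<and> (\<forall>I\<in>U. min_gens I = n)"
    using assms by blast
  fix n' assume "\<exists>U. openin X U \<and> U \<noteq> {} \<and> X closure_of U = topspace X \<and> (\<forall>I\<in>U. min_gens I = n')"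
  then obtain V where V: "openin X V" "V \<noteq> {}" "\<And>I. I \<in> V \<Longrightarrow> min_gens I = n'" by blast
  have "U \<inter> V \<noteq> {}"
    using assms(3) V(1,2) by (metis dense_intersects_open inf_commute)
  then show "n' = n" using assms(4) V(3) by blast
qed

section \<open>Jordan cells\<close>

text \<open>\<open>hgt P b\<close> is the least degree of a monomial \<open>x^a y^b\<close> of \<open>E_P\<close>.  All that follows speaks of
  a partition through this function.\<close>

definition hgt :: "nat list \<Rightarrow> nat \<Rightarrow> nat" where
  "hgt P b = b + (if b < length P then P ! b else 0)"

definition height_fun :: "(nat \<Rightarrow> nat) \<Rightarrow> bool" where
  "height_fun n \<longleftrightarrow> (\<forall>b. b \<le> n b \<and> n (Suc b) \<le> Suc (n b)) \<and> (\<exists>M. \<forall>b\<ge>M. n b = b)"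

lemma height_funD:
  assumes "height_fun n"
  shows "b \<le> n b" "n (Suc b) \<le> Suc (n b)"
  using assms by (auto simp: height_fun_def)

lemma height_fun_hgt:
  assumes "is_partition P"
  shows "height_fun (hgt P)"
proof -
  have "P ! Suc b \<le> P ! b" if "Suc b < length P" for b
    using assms that by (auto simp: is_partition_def sorted_wrt_iff_nth_less)
  then have "hgt P (Suc b) \<le> Suc (hgt P b)" for b by (auto simp: hgt_def)
  then show ?thesis
    unfolding height_fun_def by (auto simp: hgt_def intro!: exI[of _ "length P"])
qed

lemma finite_height_le: "height_fun n \<Longrightarrow> finite {b. n b \<le> i}"
  by (rule finite_subset[of _ "{..i}"]) (auto intro: order_trans[OF height_funD(1)])

lemma card_height_le: "height_fun n \<Longrightarrow> card {b. n b \<le> i} \<le> i + 1"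
  using card_mono[of "{..i}" "{b. n b \<le> i}"] order_trans[OF height_funD(1)] by fastforce

lemma hgt_inject:
  assumes "is_partition P" "is_partition Q" "hgt P = hgt Q"
  shows "P = Q"
proof -
  have eq: "(if b < length P then P ! b else 0) = (if b < length Q then Q ! b else 0)" for b
    using fun_cong[OF assms(3), of b] by (simp add: hgt_def)
  have pos: "b < length P \<Longrightarrow> 0 < P ! b" "b < length Q \<Longrightarrow> 0 < Q ! b" for b
    using assms(1,2) by (auto simp: is_partition_def)
  have "b < length P \<longleftrightarrow> b < length Q" for b
    using eq[of b] pos[of b] by (auto split: if_splits)
  then have "length P = length Q" by (metis linorder_neq_iff)
  then show ?thesis using eq by (intro nth_equalityI) (simp, metis)
qed

text \<open>Since \<open>b \<le> n b\<close> and \<open>n\<close> grows by at most one, \<open>n b = b\<close> persists from the first \<open>b\<close> where it holds; the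
  parts are the differences \<open>n b - b\<close> before that, and they are weakly decreasing for the same reason.\<close>

lemma ex_partition_hgt:
  assumes "height_fun n"
  shows "\<exists>P. is_partition P \<and> hgt P = n"
proof -
  obtain M0 where "\<forall>b\<ge>M0. n b = b" using assms by (auto simp: height_fun_def)
  then have ex: "n M0 = M0" by simp
  define M where "M = (LEAST m. n m = m)"
  have M: "n M = M" unfolding M_def using ex by (rule LeastI)
  have less: "b < n b" if "b < M" for b
    using not_less_Least[OF that[unfolded M_def]] height_funD(1)[OF assms, of b] by linarith
  have above: "n b = b" if "M \<le> b" for b
    using that
  proof (induction rule: dec_induct)
    case (step b)
    then show ?case using height_funD[OF assms] by (metis le_antisym)
  qed (rule M)
  let ?P = "map (\<lambda>b. n b - b) [0..<M]"
  have "n c - c \<le> n b - b" if "b \<le> c" for b c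
    using that
  proof (induction rule: dec_induct)
    case (step c)
    then show ?case using height_funD(2)[OF assms, of c] by linarith
  qed simp
  then have "is_partition ?P"
    using less by (auto simp: is_partition_def sorted_wrt_iff_nth_less)
  moreover have "hgt ?P b = n b" for b
    using above height_funD(1)[OF assms, of b] by (auto simp: hgt_def)
  ultimately show ?thesis by blast
qed

text \<open>The polynomials supported in a set of monomials that is stable under multiplication by the
  variables already form an ideal.\<close>

lemma in_span_monomials:
  assumes up: "\<And>a b. (a, b) \<in> S \<Longrightarrow> (Suc a, b) \<in> S \<and> (a, Suc b) \<in> S"
  shows "ideals.span (monom2 ` S) = {f :: 'k::field bipoly. Poly_Mapping.keys f \<subseteq> S}"
proof
  let ?K = "{f :: 'k bipoly. Poly_Mapping.keys f \<subseteq> S}"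
  define W where "W = ?K"
  have W: "f \<in> W \<longleftrightarrow> (\<forall>a b. (a, b) \<notin> S \<longrightarrow> lookup f (a, b) = 0)" for f
    by (auto simp: W_def subset_iff in_keys_iff)
  have "pvs.subspace W"
    unfolding pvs.subspace_def using W by (simp add: lookup_add)
  then have "ideals.subspace W"
  proof (rule ideal_subspaceI)
    fix f assume f: "f \<in> W"
    have f0: "lookup f (a, b) = 0" if "(a, b) \<notin> S" for a b
      using f that W by blast
    have "lookup (varx * f) (a, b) = 0" if "(a, b) \<notin> S" for a b
      using that up f0 by (cases a) (auto simp: lookup_varx_mult)
    moreover have "lookup (vary * f) (a, b) = 0" if "(a, b) \<notin> S" for a b
      using that up f0 by (cases b) (auto simp: lookup_vary_mult)
    ultimately have "\<forall>a b. (a, b) \<notin> S \<longrightarrow> lookup (varx * f) (a, b) = 0"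
      "\<forall>a b. (a, b) \<notin> S \<longrightarrow> lookup (vary * f) (a, b) = 0" by blast+
    then show "varx * f \<in> W" "vary * f \<in> W" unfolding W by simp_all
  qed
  moreover have "monom2 ` S \<subseteq> W" by (auto simp: monom2_def W_def)
  ultimately show "ideals.span (monom2 ` S) \<subseteq> ?K" unfolding W_def by (intro ideals.span_minimal)
  have sub: "pvs.subspace (ideals.span (monom2 ` S :: 'k bipoly set))"
    by (rule ideal_subspaceD[OF ideals.subspace_span])
  show "?K \<subseteq> ideals.span (monom2 ` S)"
  proof
    fix f assume f: "f \<in> ?K"
    have "f = (\<Sum>m\<in>Poly_Mapping.keys f. cscale (lookup f m) (monom2 m))"
      by (rule poly_mapping_eqI)
        (simp add: lookup_sum monom2_def lookup_single when_def in_keys_iff if_distrib[of "(*) _"] cong: if_cong)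
    also have "\<dots> \<in> ideals.span (monom2 ` S)"
      using f by (intro pvs.subspace_sum[OF sub] pvs.subspace_scale[OF sub] ideals.span_base) auto
    finally show "f \<in> ideals.span (monom2 ` S)" .
  qed
qed

lemma span_monomials_eq_iff:
  assumes "\<And>a b. (a, b) \<in> S \<Longrightarrow> (Suc a, b) \<in> S \<and> (a, Suc b) \<in> S"
    and "\<And>a b. (a, b) \<in> S' \<Longrightarrow> (Suc a, b) \<in> S' \<and> (a, Suc b) \<in> S'"
  shows "ideals.span (monom2 ` S) = (ideals.span (monom2 ` S') :: 'k::field bipoly set) \<longleftrightarrow> S = S'"
proof
  assume *: "ideals.span (monom2 ` S) = (ideals.span (monom2 ` S') :: 'k bipoly set)"
  have keys: "Poly_Mapping.keys (monom2 m :: 'k bipoly) = {m}" for m by (simp add: monom2_def)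
  have "m \<in> S \<longleftrightarrow> m \<in> S'" for m
  proof -
    have "(monom2 m :: 'k bipoly) \<in> ideals.span (monom2 ` S) \<longleftrightarrow> m \<in> S"
      by (subst in_span_monomials[OF assms(1)]) (simp_all add: keys)
    moreover have "(monom2 m :: 'k bipoly) \<in> ideals.span (monom2 ` S') \<longleftrightarrow> m \<in> S'"
      by (subst in_span_monomials[OF assms(2)]) (simp_all add: keys)
    ultimately show ?thesis using * by simp
  qed
  then show "S = S'" by blast
qed simp

lemma not_in_C_mons: "(a, b) \<in> - C_mons P \<longleftrightarrow> hgt P b \<le> a + b"
  by (auto simp: C_mons_def hgt_def)

lemma C_mons_compl_up:
  assumes "is_partition P" "(a, b) \<in> - C_mons P"
  shows "(Suc a, b) \<in> - C_mons P \<and> (a, Suc b) \<in> - C_mons P"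
  using assms(2) height_funD(2)[OF height_fun_hgt[OF assms(1)], of b] unfolding not_in_C_mons by simp

lemma init_mon_homog:
  assumes "g \<noteq> 0" "degree g \<le> i"
  shows "init_mon (homog i g) = (i - degree g, degree g)"
proof -
  let ?m = "(i - degree g, degree g)"
  let ?K = "Poly_Mapping.keys (homog i g)"
  have K: "m \<in> ?K \<longleftrightarrow> mdeg m = i \<and> coeff g (snd m) \<noteq> 0" for m
    by (simp add: in_keys_iff lookup_homog)
  have m: "?m \<in> ?K" using assms unfolding K by (simp add: mdeg_def)
  have le: "snd m \<le> degree g" if "m \<in> ?K" for m using that unfolding K by (simp add: le_degree)
  have "snd (init_mon (homog i g)) = snd ?m"
    unfolding init_mon_def by (rule arg_max_equality) (use m le in auto)
  moreover have "init_mon (homog i g) \<in> ?K"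
    unfolding init_mon_def by (rule arg_max_natI[where b = "Suc (degree g)"]) (use m le in \<open>auto simp: less_Suc_eq_le\<close>)
  then have "mdeg (init_mon (homog i g)) = i" unfolding K by simp
  ultimately show ?thesis by (simp add: mdeg_def prod_eq_iff)
qed

lemma lead_exps_Suc:
  assumes "graded_ideal I" "b \<in> lead_exps I i"
  shows "b \<in> lead_exps I (Suc i)" "Suc b \<in> lead_exps I (Suc i)"
proof -
  obtain g where g: "g \<noteq> 0" "degree g \<le> i" "homog i g \<in> I" "b = degree g"
    using assms(2) by (auto simp: lead_exps_def)
  have I: "homog i g \<in> I \<inter> forms i" using g homog_in_forms by blast
  have "homog (Suc i) g \<in> I"
    using graded_ideal_component(2)[OF assms(1) I] g by (simp add: varx_homog)
  then show "b \<in> lead_exps I (Suc i)" unfolding lead_exps_def using g by auto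
  have "homog (Suc i) (pCons 0 g) \<in> I"
    using graded_ideal_component(3)[OF assms(1) I] by (simp add: vary_homog)
  then show "Suc b \<in> lead_exps I (Suc i)"
    unfolding lead_exps_def using g by (intro CollectI exI[of _ "pCons 0 g"]) auto
qed

lemma init_ideal_eq:
  assumes "graded_ideal I"
  shows "init_ideal I = ideals.span (monom2 ` {(a, b). b \<in> lead_exps I (a + b)})"
proof -
  have A: "{init_mon f | f. f \<in> I \<and> f \<noteq> 0 \<and> (\<exists>i. f \<in> forms i)} = {(a, b). b \<in> lead_exps I (a + b)}" (is "?L = ?R")
  proof (intro subset_antisym subsetI)
    fix m assume "m \<in> ?L"
    then obtain f i where f: "m = init_mon f" "f \<in> I" "f \<noteq> 0" "f \<in> forms i" by blast
    obtain g where g: "degree g \<le> i" "f = homog i g" using forms_homogE[OF f(4)] .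
    then have "g \<noteq> 0" using f by auto
    then show "m \<in> ?R" using f g by (auto simp: init_mon_homog lead_exps_def)
  next
    fix m assume "m \<in> ?R"
    then obtain g where g: "g \<noteq> 0" "degree g \<le> mdeg m" "homog (mdeg m) g \<in> I" "degree g = snd m"
      by (auto simp: lead_exps_def mdeg_def)
    then have "init_mon (homog (mdeg m) g) = m" by (simp add: init_mon_homog) (simp add: mdeg_def)
    moreover have "homog (mdeg m) g \<noteq> 0" using g by (simp add: homog_eq_0_iff)
    ultimately show "m \<in> ?L" using g homog_in_forms by (intro CollectI exI[of _ "homog (mdeg m) g"]) auto
  qed
  have B: "{monom2 (init_mon f) | f. f \<in> I \<and> f \<noteq> 0 \<and> (\<exists>i. f \<in> forms i)} =
     monom2 ` {init_mon f | f. f \<in> I \<and> f \<noteq> 0 \<and> (\<exists>i. f \<in> forms i)}" by blast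
  show ?thesis unfolding init_ideal_def B A ..
qed

text \<open>Both initial ideals are monomial, and a monomial ideal determines its monomials; so membership in
  the cell only concerns leading exponents.\<close>

lemma jordan_cell_iff:
  assumes "is_partition P"
  shows "I \<in> jordan_cell P \<longleftrightarrow> graded_ideal I \<and> (\<forall>i. lead_exps I i = {b. hgt P b \<le> i})"
proof (cases "graded_ideal I")
  case True
  have "init_ideal I = E_ideal P \<longleftrightarrow> {(a, b). b \<in> lead_exps I (a + b)} = - C_mons P"
    unfolding init_ideal_eq[OF True] E_ideal_def
  proof (rule span_monomials_eq_iff)
    show "(Suc a, b) \<in> {(a, b). b \<in> lead_exps I (a + b)} \<and> (a, Suc b) \<in> {(a, b). b \<in> lead_exps I (a + b)}"
      if "(a, b) \<in> {(a, b). b \<in> lead_exps I (a + b)}" for a b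
      using that lead_exps_Suc[OF True, of b "a + b"] by simp
  qed (rule C_mons_compl_up[OF assms])
  also have "\<dots> \<longleftrightarrow> (\<forall>a b. b \<in> lead_exps I (a + b) \<longleftrightarrow> hgt P b \<le> a + b)"
    unfolding not_in_C_mons[symmetric] by auto
  also have "\<dots> \<longleftrightarrow> (\<forall>i. lead_exps I i = {b. hgt P b \<le> i})" (is "?L = ?R")
  proof
    assume L: ?L
    show ?R
    proof (intro allI set_eqI)
      fix i b
      show "b \<in> lead_exps I i \<longleftrightarrow> b \<in> {b. hgt P b \<le> i}"
      proof (cases "b \<le> i")
        case True
        then show ?thesis using L[rule_format, of b "i - b"] by simp
      next
        case False
        then show ?thesis
          using lead_exps_le[of b I i] height_funD(1)[OF height_fun_hgt[OF assms], of b] by auto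
      qed
    qed
  qed simp
  finally show ?thesis using True by (simp add: jordan_cell_def)
qed (simp add: jordan_cell_def)

lemma E_ideal_in_jordan_cell:
  assumes "is_partition P"
  shows "(E_ideal P :: 'a::field bipoly set) \<in> jordan_cell P"
    and "homog i (g :: 'a::field poly) \<in> E_ideal P \<longleftrightarrow> (\<forall>b\<le>i. coeff g b \<noteq> 0 \<longrightarrow> hgt P b \<le> i)"
proof -
  have E: "E_ideal P = {f :: 'a bipoly. Poly_Mapping.keys f \<subseteq> - C_mons P}"
    unfolding E_ideal_def by (rule in_span_monomials[OF C_mons_compl_up[OF assms]])
  have hom: "homog i g \<in> E_ideal P \<longleftrightarrow> (\<forall>b\<le>i. coeff g b \<noteq> 0 \<longrightarrow> hgt P b \<le> i)" for i and g :: "'a poly"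
  proof
    assume *: "homog i g \<in> E_ideal P"
    show "\<forall>b\<le>i. coeff g b \<noteq> 0 \<longrightarrow> hgt P b \<le> i"
    proof (intro allI impI)
      fix b assume b: "b \<le> i" "coeff g b \<noteq> 0"
      then have "(i - b, b) \<in> Poly_Mapping.keys (homog i g)"
        by (simp add: in_keys_iff lookup_homog mdeg_def)
      then have "(i - b, b) \<in> - C_mons P" using * unfolding E by blast
      then show "hgt P b \<le> i" unfolding not_in_C_mons using b by simp
    qed
  next
    assume *: "\<forall>b\<le>i. coeff g b \<noteq> 0 \<longrightarrow> hgt P b \<le> i"
    have "m \<in> - C_mons P" if "m \<in> Poly_Mapping.keys (homog i g)" for m
      using that * not_in_C_mons[of "fst m" "snd m" P]
      by (auto simp: in_keys_iff lookup_homog mdeg_def split: if_splits)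
    then show "homog i g \<in> E_ideal P" unfolding E by blast
  qed
  then show "homog i g \<in> E_ideal P \<longleftrightarrow> (\<forall>b\<le>i. coeff g b \<noteq> 0 \<longrightarrow> hgt P b \<le> i)" .
  have "graded_ideal (E_ideal P :: 'a bipoly set)"
    unfolding graded_ideal_def
  proof (intro conjI ballI allI)
    show "ideals.subspace (E_ideal P :: 'a bipoly set)"
      unfolding E_ideal_def by (rule ideals.subspace_span)
    show "hom_component i f \<in> E_ideal P" if "f \<in> E_ideal P" for f :: "'a bipoly" and i
      using that unfolding E by (auto simp: in_keys_iff lookup_hom_component subset_iff split: if_splits)
  qed
  moreover have "lead_exps (E_ideal P :: 'a bipoly set) i = {b. hgt P b \<le> i}" for i
  proof (intro set_eqI iffI)
    fix b assume "b \<in> lead_exps (E_ideal P :: 'a bipoly set) i"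
    then obtain g :: "'a poly" where "g \<noteq> 0" "b = degree g" "degree g \<le> i" "homog i g \<in> E_ideal P"
      by (auto simp: lead_exps_def)
    then show "b \<in> {b. hgt P b \<le> i}" by (auto simp: hom)
  next
    fix b assume b: "b \<in> {b. hgt P b \<le> i}"
    then have "b \<le> i" using height_funD(1)[OF height_fun_hgt[OF assms], of b] by simp
    then have "degree (monom (1::'a) b) = b" "homog i (monom (1::'a) b) \<in> E_ideal P"
      using b by (auto simp: hom degree_monom_eq split: if_splits)
    then show "b \<in> lead_exps (E_ideal P :: 'a bipoly set) i"
      unfolding lead_exps_def using \<open>b \<le> i\<close> by (intro CollectI exI[of _ "monom 1 b"]) auto
  qed
  ultimately show "(E_ideal P :: 'a bipoly set) \<in> jordan_cell P"
    unfolding jordan_cell_iff[OF assms] by blast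
qed

lemma hilbert_fun_jordan_cell:
  assumes "is_partition P" "I \<in> jordan_cell P"
  shows "hilbert_fun I i = i + 1 - card {b. hgt P b \<le> i}"
  using assms by (simp add: jordan_cell_iff hilbert_fun_lead_exps)

lemma diagonal_lengths_eq:
  assumes "is_partition P"
  shows "diagonal_lengths K P i = i + 1 - card {b. hgt P b \<le> i}"
  unfolding diagonal_lengths_def by (rule hilbert_fun_jordan_cell[OF assms E_ideal_in_jordan_cell(1)[OF assms]])

lemma jordan_cell_subset_G_T:
  assumes "is_partition P"
  shows "(jordan_cell P :: 'a::field bipoly set set) \<subseteq> G_T (diagonal_lengths K P)"
proof
  fix I :: "'a bipoly set" assume I: "I \<in> jordan_cell P"
  have "hilbert_fun I = diagonal_lengths K P"
    by (rule ext) (simp only: hilbert_fun_jordan_cell[OF assms I] diagonal_lengths_eq[OF assms])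
  then show "I \<in> G_T (diagonal_lengths K P)"
    using I unfolding jordan_cell_iff[OF assms] G_T_def by blast
qed

text \<open>The least degrees in which the exponents become leading exponents grow by at most one, because the
  ideal is closed under multiplication by \<open>y\<close>; hence they are the heights of a partition.\<close>

lemma G_T_in_some_cell:
  assumes "I \<in> G_T T" "\<And>k. J < k \<Longrightarrow> T k = 0"
  shows "\<exists>P. is_partition P \<and> I \<in> jordan_cell P"
proof -
  have gr: "graded_ideal I" and h: "\<And>k. k + 1 - card (lead_exps I k) = T k"
    using assms(1) hilbert_fun_lead_exps[of I] by (auto simp: G_T_def)
  have full: "lead_exps I k = {..k}" if "J < k" for k
  proof (rule card_subset_eq)
    show sub: "lead_exps I k \<subseteq> {..k}" using lead_exps_le by blast
    show "card (lead_exps I k) = card {..k}"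
      using h[of k] assms(2)[OF that] card_mono[OF _ sub] by simp
  qed simp
  define n where "n b = (LEAST i. b \<in> lead_exps I i)" for b
  have ex: "b \<in> lead_exps I (Suc (b + J))" for b using full[of "Suc (b + J)"] by simp
  have n: "b \<in> lead_exps I (n b)" for b unfolding n_def using ex by (rule LeastI)
  have mono: "b \<in> lead_exps I j" if "i \<le> j" "b \<in> lead_exps I i" for b i j
    using that(1)
  proof (induction rule: dec_induct)
    case base
    show ?case by (rule that(2))
  next
    case (step k)
    show ?case using step.IH by (rule lead_exps_Suc(1)[OF gr])
  qed
  have iff: "b \<in> lead_exps I i \<longleftrightarrow> n b \<le> i" for b i
  proof
    assume "b \<in> lead_exps I i"
    then show "n b \<le> i" unfolding n_def by (rule Least_le)
  qed (rule mono[OF _ n])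
  have "height_fun n"
    unfolding height_fun_def
  proof (intro conjI allI)
    fix b
    show "b \<le> n b" using n lead_exps_le by blast
    show "n (Suc b) \<le> Suc (n b)" using lead_exps_Suc(2)[OF gr n] iff by blast
    show "\<exists>M. \<forall>b\<ge>M. n b = b"
    proof (intro exI allI impI)
      fix b assume "Suc J \<le> b"
      then have "b \<in> lead_exps I b" using full[of b] by simp
      then have "n b \<le> b" using iff by blast
      then show "n b = b" using lead_exps_le[OF n] by (rule le_antisym)
    qed
  qed
  then obtain P where P: "is_partition P" "hgt P = n" using ex_partition_hgt by blast
  have "lead_exps I i = {b. hgt P b \<le> i}" for i using iff P(2) by blast
  then have "I \<in> jordan_cell P" unfolding jordan_cell_iff[OF P(1)] using gr by blast
  then show ?thesis using P by blast
qed

subsection \<open>Each cell is the image of an affine space\<close>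

lemmas [fundef_cong] = sum.cong

text \<open>Monic polynomials \<open>g_b\<close> of degree \<open>b\<close> with \<open>y g_b\<close> equal to \<open>g_(b+1)\<close> plus a combination of
  lower ones.  The coefficients are subject to no relation: whatever they are, the spaces spanned
  by the \<open>g_c\<close> with \<open>n c \<le> i\<close> are stable under \<open>y\<close>, as soon as \<open>y g_b\<close> only involves \<open>g_c\<close> with
  \<open>n c \<le> n b + 1\<close>.\<close>

fun hess_basis :: "(nat \<Rightarrow> nat \<Rightarrow> 'k::field) \<Rightarrow> nat \<Rightarrow> 'k poly" where
  "hess_basis \<alpha> 0 = 1"
| "hess_basis \<alpha> (Suc b) = pCons 0 (hess_basis \<alpha> b) - (\<Sum>c\<in>{..b}. smult (\<alpha> b c) (hess_basis \<alpha> c))"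

definition admissible :: "(nat \<Rightarrow> nat) \<Rightarrow> (nat \<Rightarrow> nat \<Rightarrow> 'k::field) \<Rightarrow> bool" where
  "admissible n \<alpha> \<longleftrightarrow> (\<forall>b c. \<alpha> b c \<noteq> 0 \<longrightarrow> c \<le> b \<and> n c \<le> Suc (n b))"

definition cell_ideal :: "(nat \<Rightarrow> nat) \<Rightarrow> (nat \<Rightarrow> nat \<Rightarrow> 'k::field) \<Rightarrow> 'k bipoly set" where
  "cell_ideal n \<alpha> = chain_ideal (\<lambda>i. pvs.span ((\<lambda>c. homog i (hess_basis \<alpha> c)) ` {c. n c \<le> i}))"

lemma hess_basis_monic: "degree (hess_basis \<alpha> b) = b \<and> lead_coeff (hess_basis \<alpha> b) = 1"
proof (induction b rule: less_induct)
  case (less b)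
  show ?case
  proof (cases b)
    case (Suc b')
    let ?S = "\<Sum>c\<in>{..b'}. smult (\<alpha> b' c) (hess_basis \<alpha> c)"
    have "degree ?S \<le> b'"
    proof (intro degree_sum_le)
      fix c assume "c \<in> {..b'}"
      then have "degree (hess_basis \<alpha> c) \<le> b'" using less[of c] Suc by simp
      then show "degree (smult (\<alpha> b' c) (hess_basis \<alpha> c)) \<le> b'"
        by (rule order_trans[OF degree_smult_le])
    qed simp
    moreover have d: "degree (hess_basis \<alpha> b') = b'" "lead_coeff (hess_basis \<alpha> b') = 1"
      using less[of b'] Suc by auto
    then have "hess_basis \<alpha> b' \<noteq> 0" by auto
    then have "degree (pCons 0 (hess_basis \<alpha> b')) = Suc b'" using d by simp
    ultimately have "degree (hess_basis \<alpha> (Suc b')) \<le> Suc b'" "coeff (hess_basis \<alpha> (Suc b')) (Suc b') = 1"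
      using d by (auto intro!: degree_diff_le simp: coeff_eq_0)
    then show ?thesis using Suc
      by (metis le_degree le_antisym zero_neq_one)
  qed simp
qed

lemma degree_hess_basis [simp]: "degree (hess_basis \<alpha> b) = b"
  and coeff_hess_basis [simp]: "coeff (hess_basis \<alpha> b) b = 1"
  using hess_basis_monic[of \<alpha> b] by auto

lemma hess_basis_nonzero [simp]: "hess_basis \<alpha> b \<noteq> 0"
  using coeff_hess_basis[of \<alpha> b] by (metis coeff_0 zero_neq_one)

lemma pCons_hess_basis:
  "pCons 0 (hess_basis \<alpha> b) = hess_basis \<alpha> (Suc b) + (\<Sum>c\<in>{..b}. smult (\<alpha> b c) (hess_basis \<alpha> c))"
  by simp

lemma span_mult:
  assumes "\<And>f. f \<in> S \<Longrightarrow> v * f \<in> pvs.span S'" "f \<in> pvs.span S"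
  shows "v * f \<in> pvs.span S'"
proof -
  have "pvs.subspace {f. v * f \<in> pvs.span S'}"
    unfolding pvs.subspace_def
    by (auto simp: pvs.span_zero distrib_left cscale_mult intro: pvs.span_add pvs.span_scale)
  then have "pvs.span S \<subseteq> {f. v * f \<in> pvs.span S'}"
    using assms(1) by (intro pvs.span_minimal) auto
  then show ?thesis using assms(2) by blast
qed

lemma in_span_imageE:
  assumes "finite S" "f \<in> pvs.span (F ` S)"
  obtains u where "f = (\<Sum>c\<in>S. cscale (u c) (F c))"
proof -
  let ?W = "{\<Sum>c\<in>S. cscale (u c) (F c) | u. True}"
  have "pvs.subspace ?W"
    unfolding pvs.subspace_def
  proof (intro conjI ballI allI)
    show "0 \<in> ?W" by (intro CollectI exI[of _ "\<lambda>_. 0"]) simp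
    show "x + y \<in> ?W" if xy: "x \<in> ?W" "y \<in> ?W" for x y
    proof -
      obtain u v where "x = (\<Sum>c\<in>S. cscale (u c) (F c))" "y = (\<Sum>c\<in>S. cscale (v c) (F c))"
        using xy by blast
      then have "x + y = (\<Sum>c\<in>S. cscale (u c + v c) (F c))"
        by (simp add: pvs.scale_left_distrib sum.distrib)
      then show ?thesis by (intro CollectI exI[of _ "\<lambda>c. u c + v c"]) simp
    qed
    show "cscale k x \<in> ?W" if x: "x \<in> ?W" for k x
    proof -
      obtain u where "x = (\<Sum>c\<in>S. cscale (u c) (F c))" using x by blast
      then have "cscale k x = (\<Sum>c\<in>S. cscale (k * u c) (F c))"
        by (simp add: pvs.scale_sum_right)
      then show ?thesis by (intro CollectI exI[of _ "\<lambda>c. k * u c"]) simp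
    qed
  qed
  moreover have "F c \<in> ?W" if "c \<in> S" for c
  proof (intro CollectI exI[of _ "\<lambda>d. if d = c then 1 else 0"] conjI)
    have "(\<Sum>d\<in>S. cscale (if d = c then 1 else 0) (F d)) = (\<Sum>d\<in>{c}. cscale (if d = c then 1 else 0) (F d))"
      by (rule sum.mono_neutral_right) (use assms(1) that in auto)
    then show "F c = (\<Sum>d\<in>S. cscale (if d = c then 1 else 0) (F d))" by simp
  qed simp
  ultimately have "pvs.span (F ` S) \<subseteq> ?W" by (intro pvs.span_minimal) auto
  then show ?thesis using assms(2) that by blast
qed

lemma cell_ideal_component:
  assumes n: "height_fun n" and adm: "admissible n \<alpha>"
  shows "graded_ideal (cell_ideal n \<alpha>)"
    and "cell_ideal n \<alpha> \<inter> forms i = pvs.span ((\<lambda>c. homog i (hess_basis \<alpha> c)) ` {c. n c \<le> i})"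
proof -
  let ?S = "\<lambda>i. (\<lambda>c. homog i (hess_basis \<alpha> c)) ` {c. n c \<le> i}"
  have base: "homog i (hess_basis \<alpha> c) \<in> pvs.span (?S i)" if "n c \<le> i" for c i
    using that by (intro pvs.span_base) auto
  have deg: "pvs.span (?S i) \<subseteq> forms i" for i
    using homog_in_forms by (intro pvs.span_minimal subspace_forms) auto
  have x: "varx * f \<in> pvs.span (?S (Suc i))" if "f \<in> pvs.span (?S i)" for f i
  proof (rule span_mult[OF _ that])
    fix f assume "f \<in> ?S i"
    then obtain c where c: "n c \<le> i" "f = homog i (hess_basis \<alpha> c)" by auto
    then have "c \<le> i" using height_funD(1)[OF n, of c] by simp
    then show "varx * f \<in> pvs.span (?S (Suc i))" using c base[of c "Suc i"] by (simp add: varx_homog)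
  qed
  have y: "vary * f \<in> pvs.span (?S (Suc i))" if "f \<in> pvs.span (?S i)" for f i
  proof (rule span_mult[OF _ that])
    fix f assume "f \<in> ?S i"
    then obtain c where c: "n c \<le> i" "f = homog i (hess_basis \<alpha> c)" by auto
    have "cscale (\<alpha> c d) (homog (Suc i) (hess_basis \<alpha> d)) \<in> pvs.span (?S (Suc i))" for d
    proof (cases "\<alpha> c d = 0")
      case False
      then have "n d \<le> Suc i" using adm c(1) unfolding admissible_def by fastforce
      then show ?thesis by (intro pvs.span_scale base)
    qed (simp add: pvs.span_zero)
    moreover have "homog (Suc i) (hess_basis \<alpha> (Suc c)) \<in> pvs.span (?S (Suc i))"
      using height_funD(2)[OF n, of c] c(1) by (intro base) simp
    moreover have "vary * f = homog (Suc i) (hess_basis \<alpha> (Suc c)) +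
        (\<Sum>d\<in>{..c}. cscale (\<alpha> c d) (homog (Suc i) (hess_basis \<alpha> d)))"
      unfolding c(2) vary_homog pCons_hess_basis homog_add homog_sum homog_smult ..
    ultimately show "vary * f \<in> pvs.span (?S (Suc i))"
      by (auto intro: pvs.span_add pvs.span_sum)
  qed
  show "graded_ideal (cell_ideal n \<alpha>)" "cell_ideal n \<alpha> \<inter> forms i = pvs.span (?S i)"
    unfolding cell_ideal_def by (rule chain_ideal; use deg x y in \<open>simp add: pvs.subspace_span\<close>)+
qed

lemma indep_fam_hess_basis:
  assumes "height_fun n"
  shows "indep_fam {c. n c \<le> i} (\<lambda>c. lookup (homog i (hess_basis \<alpha> c)))"
proof (subst indep_fam_homog)
  show "degree (hess_basis \<alpha> c) \<le> i" if "c \<in> {c. n c \<le> i}" for c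
    using that order_trans[OF height_funD(1)[OF assms, of c], of i] by simp
  show "indep_fam {c. n c \<le> i} (\<lambda>c. coeff (hess_basis \<alpha> c))"
    by (rule indep_fam_distinct_degrees[OF finite_height_le[OF assms]]) simp
qed

text \<open>The \<open>c\<close> with \<open>n c \<le> i\<close> are leading exponents in degree \<open>i\<close>, and by dimension there are no
  others.\<close>

lemma cell_ideal_in_jordan_cell:
  assumes P: "is_partition P" and adm: "admissible (hgt P) \<alpha>"
  shows "cell_ideal (hgt P) \<alpha> \<in> jordan_cell P"
proof -
  note n = height_fun_hgt[OF P]
  let ?I = "cell_ideal (hgt P) \<alpha>"
  note gr = cell_ideal_component(1)[OF n adm]
  have "lead_exps ?I i = {b. hgt P b \<le> i}" for i
  proof (rule card_subset_eq[symmetric])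
    show "{b. hgt P b \<le> i} \<subseteq> lead_exps ?I i"
    proof
      fix b assume b: "b \<in> {b. hgt P b \<le> i}"
      then have "b \<le> i" using height_funD(1)[OF n, of b] by simp
      have "homog i (hess_basis \<alpha> b) \<in> ?I \<inter> forms i"
        unfolding cell_ideal_component(2)[OF n adm] using b by (intro pvs.span_base) auto
      then show "b \<in> lead_exps ?I i"
        unfolding lead_exps_def using \<open>b \<le> i\<close> by (intro CollectI exI[of _ "hess_basis \<alpha> b"]) auto
    qed
    show "card {b. hgt P b \<le> i} = card (lead_exps ?I i)"
      unfolding card_lead_exps[OF gr, symmetric] cell_ideal_component(2)[OF n adm]
      by (rule indep_fam_card_eq_dim[symmetric, OF finite_height_le[OF n] indep_fam_hess_basis[OF n]])
  qed simp
  then show ?thesis unfolding jordan_cell_iff[OF P] using gr by blast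
qed

text \<open>Take for \<open>g_b\<close> a monic element in the least degree \<open>n b\<close> in which \<open>b\<close> is a leading exponent.
  Then \<open>y g_b - g_(b+1)\<close> has degree at most \<open>b\<close> in \<open>y\<close> and belongs to the ideal in degree
  \<open>n b + 1\<close>, so that division with remainder only uses \<open>g_c\<close> with \<open>c \<le> b\<close> and
  \<open>n c \<le> n b + 1\<close>.\<close>

lemma jordan_cell_is_cell_ideal:
  assumes P: "is_partition P" and I: "I \<in> jordan_cell P"
  shows "\<exists>\<alpha>. admissible (hgt P) \<alpha> \<and> I = cell_ideal (hgt P) \<alpha>"
proof -
  define n where "n = hgt P"
  have n: "height_fun n" unfolding n_def by (rule height_fun_hgt[OF P])
  have gr: "graded_ideal I" and lead: "\<And>i. lead_exps I i = {b. n b \<le> i}"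
    using I unfolding jordan_cell_iff[OF P] n_def by auto
  note sub = graded_ideal_component(1)[OF gr]
  have "\<exists>g. degree g = b \<and> lead_coeff g = 1 \<and> homog (n b) g \<in> I" for b
    using lead_exps_monicE[OF sub[of "n b"], of b] unfolding lead by auto
  then obtain G where G: "\<And>b. degree (G b) = b \<and> lead_coeff (G b) = 1 \<and> homog (n b) (G b) \<in> I"
    by metis
  have GI: "homog i (G b) \<in> I" if "n b \<le> i" for b i
    using that
  proof (induction rule: dec_induct)
    case (step i)
    then have "b \<le> i" using height_funD(1)[OF n, of b] by simp
    then have "homog (Suc i) (G b) = varx * homog i (G b)" using G[of b] by (simp add: varx_homog)
    then show ?case using graded_ideal_component(2)[OF gr, of "homog i (G b)" i] step homog_in_forms by auto
  qed (use G in simp)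
  have Gfam: "degree (G b) = b \<and> lead_coeff (G b) = 1 \<and> homog i (G b) \<in> I" if "b \<in> lead_exps I i" for b i
    using G GI that unfolding lead by blast
  have "\<exists>u. pCons 0 (G b) - G (Suc b) = (\<Sum>c\<in>{c. n c \<le> Suc (n b) \<and> c \<le> b}. smult (u c) (G c))" for b
  proof -
    let ?h = "pCons 0 (G b) - G (Suc b)" and ?i = "Suc (n b)"
    have G0: "G b \<noteq> 0" using G[of b] by auto
    have "degree ?h \<le> Suc b" using G[of b] G[of "Suc b"] G0 by (intro degree_diff_le) auto
    moreover have "coeff (G b) b = 1" "coeff (G (Suc b)) (Suc b) = 1"
      using G[of b] G[of "Suc b"] by metis+
    then have "coeff ?h (Suc b) = 0" by simp
    ultimately have h: "degree ?h \<le> b"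
      by (metis degree_0 le_Suc_eq leading_coeff_0_iff zero_le)
    have bn: "b \<le> ?i" using height_funD(1)[OF n, of b] by simp
    have "homog ?i (pCons 0 (G b)) \<in> I"
      using graded_ideal_component(3)[OF gr, of "homog (n b) (G b)" "n b"] G[of b] homog_in_forms
      by (auto simp: vary_homog)
    moreover have "homog ?i (G (Suc b)) \<in> I" using height_funD(2)[OF n] by (intro GI)
    ultimately have "homog ?i ?h \<in> I \<inter> forms ?i"
      unfolding homog_diff using homog_in_forms by (intro pvs.subspace_diff[OF sub]) auto
    then have "homog ?i ?h \<in> pvs.span ((\<lambda>c. homog ?i (G c)) ` {c \<in> lead_exps I ?i. c \<le> b})"
      using h bn by (intro in_span_of_lead_exps[OF sub Gfam]) auto
    then obtain u where "homog ?i ?h = (\<Sum>c\<in>{c \<in> lead_exps I ?i. c \<le> b}. cscale (u c) (homog ?i (G c)))"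
    proof (rule in_span_imageE[rotated])
      show "finite {c \<in> lead_exps I ?i. c \<le> b}" by (rule finite_subset[OF _ finite_lead_exps[of I ?i]]) blast
    qed
    also have "\<dots> = homog ?i (\<Sum>c\<in>{c \<in> lead_exps I ?i. c \<le> b}. smult (u c) (G c))"
      by (simp add: homog_sum homog_smult)
    finally have "?h = (\<Sum>c\<in>{c \<in> lead_exps I ?i. c \<le> b}. smult (u c) (G c))"
    proof (subst (asm) homog_eq_iff)
      show "degree (\<Sum>c\<in>{c \<in> lead_exps I ?i. c \<le> b}. smult (u c) (G c)) \<le> ?i"
      proof (intro degree_sum_le)
        fix c assume "c \<in> {c \<in> lead_exps I ?i. c \<le> b}"
        then have "degree (G c) \<le> ?i" using G[of c] bn by simp
        then show "degree (smult (u c) (G c)) \<le> ?i" by (rule order_trans[OF degree_smult_le])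
      qed simp
      show "degree ?h \<le> ?i" using h bn by (rule order_trans)
    qed
    then show ?thesis unfolding lead by auto
  qed
  then obtain u where u: "\<And>b. pCons 0 (G b) - G (Suc b) = (\<Sum>c\<in>{c. n c \<le> Suc (n b) \<and> c \<le> b}. smult (u b c) (G c))"
    by metis
  define \<alpha> where "\<alpha> b c = (if n c \<le> Suc (n b) \<and> c \<le> b then u b c else 0)" for b c
  have adm: "admissible n \<alpha>" unfolding admissible_def \<alpha>_def by auto
  have Ghess: "hess_basis \<alpha> b = G b" for b
  proof (induction b rule: less_induct)
    case (less b)
    show ?case
    proof (cases b)
      case 0
      obtain a where "G 0 = [:a:]" using G[of 0] degree_eq_zeroE by blast
      then show ?thesis using G[of 0] 0 by (simp add: one_pCons)
    next
      case (Suc b')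
      have "(\<Sum>c\<in>{..b'}. smult (\<alpha> b' c) (hess_basis \<alpha> c)) = (\<Sum>c\<in>{..b'}. smult (\<alpha> b' c) (G c))"
        using less Suc by (intro sum.cong) auto
      also have "\<dots> = (\<Sum>c\<in>{c. n c \<le> Suc (n b') \<and> c \<le> b'}. smult (u b' c) (G c))"
        by (intro sum.mono_neutral_cong_right) (auto simp: \<alpha>_def)
      finally show ?thesis using u[of b', symmetric] less[of b'] Suc by simp
    qed
  qed
  have "I \<inter> forms i = cell_ideal n \<alpha> \<inter> forms i" for i
    unfolding cell_ideal_component(2)[OF n adm] Ghess
  proof
    show "pvs.span ((\<lambda>c. homog i (G c)) ` {c. n c \<le> i}) \<subseteq> I \<inter> forms i"
      using GI homog_in_forms by (intro pvs.span_minimal sub) auto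
    show "I \<inter> forms i \<subseteq> pvs.span ((\<lambda>c. homog i (G c)) ` {c. n c \<le> i})"
    proof
      fix f assume f: "f \<in> I \<inter> forms i"
      then obtain g where g: "degree g \<le> i" "f = homog i g" by (auto elim: forms_homogE)
      then have "f \<in> pvs.span ((\<lambda>c. homog i (G c)) ` {c \<in> lead_exps I i. c \<le> i})"
        using f by (simp only:, intro in_span_of_lead_exps[OF sub Gfam]) auto
      also have "{c \<in> lead_exps I i. c \<le> i} = {c. n c \<le> i}"
        using order_trans[OF height_funD(1)[OF n]] unfolding lead by blast
      finally show "f \<in> pvs.span ((\<lambda>c. homog i (G c)) ` {c. n c \<le> i})" .
    qed
  qed
  then have "I = cell_ideal n \<alpha>"
    by (rule graded_ideal_eqI[OF gr cell_ideal_component(1)[OF n adm]])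
  then show ?thesis using adm unfolding n_def by blast
qed

text \<open>A frame lists a basis; the exponents are listed in an order common to all ideals of the cell, so
  that frames vary polynomially with the coefficients.\<close>

definition enum_heights :: "(nat \<Rightarrow> nat) \<Rightarrow> nat \<Rightarrow> nat \<Rightarrow> nat" where
  "enum_heights n i = (SOME e. bij_betw e {..<card {b. n b \<le> i}} {b. n b \<le> i})"

lemma enum_heights:
  assumes "height_fun n"
  shows "bij_betw (enum_heights n i) {..<card {b. n b \<le> i}} {b. n b \<le> i}"
proof -
  have "\<exists>e. bij_betw e {..<card {b. n b \<le> i}} {b. n b \<le> i}"
    using ex_bij_betw_nat_finite[OF finite_height_le[OF assms, of i]] by (simp only: atLeast0LessThan)
  then show ?thesis unfolding enum_heights_def by (rule someI_ex)
qed

definition cell_frame :: "(nat \<Rightarrow> nat) \<Rightarrow> (nat \<Rightarrow> nat \<Rightarrow> 'k::field) \<Rightarrow> nat \<Rightarrow> nat \<Rightarrow> 'k bipoly" where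
  "cell_frame n \<alpha> i r = homog i (hess_basis \<alpha> (enum_heights n i r))"

lemma frame_cell_frame:
  assumes P: "is_partition P" and adm: "admissible (hgt P) \<alpha>"
  shows "frame (diagonal_lengths K P) (cell_ideal (hgt P) \<alpha>) (cell_frame (hgt P) \<alpha>)"
proof -
  note n = height_fun_hgt[OF P]
  let ?F = "\<lambda>i c. homog i (hess_basis \<alpha> c)"
  have c: "i + 1 - diagonal_lengths K P i = card {b. hgt P b \<le> i}" for i
    using card_height_le[OF n, of i] by (simp add: diagonal_lengths_eq[OF P])
  have img: "cell_frame (hgt P) \<alpha> i ` {..<card {b. hgt P b \<le> i}} = ?F i ` {b. hgt P b \<le> i}" for i
    unfolding cell_frame_def[abs_def] image_image[of "?F i" "enum_heights (hgt P) i", symmetric]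
    by (simp only: bij_betw_imp_surj_on[OF enum_heights[OF n]])
  have ind: "inj_on (?F i) {b. hgt P b \<le> i} \<and> pvs.independent (?F i ` {b. hgt P b \<le> i})" for i
    using indep_fam_hess_basis[OF n] by (simp add: indep_fam_iff_independent finite_height_le[OF n])
  have "inj_on (cell_frame (hgt P) \<alpha> i) {..<card {b. hgt P b \<le> i}}" for i
    using ind[of i] enum_heights[OF n, of i]
    unfolding cell_frame_def[abs_def] bij_betw_def
    by (intro comp_inj_on[of "enum_heights (hgt P) i" _ "?F i", unfolded comp_def]) auto
  then show ?thesis
    unfolding frame_def c img using ind cell_ideal_component(2)[OF n adm] by simp
qed

lemma polyfun_coeff_hess_basis:
  assumes "\<And>b c. polyfun (\<lambda>s. \<alpha> s b c)"
  shows "polyfun (\<lambda>s. coeff (hess_basis (\<alpha> s) b) k)"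
proof (induction b arbitrary: k rule: less_induct)
  case (less b)
  show ?case
  proof (cases b)
    case 0
    show ?thesis unfolding 0 hess_basis.simps by (rule polyfun_const)
  next
    case (Suc b')
    have "polyfun (\<lambda>s. coeff (pCons 0 (hess_basis (\<alpha> s) b')) k)"
      using less[of b'] Suc by (cases k) (simp_all add: polyfun_const)
    moreover have "polyfun (\<lambda>s. \<Sum>c\<in>{..b'}. \<alpha> s b' c * coeff (hess_basis (\<alpha> s) c) k)"
      using less Suc by (intro polyfun_sum polyfun_mult assms) auto
    ultimately show ?thesis
      unfolding Suc hess_basis.simps coeff_diff coeff_sum coeff_smult by (rule polyfun_diff)
  qed
qed

text \<open>The cell is irreducible: two of its ideals lie on the curve that is the image of the line through
  their coefficients.\<close>

lemma cell_meets_both: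
  fixes U W :: "'k::field bipoly set set"
  assumes inf: "infinite (UNIV :: 'k set)" and P: "is_partition P"
    and U: "openin (zariski (diagonal_lengths K P)) U" "U \<inter> jordan_cell P \<noteq> {}"
    and W: "openin (zariski (diagonal_lengths K P)) W" "W \<inter> jordan_cell P \<noteq> {}"
  shows "U \<inter> W \<inter> jordan_cell P \<noteq> {}"
proof -
  obtain I J where IJ: "I \<in> U" "I \<in> jordan_cell P" "J \<in> W" "J \<in> jordan_cell P" using U(2) W(2) by blast
  obtain \<alpha> \<beta> where ab: "admissible (hgt P) \<alpha>" "I = cell_ideal (hgt P) \<alpha>"
      "admissible (hgt P) \<beta>" "J = cell_ideal (hgt P) \<beta>"
    using jordan_cell_is_cell_ideal[OF P] IJ by metis
  define \<gamma> where "\<gamma> s b c = \<alpha> b c + s * (\<beta> b c - \<alpha> b c)" for s b c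
  have adm: "admissible (hgt P) (\<gamma> s)" for s
    using ab(1,3) unfolding admissible_def \<gamma>_def by (metis add_0 diff_zero mult_zero_right)
  have "\<exists>s. cell_ideal (hgt P) (\<gamma> s) \<in> U \<inter> W"
  proof (rule curve_meets_both[OF inf U(1) W(1)])
    show "cell_ideal (hgt P) (\<gamma> s) \<in> G_T (diagonal_lengths K P)" for s
      using cell_ideal_in_jordan_cell[OF P adm] jordan_cell_subset_G_T[OF P] by blast
    show "frame (diagonal_lengths K P) (cell_ideal (hgt P) (\<gamma> s)) (cell_frame (hgt P) (\<gamma> s))" for s
      by (rule frame_cell_frame[OF P adm])
    show "polyfun (\<lambda>s. lookup (cell_frame (hgt P) (\<gamma> s) i r) m)" for i r m
    proof -
      have "polyfun (\<lambda>s. \<gamma> s b c)" for b c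
        unfolding \<gamma>_def by (intro polyfun_add polyfun_mult polyfun_const polyfun_id)
      then have "polyfun (\<lambda>s. coeff (hess_basis (\<gamma> s) b) k)" for b k by (rule polyfun_coeff_hess_basis)
      then show ?thesis
        unfolding cell_frame_def lookup_homog by (cases "mdeg m = i") (simp_all add: polyfun_const)
    qed
    show "cell_ideal (hgt P) (\<gamma> 0) \<in> U" "cell_ideal (hgt P) (\<gamma> 1) \<in> W"
      using IJ(1,3) ab unfolding \<gamma>_def by simp_all
  qed
  then show ?thesis using cell_ideal_in_jordan_cell[OF P adm] by blast
qed

section \<open>Minimal generators\<close>

lemma forms_subset_span: "forms i \<subseteq> pvs.span ((\<lambda>b. homog i (monom 1 b)) ` {..i})"
proof
  fix f assume "f \<in> forms i"
  have "f = (\<Sum>b\<le>i. cscale (lookup f (i - b, b)) (homog i (monom 1 b)))"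
  proof (rule forms_eqI[OF \<open>f \<in> forms i\<close>])
    show "(\<Sum>b\<le>i. cscale (lookup f (i - b, b)) (homog i (monom 1 b))) \<in> forms i"
      by (intro pvs.subspace_sum[OF subspace_forms] pvs.subspace_scale[OF subspace_forms] homog_in_forms)
    fix c assume "c \<le> i"
    then show "lookup f (i - c, c) = lookup
        (\<Sum>b\<le>i. cscale (lookup f (i - b, b)) (homog i (monom 1 b))) (i - c, c)"
      by (simp add: lookup_sum lookup_homog mdeg_def if_distrib[of "(*) _"] cong: if_cong)
  qed
  also have "\<dots> \<in> pvs.span ((\<lambda>b. homog i (monom 1 b)) ` {..i})"
    by (intro pvs.span_sum pvs.span_scale pvs.span_base) simp
  finally show "f \<in> pvs.span ((\<lambda>b. homog i (monom 1 b)) ` {..i})" .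
qed

lemma independent_forms_finite:
  assumes "B \<subseteq> forms i" "pvs.independent B"
  shows "finite B"
proof -
  have "B \<subseteq> pvs.span ((\<lambda>b. homog i (monom 1 b)) ` {..i})" using assms(1) forms_subset_span by (rule order_trans)
  then show ?thesis
    using pvs.independent_span_bound[OF _ assms(2)] by (meson finite_atMost finite_imageI)
qed

lemma independent_card_le_dim:
  assumes "V \<subseteq> forms i" "B \<subseteq> V" "pvs.independent B"
  shows "card B \<le> pvs.dim V"
proof -
  obtain C where C: "C \<subseteq> V" "pvs.independent C" "V \<subseteq> pvs.span C" "card C = pvs.dim V"
    using pvs.basis_exists[of V] by blast
  have "finite C" using C(1,2) assms(1) independent_forms_finite by (meson order_trans)
  moreover have "B \<subseteq> pvs.span C" using assms(2) C(3) by (rule order_trans)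
  ultimately show ?thesis using pvs.independent_span_bound[OF _ assms(3)] C(4) by metis
qed

lemma dim_mono_forms:
  assumes "V \<subseteq> W" "W \<subseteq> forms i"
  shows "pvs.dim V \<le> pvs.dim W"
proof -
  obtain C where "C \<subseteq> V" "pvs.independent C" "V \<subseteq> pvs.span C" "card C = pvs.dim V"
    using pvs.basis_exists[of V] by blast
  then show ?thesis using independent_card_le_dim[OF assms(2), of C] assms(1) by simp
qed

text \<open>Extend a basis of \<open>W\<close> to a basis of \<open>V\<close>.\<close>

lemma ex_complement_basis:
  assumes V: "pvs.subspace V" "V \<subseteq> forms i" and W: "pvs.subspace W" "W \<subseteq> V"
  shows "\<exists>H. finite H \<and> H \<subseteq> V \<and> card H = pvs.dim V - pvs.dim W \<and> V \<subseteq> pvs.span (W \<union> H) \<and>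
    (\<forall>u. (\<Sum>h\<in>H. cscale (u h) h) \<in> W \<longrightarrow> (\<forall>h\<in>H. u h = 0))"
proof -
  obtain B where B: "B \<subseteq> W" "pvs.independent B" "W \<subseteq> pvs.span B" "card B = pvs.dim W"
    using pvs.basis_exists[of W] by blast
  have "B \<subseteq> V" using B(1) W(2) by (rule order_trans)
  then obtain C where C: "B \<subseteq> C" "C \<subseteq> V" "pvs.independent C" "V \<subseteq> pvs.span C"
    using pvs.maximal_independent_subset_extend[OF _ B(2)] by metis
  have fin: "finite C" using C(2,3) V(2) independent_forms_finite by (meson order_trans)
  then have finB: "finite B" using C(1) finite_subset by blast
  let ?H = "C - B"
  have "card C = pvs.dim V" using C(2,4,3) by (rule pvs.basis_card_eq_dim)
  then have card: "card ?H = pvs.dim V - pvs.dim W" using B(4) C(1) finB by (simp add: card_Diff_subset)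
  have "C \<subseteq> W \<union> ?H" using B(1) by blast
  then have span: "V \<subseteq> pvs.span (W \<union> ?H)" using C(4) pvs.span_mono by (meson order_trans)
  have "u h = 0" if u: "(\<Sum>h\<in>?H. cscale (u h) h) \<in> W" and h: "h \<in> ?H" for u h
  proof -
    have "(\<Sum>h\<in>?H. cscale (u h) h) \<in> pvs.span (id ` B)" using u B(3) by auto
    then obtain v where v: "(\<Sum>h\<in>?H. cscale (u h) h) = (\<Sum>b\<in>B. cscale (v b) (id b))"
      by (rule in_span_imageE[OF finB])
    let ?w = "\<lambda>c. if c \<in> B then - v c else u c"
    have "(\<Sum>c\<in>C. cscale (?w c) c) = (\<Sum>c\<in>?H. cscale (?w c) c) + (\<Sum>c\<in>B. cscale (?w c) c)"
      using C(1) fin by (simp add: sum.subset_diff)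
    also have "(\<Sum>c\<in>?H. cscale (?w c) c) = (\<Sum>c\<in>?H. cscale (u c) c)" by (rule sum.cong) auto
    also have "(\<Sum>c\<in>B. cscale (?w c) c) = (\<Sum>c\<in>B. - cscale (v c) c)"
      by (rule sum.cong) (simp_all add: pvs.scale_minus_left)
    also have "(\<Sum>c\<in>?H. cscale (u c) c) + (\<Sum>c\<in>B. - cscale (v c) c) = 0"
      unfolding v by (simp add: sum_negf)
    finally have "(\<Sum>c\<in>C. cscale (?w c) c) = 0" .
    from pvs.independentD[OF C(3) fin order_refl this, of h] h show ?thesis by simp
  qed
  then show ?thesis using fin C(2) card span by (intro exI[of _ ?H]) auto
qed

text \<open>The part of degree \<open>i + 1\<close> of \<open>(x, y) I\<close>.\<close>

definition var_span :: "'k::field bipoly set \<Rightarrow> nat \<Rightarrow> 'k bipoly set" where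
  "var_span I i = pvs.span ((*) varx ` (I \<inter> forms i) \<union> (*) vary ` (I \<inter> forms i))"

text \<open>The degree \<open>i\<close> part of \<open>(x, y) I\<close>.\<close>

definition decomposables :: "'k::field bipoly set \<Rightarrow> nat \<Rightarrow> 'k bipoly set" where
  "decomposables I i = (case i of 0 \<Rightarrow> {0} | Suc i' \<Rightarrow> var_span I i')"

lemma subspace_decomposables: "pvs.subspace (decomposables I i)"
  by (cases i) (simp_all add: decomposables_def var_span_def pvs.subspace_single_0 pvs.subspace_span)

lemma decomposables_subset:
  assumes "graded_ideal I"
  shows "decomposables I i \<subseteq> I \<inter> forms i"
proof (cases i)
  case 0
  then show ?thesis
    using pvs.subspace_0[OF graded_ideal_component(1)[OF assms, of 0]] by (simp add: decomposables_def)
next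
  case (Suc i')
  have "(*) varx ` (I \<inter> forms i') \<union> (*) vary ` (I \<inter> forms i') \<subseteq> I \<inter> forms i"
    using graded_ideal_component(2,3)[OF assms] unfolding Suc by (intro Un_least image_subsetI) 
  then have "pvs.span ((*) varx ` (I \<inter> forms i') \<union> (*) vary ` (I \<inter> forms i')) \<subseteq> I \<inter> forms i"
    using graded_ideal_component(1)[OF assms] by (rule pvs.span_minimal)
  then show ?thesis unfolding Suc decomposables_def var_span_def nat.case .
qed

lemma var_span_subset: "graded_ideal I \<Longrightarrow> var_span I i \<subseteq> I \<inter> forms (Suc i)"
  using decomposables_subset[of I "Suc i"] by (simp add: decomposables_def)

lemma var_mult_decomposable:
  assumes "f \<in> I \<inter> forms i"
  shows "varx * f \<in> decomposables I (Suc i)" "vary * f \<in> decomposables I (Suc i)"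
  using assms by (auto simp: decomposables_def var_span_def intro!: pvs.span_base)

text \<open>The pure power of \<open>y\<close> is divisible by \<open>y\<close>, the other monomials of positive degree by \<open>x\<close>.\<close>

lemma forms_Suc_decomposable:
  fixes I :: "'k::field bipoly set"
  assumes "forms i \<subseteq> I"
  shows "forms (Suc i) \<subseteq> decomposables I (Suc i)"
proof
  fix f :: "'k bipoly" assume "f \<in> forms (Suc i)"
  then obtain g where g: "degree g \<le> Suc i" "f = homog (Suc i) g" by (rule forms_homogE)
  define h where "h = g - monom (coeff g (Suc i)) (Suc i)"
  have "degree h \<le> Suc i" unfolding h_def by (intro degree_diff_le g(1) degree_monom_le)
  moreover have "coeff h (Suc i) = 0" by (simp add: h_def)
  ultimately have h: "degree h \<le> i"
    by (metis degree_0 le_Suc_eq leading_coeff_0_iff zero_le)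
  have g': "g = h + pCons 0 (monom (coeff g (Suc i)) i)" by (simp add: h_def monom_Suc)
  have "f = varx * homog i h + vary * homog i (monom (coeff g (Suc i)) i)"
    unfolding g(2) varx_homog[OF h] vary_homog homog_add[symmetric] g'[symmetric] ..
  moreover have "homog i h \<in> I \<inter> forms i" "homog i (monom (coeff g (Suc i)) i) \<in> I \<inter> forms i"
    using assms homog_in_forms by blast+
  ultimately show "f \<in> decomposables I (Suc i)"
    using pvs.subspace_add[OF subspace_decomposables] var_mult_decomposable by metis
qed

text \<open>Nakayama's lemma for graded ideals.  The generators need not be homogeneous: modulo
  \<open>(x, y) I\<close> every element of the ideal is a scalar combination of them.\<close>

lemma min_gens_eq:
  fixes I :: "'k::field bipoly set"
  assumes gr: "graded_ideal I" and top: "\<And>i. M \<le> i \<Longrightarrow> forms i \<subseteq> I"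
  shows "min_gens I = (\<Sum>i\<le>M. pvs.dim (I \<inter> forms i) - pvs.dim (decomposables I i))"
proof -
  note sub = graded_ideal_component(1)[OF gr]
  have idl: "ideals.subspace I" using gr by (simp add: graded_ideal_def)
  let ?Q = "\<lambda>i H. finite H \<and> H \<subseteq> I \<inter> forms i \<and>
      card H = pvs.dim (I \<inter> forms i) - pvs.dim (decomposables I i) \<and>
      I \<inter> forms i \<subseteq> pvs.span (decomposables I i \<union> H) \<and>
      (\<forall>u. (\<Sum>h\<in>H. cscale (u h) h) \<in> decomposables I i \<longrightarrow> (\<forall>h\<in>H. u h = 0))"
  have "\<forall>i. \<exists>H. ?Q i H"
    by (rule allI, rule ex_complement_basis[OF sub Int_lower2 subspace_decomposables decomposables_subset[OF gr]])
  from choice[OF this] obtain H where H: "\<forall>i. ?Q i (H i)" ..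
  note Hi = spec[OF H]
  note fin = Hi[THEN conjunct1] and HI = Hi[THEN conjunct2, THEN conjunct1]
    and card = Hi[THEN conjunct2, THEN conjunct2, THEN conjunct1]
    and span = Hi[THEN conjunct2, THEN conjunct2, THEN conjunct2, THEN conjunct1]
    and ind = Hi[THEN conjunct2, THEN conjunct2, THEN conjunct2, THEN conjunct2, THEN spec, THEN mp]
  have H0: "0 \<notin> H i" for i
  proof
    assume "0 \<in> H i"
    have "(\<Sum>h\<in>H i. cscale (if h = 0 then 1 else 0) h) = 0" by (rule sum.neutral) simp
    then have "(\<Sum>h\<in>H i. cscale (if h = 0 then 1 else 0) h) \<in> decomposables I i"
      using pvs.subspace_0[OF subspace_decomposables] by metis
    then show False using ind[of "\<lambda>h. if h = 0 then 1 else 0"] \<open>0 \<in> H i\<close> by fastforce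
  qed
  have disj: "H i \<inter> H j = {}" if "i \<noteq> j" for i j
  proof (rule ccontr)
    assume "H i \<inter> H j \<noteq> {}"
    then obtain h where h: "h \<in> H i" "h \<in> H j" by blast
    then have "hom_component i h = h" "hom_component i h = 0"
      using HI that hom_component_forms by (metis IntE subsetD)+
    then show False using H0 h by simp
  qed
  define G where "G = (\<Union>i\<le>M. H i)"
  have finG: "finite G" unfolding G_def using fin by simp
  have cardG: "card G = (\<Sum>i\<le>M. pvs.dim (I \<inter> forms i) - pvs.dim (decomposables I i))"
    unfolding G_def card[symmetric] using fin disj by (intro card_UN_disjoint) auto
  have GI: "G \<subseteq> I" using HI unfolding G_def by blast
  let ?J = "ideals.span G"
  have subJ: "pvs.subspace ?J" by (rule ideal_subspaceD[OF ideals.subspace_span])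
  have IJ: "I \<inter> forms i \<subseteq> ?J" for i
  proof (induction i)
    case 0
    have "decomposables I 0 \<union> H 0 \<subseteq> ?J"
      using pvs.subspace_0[OF subJ] ideals.span_superset[of G] by (auto simp: decomposables_def G_def)
    then have "pvs.span (decomposables I 0 \<union> H 0) \<subseteq> ?J" using subJ by (rule pvs.span_minimal)
    then show ?case using span[of 0] by (rule order_trans[rotated])
  next
    case (Suc i)
    have "(*) varx ` (I \<inter> forms i) \<union> (*) vary ` (I \<inter> forms i) \<subseteq> ?J"
      using Suc by (auto intro: ideals.span_scale)
    then have dec: "decomposables I (Suc i) \<subseteq> ?J"
      using subJ by (simp add: decomposables_def var_span_def pvs.span_minimal)
    show ?case
    proof (cases "Suc i \<le> M")
      case True
      then have "H (Suc i) \<subseteq> ?J" using ideals.span_superset[of G] unfolding G_def by blast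
      then have "pvs.span (decomposables I (Suc i) \<union> H (Suc i)) \<subseteq> ?J"
        using subJ dec by (intro pvs.span_minimal Un_least)
      then show ?thesis using span[of "Suc i"] by (rule order_trans[rotated])
    next
      case False
      then have "forms (Suc i) \<subseteq> decomposables I (Suc i)" by (intro forms_Suc_decomposable top) simp
      then show ?thesis using dec by blast
    qed
  qed
  have spanG: "?J = I"
  proof
    show "?J \<subseteq> I" using GI idl by (rule ideals.span_minimal)
    show "I \<subseteq> ?J"
    proof
      fix f assume "f \<in> I"
      then have "hom_component i f \<in> ?J" for i using graded_ideal_iff_components[OF gr] IJ by blast
      then show "f \<in> ?J" by (rule in_subspace_if_components[OF subJ])
    qed
  qed
  have lower: "card G \<le> card G'" if G': "finite G'" "ideals.span G' = I" for G'
  proof -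
    \<comment> \<open>this is \<open>(x, y) I\<close>\<close>
    define Q where "Q = chain_ideal (decomposables I)"
    have Q: "f \<in> Q \<longleftrightarrow> (\<forall>i. hom_component i f \<in> decomposables I i)" for f
      by (simp add: Q_def chain_ideal_def)
    have subQ: "pvs.subspace Q"
      unfolding pvs.subspace_def
    proof (intro conjI ballI allI)
      note sd = subspace_decomposables[of I]
      show "0 \<in> Q" unfolding Q hom_component_0 using pvs.subspace_0[OF sd] by blast
      show "f + g \<in> Q" if "f \<in> Q" "g \<in> Q" for f g
        using that pvs.subspace_add[OF sd] unfolding Q hom_component_add by blast
      show "cscale c f \<in> Q" if "f \<in> Q" for c f
        using that pvs.subspace_scale[OF sd] unfolding Q hom_component_cscale by blast
    qed
    have varQ: "varx * f \<in> Q \<and> vary * f \<in> Q" if "f \<in> I" for f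
    proof -
      have "hom_component i (varx * f) \<in> decomposables I i \<and> hom_component i (vary * f) \<in> decomposables I i" for i
      proof (cases i)
        case 0
        then show ?thesis
          using pvs.subspace_0[OF subspace_decomposables[of I 0]] by (simp add: hom_component_0_var_mult)
      next
        case (Suc i')
        have "hom_component i' f \<in> I \<inter> forms i'" using that graded_ideal_iff_components[OF gr] by blast
        then show ?thesis unfolding Suc hom_component_var_mult using var_mult_decomposable by blast
      qed
      then show ?thesis unfolding Q by blast
    qed
    \<comment> \<open>an ideal containing \<open>G'\<close>, hence all of \<open>I\<close>\<close>
    define W where "W = {f \<in> I. \<exists>s \<in> pvs.span G'. f - s \<in> Q}"
    have subI: "pvs.subspace I" by (rule ideal_subspaceD[OF idl])
    have "ideals.subspace W"
    proof (rule ideal_subspaceI)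
      show "pvs.subspace W"
        unfolding pvs.subspace_def
      proof (intro conjI ballI allI)
        have "0 \<in> I" "0 - 0 \<in> Q" using pvs.subspace_0[OF subI] pvs.subspace_0[OF subQ] by simp_all
        then show "0 \<in> W" unfolding W_def using pvs.span_zero by blast
        show "f + g \<in> W" if fg: "f \<in> W" "g \<in> W" for f g
        proof -
          obtain s t where st: "s \<in> pvs.span G'" "f - s \<in> Q" "t \<in> pvs.span G'" "g - t \<in> Q"
            using fg unfolding W_def by blast
          have "(f + g) - (s + t) = (f - s) + (g - t)" by simp
          then have "(f + g) - (s + t) \<in> Q" using pvs.subspace_add[OF subQ st(2,4)] by metis
          moreover have "f + g \<in> I" using fg pvs.subspace_add[OF subI] unfolding W_def by blast
          ultimately show ?thesis unfolding W_def using pvs.span_add[OF st(1,3)] by blast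
        qed
        show "cscale c f \<in> W" if f: "f \<in> W" for c f
        proof -
          obtain s where s: "s \<in> pvs.span G'" "f - s \<in> Q" using f unfolding W_def by blast
          have "cscale c f - cscale c s \<in> Q"
            using pvs.subspace_scale[OF subQ s(2), of c] by (simp add: pvs.scale_right_diff_distrib)
          moreover have "cscale c f \<in> I" using f pvs.subspace_scale[OF subI] unfolding W_def by blast
          ultimately show ?thesis unfolding W_def using pvs.span_scale[OF s(1)] by blast
        qed
      qed
      fix f assume "f \<in> W"
      then have "f \<in> I" unfolding W_def by blast
      have "varx * f \<in> I" "vary * f \<in> I" using ideals.subspace_scale[OF idl \<open>f \<in> I\<close>] by blast+
      moreover have "varx * f - 0 \<in> Q" "vary * f - 0 \<in> Q" using varQ[OF \<open>f \<in> I\<close>] by simp_all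
      ultimately show "varx * f \<in> W" "vary * f \<in> W" unfolding W_def using pvs.span_zero by blast+
    qed
    moreover have "G' \<subseteq> W"
    proof
      fix g assume "g \<in> G'"
      then have "g \<in> I" "g \<in> pvs.span G'" using ideals.span_base G'(2) pvs.span_base by blast+
      moreover have "g - g \<in> Q" using pvs.subspace_0[OF subQ] by simp
      ultimately show "g \<in> W" unfolding W_def by blast
    qed
    ultimately have "I \<subseteq> W" using ideals.span_minimal G'(2) by metis
    then have "\<forall>h\<in>G. \<exists>s. s \<in> pvs.span G' \<and> h - s \<in> Q" using GI unfolding W_def by blast
    then obtain s where s: "\<And>h. h \<in> G \<Longrightarrow> s h \<in> pvs.span G'" "\<And>h. h \<in> G \<Longrightarrow> h - s h \<in> Q"
      by metis
    have "indep_fam G (\<lambda>h. lookup (s h))"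
      unfolding indep_fam_def
    proof (intro allI impI ballI)
      fix u h assume u: "\<forall>m. (\<Sum>h\<in>G. u h * lookup (s h) m) = 0" and h: "h \<in> G"
      have "(\<Sum>h\<in>G. cscale (u h) (s h)) = 0"
        using u by (intro poly_mapping_eqI) (simp add: lookup_sum del: split_paired_All)
      then have "(\<Sum>h\<in>G. cscale (u h) h) = (\<Sum>h\<in>G. cscale (u h) (h - s h))"
        by (simp add: pvs.scale_right_diff_distrib sum_subtractf)
      also have "\<dots> \<in> Q" using s(2) by (intro pvs.subspace_sum[OF subQ] pvs.subspace_scale[OF subQ])
      finally have inQ: "hom_component i (\<Sum>h\<in>G. cscale (u h) h) \<in> decomposables I i" for i
        unfolding Q by blast
      obtain i where i: "i \<le> M" "h \<in> H i" using h unfolding G_def by blast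
      have "hom_component i (\<Sum>h\<in>G. cscale (u h) h) = (\<Sum>h\<in>G. cscale (u h) (hom_component i h))"
        by (simp add: hom_component_sum hom_component_cscale)
      also have "\<dots> = (\<Sum>h\<in>H i. cscale (u h) h)"
      proof (rule sum.mono_neutral_cong_right[OF finG])
        show "H i \<subseteq> G" using i(1) unfolding G_def by blast
        show "\<forall>h\<in>G - H i. cscale (u h) (hom_component i h) = 0"
        proof
          fix h assume "h \<in> G - H i"
          then obtain j where "h \<in> H j" "j \<noteq> i" unfolding G_def by blast
          then have "hom_component i h = 0" using HI hom_component_forms by (metis IntE subsetD)
          then show "cscale (u h) (hom_component i h) = 0" by simp
        qed
        show "cscale (u h) (hom_component i h) = cscale (u h) h" if "h \<in> H i" for h
          using that HI hom_component_forms by (metis IntE subsetD)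
      qed
      finally have "(\<Sum>h\<in>H i. cscale (u h) h) \<in> decomposables I i" using inQ[of i] by metis
      then show "u h = 0" using ind i(2) by blast
    qed
    then have "inj_on s G" "pvs.independent (s ` G)"
      unfolding indep_fam_iff_independent[OF finG] by blast+
    moreover have "s ` G \<subseteq> pvs.span G'" using s(1) by blast
    ultimately show ?thesis
      using pvs.independent_span_bound[OF G'(1), of "s ` G"] by (simp add: card_image)
  qed
  show ?thesis
    unfolding min_gens_def cardG[symmetric]
  proof (rule Least_equality)
    show "\<exists>G'. finite G' \<and> card G' = card G \<and> ideals.span G' = I" using finG spanG by blast
    show "card G \<le> k" if "\<exists>G'. finite G' \<and> card G' = k \<and> ideals.span G' = I" for k
      using that lower by blast
  qed
qed

lemma dim_forms: "pvs.dim (forms i :: 'k::field bipoly set) = i + 1"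
proof -
  have gr: "graded_ideal (UNIV :: 'k bipoly set)"
    by (simp add: graded_ideal_def ideals.subspace_UNIV)
  have "b \<in> lead_exps (UNIV :: 'k bipoly set) i" if "b \<le> i" for b
    unfolding lead_exps_def
    by (intro CollectI exI[of _ "monom 1 b"]) (use that in \<open>simp add: degree_monom_eq\<close>)
  then have "lead_exps (UNIV :: 'k bipoly set) i = {..i}" using lead_exps_le by blast
  then show ?thesis using card_lead_exps[OF gr, of i] by simp
qed

lemma forms_subset_if_hilbert_0:
  fixes I :: "'k::field bipoly set"
  assumes gr: "graded_ideal I" and "hilbert_fun I i = 0"
  shows "forms i \<subseteq> I"
proof -
  note sub = graded_ideal_component(1)[OF gr, of i]
  from ex_complement_basis[OF subspace_forms order_refl sub Int_lower2]
  obtain H where H: "finite H \<and> H \<subseteq> forms i \<and> card H = pvs.dim (forms i :: 'k bipoly set) - pvs.dim (I \<inter> forms i) \<and>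
      forms i \<subseteq> pvs.span (I \<inter> forms i \<union> H) \<and>
      (\<forall>u. (\<Sum>h\<in>H. cscale (u h) h) \<in> I \<inter> forms i \<longrightarrow> (\<forall>h\<in>H. u h = 0))" ..
  have "card H = 0" using assms(2) H by (simp add: dim_forms hilbert_fun_def)
  then have "H = {}" using H[THEN conjunct1] card_0_eq by blast
  then have "forms i \<subseteq> pvs.span (I \<inter> forms i)" using H by simp
  also have "\<dots> = I \<inter> forms i" using sub by (rule pvs.span_eq_iff[THEN iffD2])
  finally show ?thesis by (rule order_trans[OF _ Int_lower1])
qed

text \<open>If some products of frame elements with \<open>x\<close> and \<open>y\<close> are independent, then the same products
  stay independent for all frames nearby.\<close>

lemma openin_dim_var_span:
  fixes T :: "nat \<Rightarrow> nat"
  shows "openin (zariski T) {I \<in> G_T T. q \<le> pvs.dim (var_span (I :: 'k::field bipoly set) i)}"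
proof (rule openin_zariskiI)
  let ?U = "{I \<in> G_T T. q \<le> pvs.dim (var_span (I :: 'k bipoly set) i)}"
  show "?U \<subseteq> G_T T" by blast
  let ?S0 = "UNIV \<times> {..<i + 1 - T i} :: (bool \<times> nat) set"
  define V :: "(nat \<Rightarrow> nat \<Rightarrow> 'k bipoly) \<Rightarrow> bool \<times> nat \<Rightarrow> 'k bipoly" where
    "V B r = (if fst r then varx else vary) * B i (snd r)" for B r
  define v where "v r B m = (if mdeg m = Suc i then lookup (V B r) m else 0)" for r B m
  have var: "var_span I i = pvs.span (V B ` ?S0)" if "frame T I B" for I B
  proof -
    let ?F = "B i ` {..<i + 1 - T i}"
    have F: "I \<inter> forms i = pvs.span ?F" using that unfolding frame_def by metis
    have img: "V B ` ?S0 = (*) varx ` ?F \<union> (*) vary ` ?F"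
    proof -
      have "?S0 = Pair True ` {..<i + 1 - T i} \<union> Pair False ` {..<i + 1 - T i}"
        by (auto simp: UNIV_bool)
      then show ?thesis by (simp only: V_def image_Un image_image fst_conv snd_conv if_True if_False)
    qed
    have a: "w * f \<in> pvs.span (V B ` ?S0)" if "w = varx \<or> w = vary" "f \<in> pvs.span ?F" for w f
      by (rule span_mult[OF _ that(2)], rule pvs.span_base) (use that(1) img in blast)
    show ?thesis
    proof
      show "var_span I i \<subseteq> pvs.span (V B ` ?S0)"
        unfolding var_span_def F by (intro pvs.span_minimal pvs.subspace_span Un_least image_subsetI a) simp_all
      show "pvs.span (V B ` ?S0) \<subseteq> var_span I i"
        unfolding var_span_def F img by (intro pvs.span_mono Un_mono image_mono pvs.span_superset)
    qed
  qed
  have Vforms: "V B r \<in> forms (Suc i)" if "frame T I B" "r \<in> ?S0" for I B r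
  proof -
    have "B i (snd r) \<in> pvs.span (B i ` {..<i + 1 - T i})" using that(2) by (intro pvs.span_base) auto
    then have "B i (snd r) \<in> forms i" using that(1) unfolding frame_def by blast
    then show ?thesis unfolding V_def by (auto intro: mult_var_forms)
  qed
  have vV: "v r B = lookup (V B r)" if "frame T I B" "r \<in> ?S0" for I B r
    using Vforms[OF that] unfolding v_def forms_iff by (intro ext) metis
  have vpoly: "(\<lambda>B. v r B m) \<in> frame_polys T" if "r \<in> ?S0" for r m
  proof -
    obtain e k where r: "r = (e, k)" by (cases r)
    obtain a b where m: "m = (a, b)" by (cases m)
    have k: "k < i + 1 - T i" using that r by simp
    note rk = r k m
    show ?thesis
    proof (cases "mdeg m = Suc i \<and> (if e then a \<noteq> 0 else b \<noteq> 0)")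
      case True
      then have *: "(\<lambda>B. v r B m) =
          (\<lambda>B. lookup (B i k) (if e then (a - 1, b) else (a, b - 1)))"
        unfolding v_def V_def rk by (auto simp: lookup_varx_mult lookup_vary_mult fun_eq_iff)
      show ?thesis unfolding * using True rk by (intro frame_polys.coord) (auto simp: mdeg_def)
    next
      case False
      then have *: "(\<lambda>B. v r B m) = (\<lambda>B. 0)"
        unfolding v_def V_def rk by (auto simp: lookup_varx_mult lookup_vary_mult fun_eq_iff split: if_splits)
      show ?thesis unfolding * by (rule frame_polys.const)
    qed
  qed
  fix I :: "'k bipoly set" and B assume I: "I \<in> ?U" and B: "frame T I B"
  obtain C where C: "C \<subseteq> V B ` ?S0" "pvs.independent C" "V B ` ?S0 \<subseteq> pvs.span C" "card C = pvs.dim (V B ` ?S0)"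
    using pvs.basis_exists[of "V B ` ?S0"] by blast
  have "pvs.dim (var_span I i) = card C" unfolding var[OF B] C(4) by (rule pvs.dim_span)
  then have "q \<le> card C" using I by simp
  moreover have "finite C" by (rule finite_subset[OF C(1)]) simp
  ultimately obtain C' where C': "C' \<subseteq> C" "card C' = q" using obtain_subset_with_card_n by metis
  have "C' \<subseteq> V B ` ?S0" by (rule order_trans[OF C'(1) C(1)])
  then obtain S where S: "S \<subseteq> ?S0" "inj_on (V B) S" "C' = V B ` S" by (meson subset_image_inj)
  have finS: "finite S" by (rule finite_subset[OF S(1)]) simp
  have "pvs.independent C'" using C(2) C'(1) by (rule pvs.independent_mono)
  then have "indep_fam S (\<lambda>r. lookup (V B r))"
    unfolding indep_fam_iff_independent[OF finS] using S by blast
  moreover have eqS: "indep_fam S (\<lambda>r. v r B') \<longleftrightarrow> indep_fam S (\<lambda>r. lookup (V B' r))"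
    if "frame T J B'" for J B'
  proof -
    have "v r B' = lookup (V B' r)" if "r \<in> S" for r
      using vV[OF \<open>frame T J B'\<close>] S(1) that by blast
    then show ?thesis unfolding indep_fam_def by (metis (mono_tags, lifting) sum.cong)
  qed
  ultimately have "indep_fam S (\<lambda>r. v r B)" using B by blast
  moreover have "(\<lambda>B. v r B m) \<in> frame_polys T" if "r \<in> S" for r m using vpoly S(1) that by blast
  ultimately obtain p where p: "p \<in> frame_polys T" "p B \<noteq> 0" "\<forall>B'. p B' \<noteq> 0 \<longrightarrow> indep_fam S (\<lambda>r. v r B')"
    using indep_fam_open[OF finS, of v T B] by blast
  have "J \<in> ?U" if J: "J \<in> G_T T" "frame T J B'" "p B' \<noteq> 0" for J B'
  proof -
    have "indep_fam S (\<lambda>r. lookup (V B' r))" using p(3) J eqS by blast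
    then have *: "inj_on (V B') S" "pvs.independent (V B' ` S)"
      unfolding indep_fam_iff_independent[OF finS] by blast+
    have "graded_ideal J" using J(1) by (simp add: G_T_def)
    then have "var_span J i \<subseteq> forms (Suc i)" using var_span_subset by blast
    moreover have "V B' ` S \<subseteq> var_span J i"
      unfolding var[OF J(2)] by (rule order_trans[OF image_mono[OF S(1)] pvs.span_superset])
    ultimately have "card (V B' ` S) \<le> pvs.dim (var_span J i)"
      using *(2) by (rule independent_card_le_dim)
    moreover have "card (V B' ` S) = q" using *(1) C'(2) S(2,3) by (simp add: card_image)
    ultimately show ?thesis using J(1) by simp
  qed
  then show "\<exists>p \<in> frame_polys T. p B \<noteq> 0 \<and>
       (\<forall>J\<in>G_T T. \<forall>B'. frame T J B' \<longrightarrow> p B' \<noteq> 0 \<longrightarrow> J \<in> ?U)"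
    using p(1,2) by blast
qed

lemma openin_dims_var_span:
  "openin (zariski T) {I \<in> G_T T. \<forall>i<M. q i \<le> pvs.dim (var_span (I :: 'k::field bipoly set) i)}"
proof (induction M)
  case 0
  show ?case using openin_topspace[of "zariski T :: 'k bipoly set topology"] by simp
next
  case (Suc M)
  have "{I \<in> G_T T. \<forall>i<Suc M. q i \<le> pvs.dim (var_span (I :: 'k bipoly set) i)} =
     {I \<in> G_T T. \<forall>i<M. q i \<le> pvs.dim (var_span I i)} \<inter> {I \<in> G_T T. q M \<le> pvs.dim (var_span I M)}"
    by (auto simp: less_Suc_eq)
  then show ?case using openin_Int[OF Suc openin_dim_var_span[of T "q M" M]] by simp
qed

section \<open>The generic number of generators of a cell\<close>

text \<open>Modulo the lower spaces, multiplication by \<open>y\<close> takes \<open>g_c\<close> to \<open>g_(c+1)\<close> plus a combination of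
  the \<open>g_b\<close> with \<open>b \<le> c\<close>.  The rows \<open>c\<close> with \<open>n c = i\<close> and the columns \<open>b\<close> with
  \<open>n b = i + 1\<close> form a matrix with ones next to the diagonal, zeros beyond, and free entries
  before; different \<open>i\<close> use different entries.  Its rank measures \<open>(x, y) I\<close> in degree \<open>i + 1\<close>.\<close>

definition hess_entry :: "(nat \<Rightarrow> nat \<Rightarrow> 'k::field) \<Rightarrow> nat \<Rightarrow> nat \<Rightarrow> 'k" where
  "hess_entry \<alpha> c b = (if b = Suc c then 1 else if b \<le> c then \<alpha> c b else 0)"

definition rows_indep :: "(nat \<Rightarrow> nat \<Rightarrow> 'k::field) \<Rightarrow> nat set \<Rightarrow> nat set \<Rightarrow> bool" where
  "rows_indep \<alpha> A B \<longleftrightarrow> indep_fam A (\<lambda>c b. if b \<in> B then hess_entry \<alpha> c b else 0)"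

text \<open>The largest rank over all choices of the free entries, as a number of independent rows.\<close>

definition gen_rank :: "'k::field itself \<Rightarrow> nat set \<Rightarrow> nat set \<Rightarrow> nat" where
  "gen_rank _ A B = Max {card A' | A'. A' \<subseteq> A \<and> (\<exists>\<alpha> :: nat \<Rightarrow> nat \<Rightarrow> 'k. rows_indep \<alpha> A' B)}"

lemma rows_indep_iff:
  "rows_indep \<alpha> A B \<longleftrightarrow> (\<forall>u. (\<forall>b\<in>B. (\<Sum>c\<in>A. u c * hess_entry \<alpha> c b) = 0) \<longrightarrow> (\<forall>c\<in>A. u c = 0))"
proof -
  have "(\<forall>b. (\<Sum>c\<in>A. u c * (if b \<in> B then hess_entry \<alpha> c b else 0)) = 0) \<longleftrightarrow>
      (\<forall>b\<in>B. (\<Sum>c\<in>A. u c * hess_entry \<alpha> c b) = 0)" (is "?L \<longleftrightarrow> ?R") for u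
  proof
    assume L: ?L
    show ?R
    proof
      fix b assume "b \<in> B"
      then show "(\<Sum>c\<in>A. u c * hess_entry \<alpha> c b) = 0" using L[rule_format, of b] by simp
    qed
  next
    assume R: ?R
    show ?L
    proof
      fix b
      show "(\<Sum>c\<in>A. u c * (if b \<in> B then hess_entry \<alpha> c b else 0)) = 0"
        using R by (cases "b \<in> B") simp_all
    qed
  qed
  then show ?thesis unfolding rows_indep_def indep_fam_def by simp
qed

lemma rows_indep_cong:
  assumes "\<And>c b. c \<in> A \<Longrightarrow> b \<in> B \<Longrightarrow> hess_entry \<alpha> c b = hess_entry \<beta> c b"
  shows "rows_indep \<alpha> A B \<longleftrightarrow> rows_indep \<beta> A B"
proof -
  have "(\<Sum>c\<in>A. u c * hess_entry \<alpha> c b) = (\<Sum>c\<in>A. u c * hess_entry \<beta> c b)" if "b \<in> B" for u b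
    using assms that by (intro sum.cong) simp_all
  then show ?thesis unfolding rows_indep_iff by simp
qed

context
  fixes A :: "nat set"
  assumes fin: "finite A"
begin

lemma gen_rank_set:
  "finite {card A' | A'. A' \<subseteq> A \<and> (\<exists>\<alpha> :: nat \<Rightarrow> nat \<Rightarrow> 'k::field. rows_indep \<alpha> A' B)}"
  "0 \<in> {card A' | A'. A' \<subseteq> A \<and> (\<exists>\<alpha> :: nat \<Rightarrow> nat \<Rightarrow> 'k::field. rows_indep \<alpha> A' B)}"
proof -
  have "{card A' | A'. A' \<subseteq> A \<and> (\<exists>\<alpha> :: nat \<Rightarrow> nat \<Rightarrow> 'k. rows_indep \<alpha> A' B)} \<subseteq> card ` Pow A" by blast
  then show "finite {card A' | A'. A' \<subseteq> A \<and> (\<exists>\<alpha> :: nat \<Rightarrow> nat \<Rightarrow> 'k. rows_indep \<alpha> A' B)}"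
    using fin finite_subset by blast
  have "rows_indep (\<lambda>_ _. 0 :: 'k) {} B" by (simp add: rows_indep_iff)
  then show "0 \<in> {card A' | A'. A' \<subseteq> A \<and> (\<exists>\<alpha> :: nat \<Rightarrow> nat \<Rightarrow> 'k. rows_indep \<alpha> A' B)}"
    by (intro CollectI exI[of _ "{}"]) auto
qed

lemma gen_rank_ge:
  fixes \<alpha> :: "nat \<Rightarrow> nat \<Rightarrow> 'k::field"
  assumes "A' \<subseteq> A" "rows_indep \<alpha> A' B"
  shows "card A' \<le> gen_rank TYPE('k) A B"
  unfolding gen_rank_def by (rule Max_ge[OF gen_rank_set(1)]) (use assms in blast)

lemma gen_rank_attained:
  "\<exists>A' (\<alpha> :: nat \<Rightarrow> nat \<Rightarrow> 'k::field). A' \<subseteq> A \<and> rows_indep \<alpha> A' B \<and> card A' = gen_rank TYPE('k) A B"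
proof -
  have "gen_rank TYPE('k) A B \<in> {card A' | A'. A' \<subseteq> A \<and> (\<exists>\<alpha> :: nat \<Rightarrow> nat \<Rightarrow> 'k. rows_indep \<alpha> A' B)}"
    unfolding gen_rank_def by (rule Max_in[OF gen_rank_set(1)]) (use gen_rank_set(2) in blast)
  then show ?thesis by (smt (verit) mem_Collect_eq)
qed

lemma gen_rank_le_card: "gen_rank TYPE('k::field) A B \<le> card A"
proof -
  obtain A' and \<alpha> :: "nat \<Rightarrow> nat \<Rightarrow> 'k" where "A' \<subseteq> A" "card A' = gen_rank TYPE('k) A B"
    using gen_rank_attained[of B] by metis
  then show ?thesis using card_mono[OF fin] by metis
qed

end

abbreviation step_rank :: "'k::field itself \<Rightarrow> (nat \<Rightarrow> nat) \<Rightarrow> nat \<Rightarrow> nat" where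
  "step_rank K n i \<equiv> gen_rank K {c. n c = i} {b. n b = Suc i}"

lemma finite_height_eq: "height_fun n \<Longrightarrow> finite {b. n b = i}"
  by (rule finite_subset[OF _ finite_height_le[of n i]]) auto

lemma card_height_Suc:
  assumes "height_fun n"
  shows "card {b. n b \<le> Suc i} = card {b. n b \<le> i} + card {b. n b = Suc i}"
proof -
  have "{b. n b \<le> Suc i} = {b. n b \<le> i} \<union> {b. n b = Suc i}" by auto
  moreover have "{b. n b \<le> i} \<inter> {b. n b = Suc i} = {}" by auto
  ultimately show ?thesis
    using finite_height_le[OF assms] finite_height_eq[OF assms] by (simp add: card_Un_disjoint)
qed

context
  fixes n :: "nat \<Rightarrow> nat" and \<alpha> :: "nat \<Rightarrow> nat \<Rightarrow> 'k::field"
  assumes n: "height_fun n" and adm: "admissible n \<alpha>"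
begin

lemma vary_hess_basis:
  assumes "n c \<le> i"
  shows "homog (Suc i) (pCons 0 (hess_basis \<alpha> c)) =
    (\<Sum>b | n b \<le> Suc i. cscale (hess_entry \<alpha> c b) (homog (Suc i) (hess_basis \<alpha> b)))"
proof -
  let ?g = "\<lambda>b. smult (hess_entry \<alpha> c b) (hess_basis \<alpha> b)"
  have "pCons 0 (hess_basis \<alpha> c) = hess_basis \<alpha> (Suc c) + (\<Sum>b\<in>{..c}. smult (\<alpha> c b) (hess_basis \<alpha> b))"
    by (rule pCons_hess_basis)
  also have "(\<Sum>b\<in>{..c}. smult (\<alpha> c b) (hess_basis \<alpha> b)) = (\<Sum>b\<in>{..c}. ?g b)"
    by (rule sum.cong) (auto simp: hess_entry_def)
  also have "hess_basis \<alpha> (Suc c) = ?g (Suc c)" by (simp add: hess_entry_def del: hess_basis.simps)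
  also have "?g (Suc c) + (\<Sum>b\<in>{..c}. ?g b) = (\<Sum>b\<in>{..Suc c}. ?g b)"
    by (simp only: sum.atMost_Suc add.commute)
  also have "\<dots> = (\<Sum>b\<in>{b. n b \<le> Suc i} \<inter> {..Suc c}. ?g b)"
  proof (rule sum.mono_neutral_right)
    show "\<forall>b\<in>{..Suc c} - {b. n b \<le> Suc i} \<inter> {..Suc c}. ?g b = 0"
    proof
      fix b assume b: "b \<in> {..Suc c} - {b. n b \<le> Suc i} \<inter> {..Suc c}"
      have "n (Suc c) \<le> Suc i" using height_funD(2)[OF n, of c] assms by simp
      then have "b \<noteq> Suc c" using b by auto
      moreover have "\<alpha> c b = 0"
      proof (rule ccontr)
        assume "\<alpha> c b \<noteq> 0"
        then have "n b \<le> Suc (n c)" using adm by (simp add: admissible_def)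
        then show False using b assms by simp
      qed
      ultimately show "?g b = 0" by (simp add: hess_entry_def)
    qed
  qed auto
  also have "\<dots> = (\<Sum>b | n b \<le> Suc i. ?g b)"
    by (rule sum.mono_neutral_left[OF finite_height_le[OF n]]) (auto simp: hess_entry_def)
  finally show ?thesis by (simp only: homog_sum homog_smult)
qed

text \<open>Only the \<open>g_c\<close> with \<open>n c = i\<close> contribute products with \<open>y\<close>: for smaller \<open>n c\<close> the product
  already occurs in degree \<open>i\<close>.\<close>

lemma var_span_cell_ideal:
  "var_span (cell_ideal n \<alpha>) i =
     pvs.span ((\<lambda>c. homog (Suc i) (hess_basis \<alpha> c)) ` {c. n c \<le> i} \<union>
               (\<lambda>c. homog (Suc i) (pCons 0 (hess_basis \<alpha> c))) ` {c. n c = i})"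
  (is "_ = pvs.span (?F ` ?D \<union> ?Y ` ?N)")
proof -
  let ?G = "(\<lambda>c. homog i (hess_basis \<alpha> c)) ` ?D"
  have deg: "c \<le> i" if "n c \<le> i" for c using height_funD(1)[OF n, of c] that by simp
  have x: "varx * homog i (hess_basis \<alpha> c) = ?F c" if "n c \<le> i" for c
    using deg[OF that] by (simp add: varx_homog)
  have y: "vary * homog i (hess_basis \<alpha> c) = ?Y c" for c by (rule vary_homog)
  have comp: "cell_ideal n \<alpha> \<inter> forms i = pvs.span ?G" by (rule cell_ideal_component(2)[OF n adm])
  show ?thesis
  proof
    have "varx * f \<in> pvs.span (?F ` ?D \<union> ?Y ` ?N)" if "f \<in> pvs.span ?G" for f
    proof (rule span_mult[OF _ that])
      fix f assume "f \<in> ?G"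
      then obtain c where c: "n c \<le> i" "f = homog i (hess_basis \<alpha> c)" by auto
      show "varx * f \<in> pvs.span (?F ` ?D \<union> ?Y ` ?N)"
        unfolding c(2) x[OF c(1)] by (rule pvs.span_base) (use c(1) in auto)
    qed
    moreover have "vary * f \<in> pvs.span (?F ` ?D \<union> ?Y ` ?N)" if "f \<in> pvs.span ?G" for f
    proof (rule span_mult[OF _ that])
      fix f assume "f \<in> ?G"
      then obtain c where c: "n c \<le> i" "f = homog i (hess_basis \<alpha> c)" by auto
      show "vary * f \<in> pvs.span (?F ` ?D \<union> ?Y ` ?N)"
      proof (cases "n c = i")
        case True
        then show ?thesis unfolding c(2) y by (intro pvs.span_base) auto
      next
        case False
        then obtain i' where i': "i = Suc i'" "n c \<le> i'" using c(1) by (cases i) auto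
        have "?Y c = varx * homog i (pCons 0 (hess_basis \<alpha> c))"
          using deg[of c] height_funD(1)[OF n, of c] i' by (simp add: varx_homog)
        also have "\<dots> = (\<Sum>b | n b \<le> i. cscale (hess_entry \<alpha> c b) (varx * homog i (hess_basis \<alpha> b)))"
          unfolding i'(1) vary_hess_basis[OF i'(2)] sum_distrib_left cscale_mult ..
        also have "\<dots> = (\<Sum>b | n b \<le> i. cscale (hess_entry \<alpha> c b) (?F b))"
          by (rule sum.cong) (simp_all add: x)
        also have "\<dots> \<in> pvs.span (?F ` ?D \<union> ?Y ` ?N)"
          by (intro pvs.span_sum pvs.span_scale pvs.span_base) auto
        finally show ?thesis unfolding c(2) y .
      qed
    qed
    ultimately show "var_span (cell_ideal n \<alpha>) i \<subseteq> pvs.span (?F ` ?D \<union> ?Y ` ?N)"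
      unfolding var_span_def comp by (intro pvs.span_minimal pvs.subspace_span Un_least image_subsetI)
    have "?F ` ?D \<union> ?Y ` ?N \<subseteq> var_span (cell_ideal n \<alpha>) i"
      unfolding var_span_def comp
    proof (intro Un_least image_subsetI)
      fix c assume "c \<in> ?D"
      then have c: "n c \<le> i" by simp
      then have "homog i (hess_basis \<alpha> c) \<in> pvs.span ?G" by (intro pvs.span_base) auto
      then show "?F c \<in> pvs.span ((*) varx ` pvs.span ?G \<union> (*) vary ` pvs.span ?G)"
        unfolding x[OF c, symmetric] by - (rule pvs.span_base, rule UnI1, erule imageI)
    next
      fix c assume "c \<in> ?N"
      then have "homog i (hess_basis \<alpha> c) \<in> pvs.span ?G" by (intro pvs.span_base) auto
      then show "?Y c \<in> pvs.span ((*) varx ` pvs.span ?G \<union> (*) vary ` pvs.span ?G)"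
        unfolding y[symmetric] by - (rule pvs.span_base, rule UnI2, erule imageI)
    qed
    then show "pvs.span (?F ` ?D \<union> ?Y ` ?N) \<subseteq> var_span (cell_ideal n \<alpha>) i"
      unfolding var_span_def by (intro pvs.span_minimal pvs.subspace_span)
  qed
qed

text \<open>Expand the products in the basis \<open>g_d\<close> of degree \<open>i + 1\<close>: the coordinates with \<open>n d \<le> i\<close> are
  cleared by the lower basis elements, and the remaining ones are the rows of the matrix.\<close>

lemma rows_indep_iff_indep_fam:
  assumes A: "A \<subseteq> {c. n c = i}"
  shows "rows_indep \<alpha> A {b. n b = Suc i} \<longleftrightarrow>
    indep_fam (Inl ` {c. n c \<le> i} \<union> Inr ` A) (\<lambda>r. lookup
      (case_sum (\<lambda>c. homog (Suc i) (hess_basis \<alpha> c)) (\<lambda>c. homog (Suc i) (pCons 0 (hess_basis \<alpha> c))) r))"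
  (is "_ \<longleftrightarrow> indep_fam ?S (\<lambda>r. lookup (case_sum ?F ?Y r))")
proof -
  let ?D = "\<lambda>i. {c. n c \<le> i}"
  have finD: "finite (?D i)" "finite (?D (Suc i))" by (rule finite_height_le[OF n])+
  have finA: "finite A" by (rule finite_subset[OF A finite_height_eq[OF n]])
  let ?w = "\<lambda>u d. (if n d \<le> i then u (Inl d) else 0) + (\<Sum>c\<in>A. u (Inr c) * hess_entry \<alpha> c d)"
  have F: "indep_fam (?D (Suc i)) (\<lambda>d. lookup (?F d))" by (rule indep_fam_hess_basis[OF n])
  have comb: "(\<Sum>r\<in>?S. u r * lookup (case_sum ?F ?Y r) m) =
      (\<Sum>d\<in>?D (Suc i). ?w u d * lookup (?F d) m)" for u :: "nat + nat \<Rightarrow> 'k" and m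
  proof -
    have "(\<Sum>r\<in>?S. u r * lookup (case_sum ?F ?Y r) m) =
        (\<Sum>c\<in>?D i. u (Inl c) * lookup (?F c) m) + (\<Sum>c\<in>A. u (Inr c) * lookup (?Y c) m)"
      using finD finA by (subst sum.union_disjoint) (auto simp: sum.reindex)
    also have "(\<Sum>c\<in>?D i. u (Inl c) * lookup (?F c) m) =
        (\<Sum>d\<in>?D (Suc i). (if n d \<le> i then u (Inl d) else 0) * lookup (?F d) m)"
      by (rule sum.mono_neutral_cong_left[OF finD(2)]) auto
    also have "(\<Sum>c\<in>A. u (Inr c) * lookup (?Y c) m) =
        (\<Sum>c\<in>A. \<Sum>d\<in>?D (Suc i). u (Inr c) * hess_entry \<alpha> c d * lookup (?F d) m)"
    proof (rule sum.cong[OF refl])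
      fix c assume "c \<in> A"
      then have "n c \<le> i" using A by auto
      then show "u (Inr c) * lookup (?Y c) m =
          (\<Sum>d\<in>?D (Suc i). u (Inr c) * hess_entry \<alpha> c d * lookup (?F d) m)"
        unfolding vary_hess_basis[OF \<open>n c \<le> i\<close>] by (simp only: lookup_sum lookup_cscale sum_distrib_left mult.assoc)
    qed
    also have "\<dots> = (\<Sum>d\<in>?D (Suc i). (\<Sum>c\<in>A. u (Inr c) * hess_entry \<alpha> c d) * lookup (?F d) m)"
      by (subst sum.swap) (simp only: sum_distrib_right)
    finally show ?thesis by (simp only: sum.distrib[symmetric] distrib_right)
  qed
  show ?thesis
  proof
    assume rows: "rows_indep \<alpha> A {b. n b = Suc i}"
    show "indep_fam ?S (\<lambda>r. lookup (case_sum ?F ?Y r))"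
      unfolding indep_fam_def comb
    proof (intro allI impI)
      fix u :: "nat + nat \<Rightarrow> 'k" assume "\<forall>m. (\<Sum>d\<in>?D (Suc i). ?w u d * lookup (?F d) m) = 0"
      note u = this[rule_format]
      have w: "?w u d = 0" if "n d \<le> Suc i" for d
        using indep_famD[OF F u, of d] that by simp
      have "\<forall>b\<in>{b. n b = Suc i}. (\<Sum>c\<in>A. u (Inr c) * hess_entry \<alpha> c b) = 0"
      proof
        fix b assume "b \<in> {b. n b = Suc i}"
        then show "(\<Sum>c\<in>A. u (Inr c) * hess_entry \<alpha> c b) = 0" using w[of b] by simp
      qed
      then have 0: "u (Inr c) = 0" if "c \<in> A" for c
        using rows[unfolded rows_indep_iff, THEN spec, of "\<lambda>c. u (Inr c)"] that by simp
      then have "u (Inl c) = 0" if "n c \<le> i" for c using w[of c] that by simp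
      then show "\<forall>r\<in>?S. u r = 0" using 0 by auto
    qed
  next
    assume ind: "indep_fam ?S (\<lambda>r. lookup (case_sum ?F ?Y r))"
    show "rows_indep \<alpha> A {b. n b = Suc i}"
      unfolding rows_indep_iff
    proof (intro allI impI ballI)
      fix v c assume v: "\<forall>b\<in>{b. n b = Suc i}. (\<Sum>c\<in>A. v c * hess_entry \<alpha> c b) = 0" and c: "c \<in> A"
      \<comment> \<open>the lower basis elements cancel the coordinates outside the columns\<close>
    let ?u = "case_sum (\<lambda>d. - (\<Sum>c\<in>A. v c * hess_entry \<alpha> c d)) v"
      have "?w ?u d = 0" if "n d \<le> Suc i" for d
      proof (cases "n d = Suc i")
        case True
        then show ?thesis using v by simp
      next
        case False
        then show ?thesis using that by simp
      qed
      then have "(\<Sum>d\<in>?D (Suc i). ?w ?u d * lookup (?F d) m) = 0" for m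
        by (intro sum.neutral ballI) (simp only: mem_Collect_eq mult_zero_left)
      then have "?u (Inr c) = 0"
        by (intro indep_famD[OF ind, of ?u "Inr c", unfolded comb]) (use c in auto)
      then show "v c = 0" by simp
    qed
  qed
qed

lemma dim_var_span_ge:
  assumes A: "A \<subseteq> {c. n c = i}" and rows: "rows_indep \<alpha> A {b. n b = Suc i}"
  shows "card {c. n c \<le> i} + card A \<le> pvs.dim (var_span (cell_ideal n \<alpha>) i)"
proof -
  let ?F = "\<lambda>c. homog (Suc i) (hess_basis \<alpha> c)" and ?Y = "\<lambda>c. homog (Suc i) (pCons 0 (hess_basis \<alpha> c))"
  let ?S = "Inl ` {c. n c \<le> i} \<union> Inr ` A"
  have fin: "finite {c. n c \<le> i}" "finite A"
    using finite_height_le[OF n] finite_subset[OF A finite_height_eq[OF n]] by blast+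
  then have finS: "finite ?S" by simp
  have inj: "inj_on (case_sum ?F ?Y) ?S" and ind: "pvs.independent (case_sum ?F ?Y ` ?S)"
    using rows_indep_iff_indep_fam[OF A] rows unfolding indep_fam_iff_independent[OF finS] by blast+
  have "card (case_sum ?F ?Y ` ?S) = card ?S" using inj by (rule card_image)
  also have "\<dots> = card {c. n c \<le> i} + card A"
    using fin by (subst card_Un_disjoint) (auto simp: card_image)
  finally have card: "card (case_sum ?F ?Y ` ?S) = card {c. n c \<le> i} + card A" .
  have "case_sum ?F ?Y ` ?S \<subseteq> ?F ` {c. n c \<le> i} \<union> ?Y ` {c. n c = i}" using A by auto
  also have "\<dots> \<subseteq> var_span (cell_ideal n \<alpha>) i" unfolding var_span_cell_ideal by (rule pvs.span_superset)
  finally have "case_sum ?F ?Y ` ?S \<subseteq> var_span (cell_ideal n \<alpha>) i" .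
  moreover have "var_span (cell_ideal n \<alpha>) i \<subseteq> forms (Suc i)"
    using var_span_subset[OF cell_ideal_component(1)[OF n adm]] by blast
  ultimately show ?thesis using independent_card_le_dim[OF _ _ ind] card by metis
qed

text \<open>The basis of the lower space extends by products \<open>y g_c\<close> to a basis, and then the rows of these
  \<open>c\<close> are independent.\<close>

lemma dim_var_span_le:
  "pvs.dim (var_span (cell_ideal n \<alpha>) i) \<le> card {c. n c \<le> i} + step_rank TYPE('k) n i"
proof -
  let ?F = "\<lambda>c. homog (Suc i) (hess_basis \<alpha> c)" and ?Y = "\<lambda>c. homog (Suc i) (pCons 0 (hess_basis \<alpha> c))"
  let ?D = "{c. n c \<le> i}" and ?N = "{c. n c = i}"
  note finD = finite_height_le[OF n, of i]
  have deg: "c \<le> i" if "n c \<le> i" for c using height_funD(1)[OF n, of c] that by simp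
  have "indep_fam ?D (\<lambda>c. lookup (?F c))"
  proof (subst indep_fam_homog)
    show "degree (hess_basis \<alpha> c) \<le> Suc i" if "c \<in> ?D" for c using deg[of c] that by simp
    show "indep_fam ?D (\<lambda>c. coeff (hess_basis \<alpha> c))" by (rule indep_fam_distinct_degrees[OF finD]) simp
  qed
  then have injF: "inj_on ?F ?D" and indF: "pvs.independent (?F ` ?D)"
    unfolding indep_fam_iff_independent[OF finD] by blast+
  have injY: "inj_on ?Y ?N"
  proof (rule inj_onI)
    fix c d assume cd: "c \<in> ?N" "d \<in> ?N" "?Y c = ?Y d"
    then have "pCons 0 (hess_basis \<alpha> c) = pCons 0 (hess_basis \<alpha> d)"
      using deg[of c] deg[of d] by (subst (asm) homog_eq_iff) auto
    then have "degree (hess_basis \<alpha> c) = degree (hess_basis \<alpha> d)" by simp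
    then show "c = d" by simp
  qed
  obtain C where C: "?F ` ?D \<subseteq> C" "C \<subseteq> ?F ` ?D \<union> ?Y ` ?N" "pvs.independent C"
      "?F ` ?D \<union> ?Y ` ?N \<subseteq> pvs.span C"
    using pvs.maximal_independent_subset_extend[OF Un_upper1 indF] by metis
  define A where "A = {c \<in> ?N. ?Y c \<in> C - ?F ` ?D}"
  have A: "A \<subseteq> ?N" unfolding A_def by blast
  have finA: "finite A" by (rule finite_subset[OF A finite_height_eq[OF n]])
  have CA: "C = ?F ` ?D \<union> ?Y ` A" using C(1,2) unfolding A_def by blast
  have "?Y ` A \<subseteq> - (?F ` ?D)"
  proof (rule image_subsetI)
    fix c assume "c \<in> A"
    then have "c \<in> ?N \<and> ?Y c \<in> C - ?F ` ?D" unfolding A_def by (rule CollectD)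
    then show "?Y c \<in> - (?F ` ?D)" by (elim conjE DiffE, intro ComplI) (erule (1) notE)
  qed
  then have disj: "?F ` ?D \<inter> ?Y ` A = {}" by blast
  have injYA: "inj_on ?Y A" using injY A by (rule inj_on_subset)
  let ?S = "Inl ` ?D \<union> Inr ` A"
  have finS: "finite ?S" using finD finA by simp
  have "inj_on (case_sum ?F ?Y) ?S"
  proof (rule inj_onI)
    fix r s assume rs: "r \<in> ?S" "s \<in> ?S" "case_sum ?F ?Y r = case_sum ?F ?Y s"
    have 1: "r = s" if "r = Inl c" "s = Inl d" for c d
      using rs that inj_onD[OF injF, of c d] by auto
    have 2: "r = s" if "r = Inr c" "s = Inr d" for c d
      using rs that inj_onD[OF injYA, of c d] by auto
    have 3: "r = s" if "r = Inl c \<and> s = Inr d \<or> r = Inr d \<and> s = Inl c" for c d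
    proof -
      have "c \<in> ?D" "d \<in> A" "?F c = ?Y d" using rs that by auto
      then have "?F c \<in> ?F ` ?D \<inter> ?Y ` A" by (metis IntI imageI)
      then show ?thesis using disj by blast
    qed
    show "r = s" using 1 2 3 by (cases r; cases s) blast+
  qed
  moreover have "case_sum ?F ?Y ` ?S = C" unfolding CA by (simp add: image_Un image_image)
  ultimately have "rows_indep \<alpha> A {b. n b = Suc i}"
    using C(3) unfolding rows_indep_iff_indep_fam[OF A] indep_fam_iff_independent[OF finS] by metis
  then have "card A \<le> gen_rank TYPE('k) ?N {b. n b = Suc i}"
    by (rule gen_rank_ge[OF finite_height_eq[OF n] A])
  moreover have "card C = card ?D + card A"
    unfolding CA using disj finD finA injF injYA by (simp add: card_Un_disjoint card_image)
  moreover have "pvs.dim (var_span (cell_ideal n \<alpha>) i) \<le> card C"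
    unfolding var_span_cell_ideal
  proof (rule pvs.dim_le_card)
    show "pvs.span (?F ` ?D \<union> ?Y ` ?N) \<subseteq> pvs.span C" using C(4) by (intro pvs.span_minimal pvs.subspace_span)
    show "finite C" unfolding CA using finD finA by simp
  qed
  ultimately show ?thesis by linarith
qed

end

text \<open>Different degrees use different free entries, so that optimal choices can be combined.\<close>

lemma ex_generic_coefficients:
  assumes n: "height_fun n"
  shows "\<exists>\<alpha> :: nat \<Rightarrow> nat \<Rightarrow> 'k::field. admissible n \<alpha> \<and> (\<forall>i. pvs.dim (var_span (cell_ideal n \<alpha>) i) =
    card {c. n c \<le> i} + step_rank TYPE('k) n i)"
proof -
  have "\<forall>i. \<exists>p. fst p \<subseteq> {c. n c = i} \<and> rows_indep (snd p :: nat \<Rightarrow> nat \<Rightarrow> 'k) (fst p) {b. n b = Suc i} \<and>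
      card (fst p) = step_rank TYPE('k) n i"
    using gen_rank_attained[OF finite_height_eq[OF n]] by (metis fst_conv snd_conv)
  from choice[OF this] obtain p where p: "\<forall>i. fst (p i) \<subseteq> {c. n c = i} \<and>
      rows_indep (snd (p i) :: nat \<Rightarrow> nat \<Rightarrow> 'k) (fst (p i)) {b. n b = Suc i} \<and>
      card (fst (p i)) = step_rank TYPE('k) n i" ..
  \<comment> \<open>the entry in row \<open>c\<close> and column \<open>b\<close> belongs to degree \<open>n c\<close> alone\<close>
  define \<alpha> where "\<alpha> c b = (if b \<le> c \<and> n b = Suc (n c) then snd (p (n c)) c b else 0)" for c b
  have adm: "admissible n \<alpha>" unfolding admissible_def \<alpha>_def by auto
  have "pvs.dim (var_span (cell_ideal n \<alpha>) i) =
      card {c. n c \<le> i} + step_rank TYPE('k) n i" for i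
  proof (rule antisym)
    have A: "fst (p i) \<subseteq> {c. n c = i}" and r: "rows_indep (snd (p i)) (fst (p i)) {b. n b = Suc i}"
      and c: "card (fst (p i)) = step_rank TYPE('k) n i"
      using p by blast+
    have "rows_indep \<alpha> (fst (p i)) {b. n b = Suc i} \<longleftrightarrow> rows_indep (snd (p i)) (fst (p i)) {b. n b = Suc i}"
    proof (rule rows_indep_cong)
      fix c b assume "c \<in> fst (p i)" "b \<in> {b. n b = Suc i}"
      then have "n c = i" "n b = Suc i" using A by auto
      then show "hess_entry \<alpha> c b = hess_entry (snd (p i)) c b" by (simp add: hess_entry_def \<alpha>_def)
    qed
    then have "rows_indep \<alpha> (fst (p i)) {b. n b = Suc i}" using r by (rule iffD2)
    from dim_var_span_ge[OF n adm A this]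
    show "card {c. n c \<le> i} + step_rank TYPE('k) n i \<le> pvs.dim (var_span (cell_ideal n \<alpha>) i)"
      unfolding c .
  qed (rule dim_var_span_le[OF n adm])
  then show ?thesis using adm by blast
qed

text \<open>The rank is realised by an ideal, and its part of degree \<open>i + 1\<close> leaves no more room.\<close>

lemma gen_rank_le_columns:
  assumes n: "height_fun n"
  shows "step_rank TYPE('k::field) n i \<le> card {b. n b = Suc i}"
proof -
  obtain \<alpha> :: "nat \<Rightarrow> nat \<Rightarrow> 'k" where adm: "admissible n \<alpha>" and dim: "\<forall>i. pvs.dim (var_span (cell_ideal n \<alpha>) i) =
      card {c. n c \<le> i} + step_rank TYPE('k) n i"
    using ex_generic_coefficients[OF n] by blast
  note comp = cell_ideal_component[OF n adm]
  have "pvs.dim (var_span (cell_ideal n \<alpha>) i) \<le> pvs.dim (cell_ideal n \<alpha> \<inter> forms (Suc i))"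
    by (rule dim_mono_forms[OF var_span_subset[OF comp(1)] Int_lower2])
  also have "\<dots> = card {b. n b \<le> Suc i}"
    unfolding comp(2) by (rule indep_fam_card_eq_dim[OF finite_height_le[OF n] indep_fam_hess_basis[OF n]])
  finally show ?thesis using dim[rule_format, of i] card_height_Suc[OF n, of i] by linarith
qed

definition cell_gens :: "'k::field itself \<Rightarrow> (nat \<Rightarrow> nat) \<Rightarrow> nat \<Rightarrow> nat" where
  "cell_gens K n M = card {b. n b = 0} +
     (\<Sum>i<M. card {b. n b = Suc i} - step_rank K n i)"

text \<open>The conditions that hold generically in the cell with heights \<open>n\<close>, imposed on all of \<open>G_T\<close> to
  obtain an open set there.\<close>

definition generic_part :: "'k::field itself \<Rightarrow> (nat \<Rightarrow> nat) \<Rightarrow> (nat \<Rightarrow> nat) \<Rightarrow> nat \<Rightarrow> 'k bipoly set set" where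
  "generic_part K T n M = {I \<in> G_T T. \<forall>i<M. card {c. n c \<le> i} + step_rank K n i
      \<le> pvs.dim (var_span I i)}"

lemma openin_generic_part: "openin (zariski T) (generic_part K T n M)"
  unfolding generic_part_def by (rule openin_dims_var_span)

lemma generic_part_meets_cell:
  assumes P: "is_partition P"
  shows "generic_part TYPE('k::field) (diagonal_lengths K P) (hgt P) M \<inter> jordan_cell P \<noteq> {}"
proof -
  note n = height_fun_hgt[OF P]
  obtain \<alpha> :: "nat \<Rightarrow> nat \<Rightarrow> 'k" where adm: "admissible (hgt P) \<alpha>"
    and dim: "\<forall>i. pvs.dim (var_span (cell_ideal (hgt P) \<alpha>) i) =
      card {c. hgt P c \<le> i} + step_rank TYPE('k) (hgt P) i"
    using ex_generic_coefficients[OF n] by blast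
  have cell: "cell_ideal (hgt P) \<alpha> \<in> jordan_cell P" by (rule cell_ideal_in_jordan_cell[OF P adm])
  then have "cell_ideal (hgt P) \<alpha> \<in> G_T (diagonal_lengths K P)" using jordan_cell_subset_G_T[OF P] by blast
  then have "cell_ideal (hgt P) \<alpha> \<in> generic_part TYPE('k) (diagonal_lengths K P) (hgt P) M"
    unfolding generic_part_def using dim by simp
  then show ?thesis using cell by blast
qed

lemma min_gens_generic_part:
  fixes I :: "'k::field bipoly set"
  assumes P: "is_partition P" and I: "I \<in> generic_part TYPE('k) T (hgt P) M" "I \<in> jordan_cell P"
    and M: "\<And>k. M \<le> k \<Longrightarrow> diagonal_lengths K P k = 0"
  shows "min_gens I = cell_gens TYPE('k) (hgt P) M"
proof -
  note n = height_fun_hgt[OF P]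
  have gr: "graded_ideal I" using I(2) by (simp add: jordan_cell_iff[OF P])
  have dim: "pvs.dim (I \<inter> forms i) = card {b. hgt P b \<le> i}" for i
    using I(2) card_lead_exps[OF gr, of i] by (simp add: jordan_cell_iff[OF P])
  obtain \<alpha> where adm: "admissible (hgt P) \<alpha>" and I\<alpha>: "I = cell_ideal (hgt P) \<alpha>"
    using jordan_cell_is_cell_ideal[OF P I(2)] by blast
  have dimv: "pvs.dim (var_span I i) = card {c. hgt P c \<le> i} + step_rank TYPE('k) (hgt P) i"
    if "i < M" for i
    using dim_var_span_le[OF n adm, of i] I(1) that unfolding generic_part_def I\<alpha>[symmetric]
    by (intro antisym) blast+
  have "min_gens I = (\<Sum>i\<le>M. pvs.dim (I \<inter> forms i) - pvs.dim (decomposables I i))"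
  proof (rule min_gens_eq[OF gr])
    fix i assume "M \<le> i"
    then have "hilbert_fun I i = 0"
      using M hilbert_fun_jordan_cell[OF P I(2)] diagonal_lengths_eq[OF P, of K] by metis
    then show "forms i \<subseteq> I" by (rule forms_subset_if_hilbert_0[OF gr])
  qed
  also have "\<dots> = (pvs.dim (I \<inter> forms 0) - pvs.dim (decomposables I 0)) +
      (\<Sum>i<M. pvs.dim (I \<inter> forms (Suc i)) - pvs.dim (decomposables I (Suc i)))"
    by (simp only: lessThan_Suc_atMost[symmetric] sum.lessThan_Suc_shift)
  also have "pvs.dim (I \<inter> forms 0) - pvs.dim (decomposables I 0) = card {b. hgt P b = 0}"
  proof -
    have "pvs.dim {0 :: 'k bipoly} = 0" using pvs.dim_span[of "{} :: 'k bipoly set"] pvs.dim_eq_card_independent[of "{} :: 'k bipoly set"]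
      by (simp add: pvs.independent_empty)
    then show ?thesis unfolding dim by (simp add: decomposables_def)
  qed
  also have "(\<Sum>i<M. pvs.dim (I \<inter> forms (Suc i)) - pvs.dim (decomposables I (Suc i))) =
      (\<Sum>i<M. card {b. hgt P b = Suc i} - step_rank TYPE('k) (hgt P) i)"
  proof (rule sum.cong[OF refl])
    fix i assume "i \<in> {..<M}"
    then have "pvs.dim (decomposables I (Suc i)) =
        card {c. hgt P c \<le> i} + step_rank TYPE('k) (hgt P) i"
      using dimv[of i] by (simp add: decomposables_def)
    then show "pvs.dim (I \<inter> forms (Suc i)) - pvs.dim (decomposables I (Suc i)) =
        card {b. hgt P b = Suc i} - step_rank TYPE('k) (hgt P) i"
      unfolding dim card_height_Suc[OF n] by simp
  qed
  finally show ?thesis unfolding cell_gens_def .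
qed

text \<open>The rank conditions are open and can be fulfilled in the cell, hence they hold on a dense open
  subset, because the cell is irreducible.\<close>

lemma kappa_P_eq:
  assumes inf: "infinite (UNIV :: 'k::field set)" and P: "is_partition P"
    and M: "\<And>k. M \<le> k \<Longrightarrow> diagonal_lengths TYPE('k) P k = 0"
  shows "kappa_P TYPE('k) P = cell_gens TYPE('k) (hgt P) M"
proof -
  let ?T = "diagonal_lengths TYPE('k) P"
  let ?C = "jordan_cell P :: 'k bipoly set set"
  let ?X = "subtopology (zariski ?T) ?C"
  let ?G = "generic_part TYPE('k) ?T (hgt P) M"
  have C: "?C \<subseteq> G_T ?T" by (rule jordan_cell_subset_G_T[OF P])
  then have top: "topspace ?X = ?C" by (simp add: Int_absorb1)
  show ?thesis
    unfolding kappa_P_def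
  proof (rule generic_gens_eqI)
    show "openin ?X (?C \<inter> ?G)" using openin_generic_part by (rule openin_subtopology_Int2)
    show "?C \<inter> ?G \<noteq> {}" using generic_part_meets_cell[OF P] by blast
    show "?X closure_of (?C \<inter> ?G) = topspace ?X"
      unfolding dense_intersects_open
    proof (intro allI impI)
      fix V assume V: "openin ?X V \<and> V \<noteq> {}"
      then obtain W where W: "openin (zariski ?T) W" "V = W \<inter> ?C" unfolding openin_subtopology by blast
      have "W \<inter> ?G \<inter> ?C \<noteq> {}"
      proof (rule cell_meets_both[OF inf P W(1) _ openin_generic_part generic_part_meets_cell[OF P]])
        show "W \<inter> ?C \<noteq> {}" using V W(2) by blast
      qed
      then show "?C \<inter> ?G \<inter> V \<noteq> {}" unfolding W(2) by blast
    qed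
    show "min_gens I = cell_gens TYPE('k) (hgt P) M" if "I \<in> ?C \<inter> ?G" for I
      using that by (intro min_gens_generic_part[OF P _ _ M]) blast+
  qed
qed

section \<open>The generic number of generators for a Hilbert function\<close>

subsection \<open>The substitution of x + s y for x\<close>

text \<open>If \<open>g\<close> records a form of degree \<open>i\<close> at \<open>x = 1\<close>, this records the form after the substitution:
  \<open>x^(i-b) y^b\<close> becomes \<open>(1 + s y)^(i-b) y^b\<close>.\<close>

definition shear :: "'k::field \<Rightarrow> nat \<Rightarrow> 'k poly \<Rightarrow> 'k poly" where
  "shear s i g = (\<Sum>b\<le>i. smult (coeff g b) (monom 1 b * [:1, s:] ^ (i - b)))"

definition shear_coeff :: "'k::field \<Rightarrow> nat \<Rightarrow> nat \<Rightarrow> nat \<Rightarrow> 'k" where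
  "shear_coeff s i b k = (if k < b then 0 else of_nat ((i - b) choose (k - b)) * s ^ (k - b))"

lemma coeff_shear: "coeff (shear s i g) k = (\<Sum>b\<le>i. coeff g b * shear_coeff s i b k)"
proof -
  have "coeff ([:1, s:] ^ n) m = of_nat (n choose m) * s ^ m" for n m
  proof (cases "m \<le> n")
    case True
    then show ?thesis by (simp add: coeff_linear_poly_power)
  next
    case False
    have "degree ([:1, s:] ^ n) \<le> degree [:1, s:] * n" by (rule degree_power_le)
    also have "\<dots> \<le> 1 * n" by (intro mult_right_mono) simp_all
    finally show ?thesis using False by (simp add: coeff_eq_0 binomial_eq_0)
  qed
  then have "coeff (monom 1 b * [:1, s:] ^ (i - b)) k = shear_coeff s i b k" for b
    by (simp add: coeff_monom_mult shear_coeff_def)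
  then show ?thesis unfolding shear_def coeff_sum coeff_smult by simp
qed

lemma shear_add: "shear s i (f + g) = shear s i f + shear s i g"
  by (rule poly_eqI) (simp add: coeff_shear distrib_right sum.distrib)

lemma shear_smult: "shear s i (smult c g) = smult c (shear s i g)"
  by (rule poly_eqI) (simp add: coeff_shear sum_distrib_left mult.assoc)

lemma shear_0_right [simp]: "shear s i 0 = 0"
  by (rule poly_eqI) (simp add: coeff_shear)

lemma shear_sum: "shear s i (sum f A) = (\<Sum>a\<in>A. shear s i (f a))"
  by (induction A rule: infinite_finite_induct) (simp_all add: shear_add)

lemma degree_shear: "degree (shear s i g) \<le> i"
proof (rule degree_le, intro allI impI)
  fix k assume "i < k"
  then have "shear_coeff s i b k = 0" if "b \<le> i" for b
    using that by (simp add: shear_coeff_def binomial_eq_0 diff_less_mono)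
  then show "coeff (shear s i g) k = 0" unfolding coeff_shear by (intro sum.neutral) simp
qed

lemma shear_Suc:
  assumes "degree g \<le> i"
  shows "shear s (Suc i) g = [:1, s:] * shear s i g"
proof -
  have "shear s (Suc i) g = (\<Sum>b\<le>i. smult (coeff g b) (monom 1 b * [:1, s:] ^ (Suc i - b)))"
    using assms unfolding shear_def by (simp add: coeff_eq_0)
  also have "\<dots> = (\<Sum>b\<le>i. [:1, s:] * smult (coeff g b) (monom 1 b * [:1, s:] ^ (i - b)))"
  proof (rule sum.cong[OF refl])
    fix b assume "b \<in> {..i}"
    then have "[:1, s:] ^ (Suc i - b) = [:1, s:] * [:1, s:] ^ (i - b)" by (simp add: Suc_diff_le)
    then show "smult (coeff g b) (monom 1 b * [:1, s:] ^ (Suc i - b)) =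
        [:1, s:] * smult (coeff g b) (monom 1 b * [:1, s:] ^ (i - b))"
      by (simp only: mult_smult_right mult.left_commute)
  qed
  finally show ?thesis unfolding shear_def sum_distrib_left .
qed

lemma shear_pCons: "shear s (Suc i) (pCons 0 g) = pCons 0 (shear s i g)"
proof (rule poly_eqI)
  fix k
  have "coeff (shear s (Suc i) (pCons 0 g)) k = (\<Sum>b\<le>i. coeff g b * shear_coeff s (Suc i) (Suc b) k)"
    unfolding coeff_shear by (subst sum.atMost_Suc_shift) simp
  also have "\<dots> = coeff (pCons 0 (shear s i g)) k"
  proof (cases k)
    case 0
    then show ?thesis by (simp add: shear_coeff_def)
  next
    case (Suc k')
    have "shear_coeff s (Suc i) (Suc b) (Suc k') = shear_coeff s i b k'" for b
      by (simp add: shear_coeff_def)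
    then show ?thesis by (simp add: Suc coeff_shear)
  qed
  finally show "coeff (shear s (Suc i) (pCons 0 g)) k = coeff (pCons 0 (shear s i g)) k" .
qed

text \<open>The matrix of the substitution is unitriangular.\<close>

lemma shear_eq_0D:
  assumes "shear s i g = 0" "degree g \<le> i"
  shows "g = 0"
proof (rule poly_eqI)
  fix k
  have "coeff g k = 0" if "k \<le> i"
    using that
  proof (induction k rule: less_induct)
    case (less k)
    have "0 = coeff (shear s i g) k" using assms(1) by simp
    also have "\<dots> = (\<Sum>b\<in>{k}. coeff g b * shear_coeff s i b k)"
      unfolding coeff_shear
    proof (rule sum.mono_neutral_right)
      show "\<forall>b\<in>{..i} - {k}. coeff g b * shear_coeff s i b k = 0"
      proof
        fix b assume b: "b \<in> {..i} - {k}"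
        show "coeff g b * shear_coeff s i b k = 0"
          using b less.IH[of b] by (cases "b < k") (simp_all add: shear_coeff_def)
      qed
    qed (use less.prems in auto)
    also have "\<dots> = coeff g k" by (simp add: shear_coeff_def)
    finally show ?case by simp
  qed
  then show "coeff g k = coeff 0 k" using assms(2) by (cases "k \<le> i") (simp_all add: coeff_eq_0)
qed

lemma shear_0:
  assumes "degree g \<le> i"
  shows "shear 0 i g = g"
proof (rule poly_eqI)
  fix k
  have "coeff (shear 0 i g) k = (\<Sum>b\<le>i. if b = k then coeff g b else 0)"
    unfolding coeff_shear by (intro sum.cong refl) (auto simp: shear_coeff_def)
  also have "\<dots> = coeff g k" using assms by (auto simp: coeff_eq_0)
  finally show "coeff (shear 0 i g) k = coeff g k" .
qed

definition dehomog :: "nat \<Rightarrow> 'k::field bipoly \<Rightarrow> 'k poly" where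
  "dehomog i f = (\<Sum>b\<le>i. monom (lookup f (i - b, b)) b)"

lemma coeff_dehomog: "coeff (dehomog i f) b = (if b \<le> i then lookup f (i - b, b) else 0)"
  unfolding dehomog_def coeff_sum coeff_monom by (simp add: sum.delta)

lemma degree_dehomog: "degree (dehomog i f) \<le> i"
  by (rule degree_le) (simp add: coeff_dehomog)

lemma degree_smult_dehomog: "degree (smult c (dehomog i f)) \<le> i"
  by (rule order_trans[OF degree_smult_le degree_dehomog])

lemma homog_dehomog: "f \<in> forms i \<Longrightarrow> homog i (dehomog i f) = f"
  by (rule forms_eqI[OF homog_in_forms]) (simp_all add: lookup_homog mdeg_def coeff_dehomog)

definition shear_ideal :: "'k::field \<Rightarrow> 'k bipoly set \<Rightarrow> 'k bipoly set" where
  "shear_ideal s I = chain_ideal (\<lambda>i. {homog i (shear s i g) | g. degree g \<le> i \<and> homog i g \<in> I})"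

definition shear_frame :: "'k::field \<Rightarrow> (nat \<Rightarrow> nat \<Rightarrow> 'k bipoly) \<Rightarrow> nat \<Rightarrow> nat \<Rightarrow> 'k bipoly" where
  "shear_frame s B i r = homog i (shear s i (dehomog i (B i r)))"

lemma shear_ideal:
  assumes gr: "graded_ideal I"
  shows "graded_ideal (shear_ideal s I)"
    and "shear_ideal s I \<inter> forms i = {homog i (shear s i g) | g. degree g \<le> i \<and> homog i g \<in> I}"
proof -
  define W where "W i = {homog i (shear s i g) | g. degree g \<le> i \<and> homog i g \<in> I}" for i
  have WI: "homog i (shear s i g) \<in> W i" if "degree g \<le> i" "homog i g \<in> I" for i g
    using that unfolding W_def by blast
  have WE: "\<exists>g. f = homog i (shear s i g) \<and> degree g \<le> i \<and> homog i g \<in> I" if "f \<in> W i" for i f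
    using that unfolding W_def by blast
  have subI: "pvs.subspace I" using gr unfolding graded_ideal_def by (intro ideal_subspaceD) blast
  have closed: "homog i (f + g) \<in> I" "homog i (smult c f) \<in> I" if "homog i f \<in> I" "homog i g \<in> I" for i f g c
    unfolding homog_add homog_smult
    using pvs.subspace_add[OF subI that] pvs.subspace_scale[OF subI that(1)] by blast+
  have sub: "pvs.subspace (W i)" for i
    unfolding pvs.subspace_def
  proof (intro conjI ballI allI)
    have "homog i 0 \<in> I" using pvs.subspace_0[OF graded_ideal_component(1)[OF gr, of i]] by simp
    then show "0 \<in> W i" using WI[of 0 i] by simp
    show "f + f' \<in> W i" if f: "f \<in> W i" "f' \<in> W i" for f f'
    proof -
      obtain g where g: "f = homog i (shear s i g)" "degree g \<le> i" "homog i g \<in> I"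
        using WE[OF f(1)] by blast
      obtain g' where g': "f' = homog i (shear s i g')" "degree g' \<le> i" "homog i g' \<in> I"
        using WE[OF f(2)] by blast
      have "f + f' = homog i (shear s i (g + g'))" by (simp add: g(1) g'(1) shear_add homog_add)
      then show ?thesis using WI[of "g + g'" i] closed(1)[OF g(3) g'(3)] degree_add_le[OF g(2) g'(2)] by simp
    qed
    show "cscale c f \<in> W i" if f: "f \<in> W i" for c f
    proof -
      obtain g where g: "f = homog i (shear s i g)" "degree g \<le> i" "homog i g \<in> I"
        using WE[OF f] by blast
      have "cscale c f = homog i (shear s i (smult c g))" by (simp add: g shear_smult homog_smult)
      then show ?thesis
        using WI[of "smult c g" i] closed(2)[OF g(3,3)] order_trans[OF degree_smult_le g(2)] by simp
    qed
  qed
  have deg: "W i \<subseteq> forms i" for i unfolding W_def using homog_in_forms by blast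
  have y: "vary * f \<in> W (Suc i)" if f: "f \<in> W i" for i f
  proof -
    obtain g where g: "f = homog i (shear s i g)" "degree g \<le> i" "homog i g \<in> I"
      using WE[OF f] by blast
    have "homog (Suc i) (pCons 0 g) \<in> I"
      using graded_ideal_component(3)[OF gr, of "homog i g" i] g(3) by (simp add: vary_homog homog_in_forms)
    moreover have "degree (pCons 0 g) \<le> Suc i" using degree_pCons_le[of 0 g] g(2) by simp
    ultimately show ?thesis unfolding g(1) vary_homog shear_pCons[symmetric] by (intro WI)
  qed
  have x: "varx * f \<in> W (Suc i)" if f: "f \<in> W i" for i f
  proof -
    obtain g where g: "f = homog i (shear s i g)" "degree g \<le> i" "homog i g \<in> I"
      using WE[OF f] by blast
    have "homog (Suc i) g \<in> I"
      using graded_ideal_component(2)[OF gr, of "homog i g" i] g(2,3) by (simp add: varx_homog homog_in_forms)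
    then have gx: "homog (Suc i) (shear s (Suc i) g) \<in> W (Suc i)" using g(2) by (intro WI) auto
    \<comment> \<open>the substitution takes \<open>x - s y\<close> to \<open>x\<close>\<close>
    have "shear s (Suc i) g = shear s i g + smult s (pCons 0 (shear s i g))"
      unfolding shear_Suc[OF g(2)] by simp
    then have "varx * f = homog (Suc i) (shear s (Suc i) g) - cscale s (vary * f)"
      unfolding g(1) varx_homog[OF degree_shear] vary_homog homog_smult[symmetric] homog_diff[symmetric] by simp
    then show ?thesis
      using pvs.subspace_diff[OF sub gx pvs.subspace_scale[OF sub y[OF f], of s]] by simp
  qed
  show "graded_ideal (shear_ideal s I)"
    "shear_ideal s I \<inter> forms i = {homog i (shear s i g) | g. degree g \<le> i \<and> homog i g \<in> I}"
    unfolding shear_ideal_def W_def[symmetric, abs_def]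
    using chain_ideal[of W, OF sub deg x y] by simp_all
qed

lemma shear_ideal_0:
  assumes gr: "graded_ideal I"
  shows "shear_ideal 0 I = I"
proof (rule graded_ideal_eqI[OF shear_ideal(1)[OF gr] gr])
  fix i
  have "{homog i (shear 0 i g) | g. degree g \<le> i \<and> homog i g \<in> I} = {homog i g | g. degree g \<le> i \<and> homog i g \<in> I}"
    using shear_0 by (metis (no_types, opaque_lifting))
  also have "\<dots> = I \<inter> forms i"
  proof (intro subset_antisym subsetI)
    fix f assume f: "f \<in> I \<inter> forms i"
    then obtain g where "degree g \<le> i" "f = homog i g" by (auto elim: forms_homogE)
    then show "f \<in> {homog i g | g. degree g \<le> i \<and> homog i g \<in> I}" using f by blast
  qed (use homog_in_forms in blast)
  finally show "shear_ideal 0 I \<inter> forms i = I \<inter> forms i" unfolding shear_ideal(2)[OF gr] .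
qed

lemma frame_shear:
  assumes I: "I \<in> G_T T" and B: "frame T I B"
  shows "shear_ideal s I \<in> G_T T" and "frame T (shear_ideal s I) (shear_frame s B)"
proof -
  have gr: "graded_ideal I" and T: "\<And>i. hilbert_fun I i = T i" using I by (auto simp: G_T_def)
  note grs = shear_ideal(1)[OF gr]
  let ?R = "\<lambda>i. {..<i + 1 - T i}"
  have Bi: "inj_on (B i) (?R i)" "pvs.independent (B i ` ?R i)" "pvs.span (B i ` ?R i) = I \<inter> forms i" for i
    using B unfolding frame_def by blast+
  have BI: "B i r \<in> I \<inter> forms i" if "r \<in> ?R i" for i r
    unfolding Bi(3)[symmetric] using that by (intro pvs.span_base imageI)
  have ind: "indep_fam (?R i) (\<lambda>r. coeff (dehomog i (B i r)))" for i
  proof -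
    have "indep_fam (?R i) (\<lambda>r. lookup (B i r))"
      using Bi by (subst indep_fam_iff_independent) auto
    moreover have "indep_fam (?R i) (\<lambda>r. lookup (B i r)) \<longleftrightarrow>
        indep_fam (?R i) (\<lambda>r. lookup (homog i (dehomog i (B i r))))"
    proof -
      have "lookup (B i r) m = lookup (homog i (dehomog i (B i r))) m" if "r \<in> ?R i" for r m
        using BI[OF that] homog_dehomog by (metis IntD2)
      then have "(\<Sum>r\<in>?R i. u r * lookup (B i r) m) =
          (\<Sum>r\<in>?R i. u r * lookup (homog i (dehomog i (B i r))) m)" for u m
        by (intro sum.cong refl) simp
      then show ?thesis unfolding indep_fam_def by simp
    qed
    ultimately show ?thesis using indep_fam_homog[of "?R i" "\<lambda>r. dehomog i (B i r)" i] degree_dehomog by metis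
  qed
  have "indep_fam (?R i) (\<lambda>r. coeff (shear s i (dehomog i (B i r))))" for i
    unfolding indep_fam_def
  proof (intro allI impI ballI)
    fix u r assume u: "\<forall>m. (\<Sum>r\<in>?R i. u r * coeff (shear s i (dehomog i (B i r))) m) = 0" and r: "r \<in> ?R i"
    let ?g = "\<Sum>r\<in>?R i. smult (u r) (dehomog i (B i r))"
    have "shear s i ?g = 0"
      by (rule poly_eqI) (use u in \<open>simp add: shear_sum shear_smult coeff_sum\<close>)
    moreover have "degree ?g \<le> i"
      by (intro degree_sum_le) (simp_all only: degree_smult_dehomog finite_lessThan)
    ultimately have "?g = 0" by (rule shear_eq_0D)
    then have "coeff ?g m = 0" for m by simp
    then have "(\<Sum>r\<in>?R i. u r * coeff (dehomog i (B i r)) m) = 0" for m by (simp add: coeff_sum)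
    then show "u r = 0" by (rule indep_famD[OF ind]) (rule r)
  qed
  then have "indep_fam (?R i) (\<lambda>r. lookup (shear_frame s B i r))" for i
    unfolding shear_frame_def by (subst indep_fam_homog) (simp_all add: degree_shear)
  then have fam: "inj_on (shear_frame s B i) (?R i)" "pvs.independent (shear_frame s B i ` ?R i)" for i
    by (simp_all add: indep_fam_iff_independent)
  have span: "pvs.span (shear_frame s B i ` ?R i) = shear_ideal s I \<inter> forms i" for i
  proof
    have "shear_frame s B i r \<in> shear_ideal s I \<inter> forms i" if "r \<in> ?R i" for r
    proof -
      have "homog i (dehomog i (B i r)) \<in> I" using BI[OF that] by (simp add: homog_dehomog)
      then show ?thesis unfolding shear_ideal(2)[OF gr] shear_frame_def using degree_dehomog by blast
    qed
    then show "pvs.span (shear_frame s B i ` ?R i) \<subseteq> shear_ideal s I \<inter> forms i"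
      by (intro pvs.span_minimal graded_ideal_component(1)[OF grs] image_subsetI)
    show "shear_ideal s I \<inter> forms i \<subseteq> pvs.span (shear_frame s B i ` ?R i)"
    proof
      fix f assume "f \<in> shear_ideal s I \<inter> forms i"
      then obtain g where g: "f = homog i (shear s i g)" "degree g \<le> i" "homog i g \<in> I"
        unfolding shear_ideal(2)[OF gr] by blast
      then have "homog i g \<in> pvs.span (B i ` ?R i)" unfolding Bi(3) using homog_in_forms by blast
      then obtain u where "homog i g = (\<Sum>r\<in>?R i. cscale (u r) (B i r))"
        by (rule in_span_imageE[OF finite_lessThan])
      also have "\<dots> = (\<Sum>r\<in>?R i. cscale (u r) (homog i (dehomog i (B i r))))"
        using BI by (intro sum.cong refl) (simp add: homog_dehomog)
      also have "\<dots> = homog i (\<Sum>r\<in>?R i. smult (u r) (dehomog i (B i r)))"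
        by (simp only: homog_sum homog_smult)
      finally have "g = (\<Sum>r\<in>?R i. smult (u r) (dehomog i (B i r)))"
      proof (rule homog_eq_iff[THEN iffD1, rotated 2])
        show "degree (\<Sum>r\<in>?R i. smult (u r) (dehomog i (B i r))) \<le> i"
          by (intro degree_sum_le) (simp_all only: degree_smult_dehomog finite_lessThan)
      qed (rule g(2))
      then have "f = (\<Sum>r\<in>?R i. cscale (u r) (shear_frame s B i r))"
        unfolding g(1) shear_frame_def by (simp only: shear_sum shear_smult homog_sum homog_smult)
      also have "\<dots> \<in> pvs.span (shear_frame s B i ` ?R i)"
        by (intro pvs.span_sum pvs.span_scale pvs.span_base imageI)
      finally show "f \<in> pvs.span (shear_frame s B i ` ?R i)" .
    qed
  qed
  show "frame T (shear_ideal s I) (shear_frame s B)"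
    unfolding frame_def using fam span by blast
  have "hilbert_fun (shear_ideal s I) i = T i" for i
  proof -
    have "pvs.dim (shear_ideal s I \<inter> forms i) = i + 1 - T i"
      unfolding span[symmetric] pvs.dim_span using fam[of i]
      by (simp add: pvs.dim_eq_card_independent card_image)
    moreover have "T i \<le> i + 1" using T[of i] by (simp add: hilbert_fun_def)
    ultimately show ?thesis by (simp add: hilbert_fun_def)
  qed
  then show "shear_ideal s I \<in> G_T T" unfolding G_T_def using grs by (simp add: fun_eq_iff)
qed

lemma polyfun_shear_frame: "polyfun (\<lambda>s. lookup (shear_frame s B i r) m)"
proof -
  have "polyfun (\<lambda>s. shear_coeff s i b k)" for b k
    unfolding shear_coeff_def
    by (cases "k < b") (simp_all add: polyfun_const polyfun_mult polyfun_power polyfun_id)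
  then have "polyfun (\<lambda>s. coeff (shear s i g) k)" for g k
    unfolding coeff_shear by (intro polyfun_sum polyfun_mult polyfun_const)
  then show ?thesis
    unfolding shear_frame_def lookup_homog by (cases "mdeg m = i") (simp_all add: polyfun_const)
qed

subsection \<open>The big cell\<close>

text \<open>For \<open>s = 0\<close>, no nonzero form of degree \<open>i\<close> in the ideal lies in the span of the \<open>T i\<close> monomials of
  least degree in \<open>y\<close>; if the ideal has Hilbert function \<open>T\<close>, its initial monomials are then all
  the others.  In general, this is asked after the substitution.\<close>

definition transversal :: "'k::field \<Rightarrow> (nat \<Rightarrow> nat) \<Rightarrow> nat \<Rightarrow> 'k bipoly set \<Rightarrow> bool" where
  "transversal s T i I \<longleftrightarrow> (\<forall>g. degree g \<le> i \<longrightarrow> homog i g \<in> I \<longrightarrow>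
     (\<forall>b. T i \<le> b \<longrightarrow> coeff (shear s i g) b = 0) \<longrightarrow> g = 0)"

text \<open>Transversality means that the sheared frame stays independent after forgetting the coefficients
  of \<open>y^b\<close> with \<open>b < T i\<close>.\<close>

lemma openin_transversal: "openin (zariski T) {I \<in> G_T T. transversal (s :: 'k::field) T i I}"
proof (rule openin_zariskiI)
  let ?U = "{I \<in> G_T T. transversal s T i I}"
  show "?U \<subseteq> G_T T" by blast
  let ?R = "{..<i + 1 - T i}"
  define v :: "nat \<Rightarrow> (nat \<Rightarrow> nat \<Rightarrow> 'k bipoly) \<Rightarrow> nat \<Rightarrow> 'k" where "v r B b = (if T i \<le> b then
      (\<Sum>c\<le>i. lookup (B i r) (i - c, c) * shear_coeff s i c b) else 0)" for r B b
  have v: "v r B b = (if T i \<le> b then coeff (shear s i (dehomog i (B i r))) b else 0)" for r B b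
    unfolding v_def coeff_shear by (simp add: coeff_dehomog)
  have vpoly: "(\<lambda>B. v r B b) \<in> frame_polys T" if "r \<in> ?R" for r b
  proof (cases "T i \<le> b")
    case True
    have "(\<lambda>B. \<Sum>c\<le>i. lookup (B i r) (i - c, c) * shear_coeff s i c b) \<in> frame_polys T"
      using that by (intro frame_polys_sum frame_polys.mult frame_polys.coord frame_polys.const) (auto simp: mdeg_def)
    then show ?thesis unfolding v_def using True by simp
  next
    case False
    then show ?thesis unfolding v_def by (simp add: frame_polys.const)
  qed
  have iff: "transversal s T i I \<longleftrightarrow> indep_fam ?R (\<lambda>r. v r B)" if B: "frame T I B" for I B
  proof -
    have Bi: "inj_on (B i) ?R" "pvs.independent (B i ` ?R)" "pvs.span (B i ` ?R) = I \<inter> forms i"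
      using B unfolding frame_def by blast+
    have BI: "B i r \<in> I \<inter> forms i" if "r \<in> ?R" for r
      unfolding Bi(3)[symmetric] using that by (intro pvs.span_base imageI)
    have ind: "indep_fam ?R (\<lambda>r. lookup (B i r))"
      using Bi by (subst indep_fam_iff_independent) auto
    let ?g = "\<lambda>u. \<Sum>r\<in>?R. smult (u r) (dehomog i (B i r))"
    have deg: "degree (?g u) \<le> i" for u
      by (intro degree_sum_le) (simp_all only: degree_smult_dehomog finite_lessThan)
    have hom: "homog i (?g u) = (\<Sum>r\<in>?R. cscale (u r) (B i r))" for u
      unfolding homog_sum homog_smult using BI by (intro sum.cong refl) (simp add: homog_dehomog)
    have top: "(\<Sum>r\<in>?R. u r * v r B b) = (if T i \<le> b then coeff (shear s i (?g u)) b else 0)" for u b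
      by (simp add: v shear_sum shear_smult coeff_sum)
    show ?thesis
    proof
      assume t: "transversal s T i I"
      show "indep_fam ?R (\<lambda>r. v r B)"
        unfolding indep_fam_def
      proof (intro allI impI ballI)
        fix u r assume u: "\<forall>b. (\<Sum>r\<in>?R. u r * v r B b) = 0" and r: "r \<in> ?R"
        have "\<forall>b. T i \<le> b \<longrightarrow> coeff (shear s i (?g u)) b = 0"
          using u unfolding top by (metis (full_types))
        moreover have "homog i (?g u) \<in> I \<inter> forms i"
          unfolding hom Bi(3)[symmetric] by (intro pvs.span_sum pvs.span_scale pvs.span_base imageI)
        then have "homog i (?g u) \<in> I" by blast
        ultimately have "?g u = 0" using t deg[of u] unfolding transversal_def by blast
        then have "(\<Sum>r\<in>?R. cscale (u r) (B i r)) = 0" unfolding hom[symmetric] by simp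
        then have "(\<Sum>r\<in>?R. u r * lookup (B i r) m) = 0" for m
          using lookup_sum[of "\<lambda>r. cscale (u r) (B i r)" ?R m] by simp
        then show "u r = 0" by (rule indep_famD[OF ind]) (rule r)
      qed
    next
      assume indv: "indep_fam ?R (\<lambda>r. v r B)"
      show "transversal s T i I"
        unfolding transversal_def
      proof (intro allI impI)
        fix g assume g: "degree g \<le> i" "homog i g \<in> I" and 0: "\<forall>b. T i \<le> b \<longrightarrow> coeff (shear s i g) b = 0"
        have "homog i g \<in> pvs.span (B i ` ?R)" unfolding Bi(3) using g(2) homog_in_forms by blast
        then obtain u where "homog i g = (\<Sum>r\<in>?R. cscale (u r) (B i r))"
          by (rule in_span_imageE[OF finite_lessThan])
        then have gu: "g = ?g u" unfolding hom[symmetric] using homog_eq_iff[OF g(1) deg] by blast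
        have "(\<Sum>r\<in>?R. u r * v r B b) = 0" for b
          unfolding top gu[symmetric] using 0 by simp
        then have "u r = 0" if "r \<in> ?R" for r using that by (intro indep_famD[OF indv, of u]) 
        then show "g = 0" unfolding gu by (intro sum.neutral ballI) simp
      qed
    qed
  qed
  fix I :: "'k bipoly set" and B assume "I \<in> ?U" and B: "frame T I B"
  then have "indep_fam ?R (\<lambda>r. v r B)" using iff[OF B] by blast
  then obtain p where "p \<in> frame_polys T" "p B \<noteq> 0" "\<forall>B'. p B' \<noteq> 0 \<longrightarrow> indep_fam ?R (\<lambda>r. v r B')"
    using indep_fam_open[OF finite_lessThan, of "i + 1 - T i" v T B] vpoly by blast
  then show "\<exists>p \<in> frame_polys T. p B \<noteq> 0 \<and>
       (\<forall>J\<in>G_T T. \<forall>B'. frame T J B' \<longrightarrow> p B' \<noteq> 0 \<longrightarrow> J \<in> ?U)"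
    using iff by blast
qed

lemma openin_transversal_all: "openin (zariski T) {I \<in> G_T T. \<forall>i<M. transversal (s :: 'k::field) T i I}"
proof (induction M)
  case 0
  show ?case using openin_topspace[of "zariski T :: 'k bipoly set topology"] by simp
next
  case (Suc M)
  have "{I \<in> G_T T. \<forall>i<Suc M. transversal s T i I} =
     {I \<in> G_T T. \<forall>i<M. transversal s T i I} \<inter> {I \<in> G_T T. transversal s T M I}"
    by (auto simp: less_Suc_eq)
  then show ?case using openin_Int[OF Suc openin_transversal[of T s M]] by simp
qed

lemma transversal_trivial: "T i = 0 \<Longrightarrow> transversal s T i I"
  unfolding transversal_def using shear_eq_0D poly_eqI[of "shear s i _" 0] by auto

lemma transversal_shear_ideal:
  assumes gr: "graded_ideal I" and t: "transversal s T i I"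
  shows "transversal 0 T i (shear_ideal s I)"
  unfolding transversal_def
proof (intro allI impI)
  fix h assume h: "degree h \<le> i" "homog i h \<in> shear_ideal s I" and 0: "\<forall>b. T i \<le> b \<longrightarrow> coeff (shear 0 i h) b = 0"
  have "homog i h \<in> shear_ideal s I \<inter> forms i" using h(2) homog_in_forms by blast
  then obtain g where g: "homog i h = homog i (shear s i g)" "degree g \<le> i" "homog i g \<in> I"
    unfolding shear_ideal(2)[OF gr] by blast
  have hg: "h = shear s i g" using g(1) homog_eq_iff[OF h(1) degree_shear] by blast
  then have "\<forall>b. T i \<le> b \<longrightarrow> coeff (shear s i g) b = 0" using 0 unfolding shear_0[OF h(1)] by simp
  then have "g = 0" using t g(2,3) unfolding transversal_def by blast
  then show "h = 0" by (simp add: hg)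
qed

text \<open>There are \<open>i + 1 - T i\<close> leading exponents, which leaves no choice if all are at least \<open>T i\<close>.\<close>

lemma lead_exps_transversal:
  assumes I: "I \<in> G_T T"
  shows "transversal 0 T i I \<longleftrightarrow> lead_exps I i = {T i..i}"
proof
  assume t: "transversal 0 T i I"
  have "T i \<le> degree g" if "g \<noteq> 0" "degree g \<le> i" "homog i g \<in> I" for g
  proof (rule ccontr)
    assume "\<not> T i \<le> degree g"
    then have "\<forall>b. T i \<le> b \<longrightarrow> coeff (shear 0 i g) b = 0"
      unfolding shear_0[OF that(2)] by (auto intro!: coeff_eq_0)
    then show False using t that unfolding transversal_def by blast
  qed
  then have sub: "lead_exps I i \<subseteq> {T i..i}" unfolding lead_exps_def by auto
  have "i + 1 - card (lead_exps I i) = T i"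
    using I hilbert_fun_lead_exps[of I i] by (auto simp: G_T_def)
  moreover have "card (lead_exps I i) \<le> i + 1 - T i" using card_mono[OF _ sub] by simp
  moreover have "card (lead_exps I i) \<le> i + 1" using card_mono[of "{..i}" "lead_exps I i"] lead_exps_le by auto
  ultimately show "lead_exps I i = {T i..i}" by (intro card_subset_eq sub) auto
next
  assume l: "lead_exps I i = {T i..i}"
  show "transversal 0 T i I"
    unfolding transversal_def
  proof (intro allI impI, rule ccontr)
    fix g assume g: "degree g \<le> i" "homog i g \<in> I" "\<forall>b. T i \<le> b \<longrightarrow> coeff (shear 0 i g) b = 0" "g \<noteq> 0"
    then have "degree g \<in> lead_exps I i" unfolding lead_exps_def by blast
    then have "coeff g (degree g) = 0" using g(3) l unfolding shear_0[OF g(1)] by simp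
    then show False using g(4) by simp
  qed
qed

text \<open>The operator \<open>y d/dy\<close> in the new coordinates only combines neighbouring coefficients.\<close>

lemma shear_coeff_euler:
  assumes "b \<le> i"
  shows "(of_nat b :: 'k::field) * shear_coeff 1 i b k = of_nat k * shear_coeff 1 i b k -
    (if k = 0 then 0 else (of_nat (Suc i) - of_nat k) * shear_coeff 1 i b (k - 1))"
proof (cases "b < k")
  case True
  then obtain m where k: "k = Suc (b + m)" by (auto dest: less_imp_Suc_add)
  let ?n = "i - b"
  have *: "Suc m * (?n choose Suc m) = (?n - m) * (?n choose m)"
    by (simp only: binomial_absorption binomial_absorb_comp)
  have "(of_nat (Suc i) - of_nat k :: 'k) * of_nat (?n choose m) = of_nat ((?n - m) * (?n choose m))"
  proof (cases "m \<le> ?n")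
    case True
    have "of_nat (Suc i) - of_nat k = (of_nat (?n - m) :: 'k)"
    proof -
      have "Suc i = (?n - m) + k" using True assms k by simp
      then show ?thesis by (metis add_diff_cancel_right' of_nat_add)
    qed
    then show ?thesis by simp
  next
    case False
    then show ?thesis by (simp add: binomial_eq_0)
  qed
  also have "\<dots> = of_nat (Suc m) * of_nat (?n choose Suc m)" unfolding *[symmetric] of_nat_mult ..
  also have "of_nat (Suc m) = (of_nat k - of_nat b :: 'k)" by (simp add: k)
  finally have "(of_nat (Suc i) - of_nat k :: 'k) * of_nat (?n choose m) = (of_nat k - of_nat b) * of_nat (?n choose Suc m)" .
  then show ?thesis by (simp add: shear_coeff_def k algebra_simps)
next
  case False
  then show ?thesis by (cases "k = b") (auto simp: shear_coeff_def)
qed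

text \<open>A form with \<open>r\<close> terms that is divisible by \<open>(x - y)^r\<close> vanishes; after the substitution,
  divisibility says that the coefficients of highest degree in \<open>y\<close> vanish.  The operator
  \<open>y d/dy - b\<close> removes the term of exponent \<open>b\<close>, keeps the others because exponents up to \<open>i\<close>
  are distinct in the field, and costs one factor \<open>x - y\<close>.\<close>

lemma fewnomial_zero:
  fixes g :: "'k::field poly"
  assumes char: "CHAR('k) = 0 \<or> i < CHAR('k)"
    and "finite S" "S \<subseteq> {..i}" "\<And>b. coeff g b \<noteq> 0 \<Longrightarrow> b \<in> S"
    and "\<And>k. i < k + card S \<Longrightarrow> coeff (shear 1 i g) k = 0"
  shows "g = 0"
  using assms(2-)
proof (induction S arbitrary: g rule: finite_induct)
  case empty
  then show ?case by (intro poly_eqI) auto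
next
  case (insert b0 S)
  let ?h = "pCons 0 (pderiv g) - smult (of_nat b0) g"
  have c: "coeff ?h b = (of_nat b - of_nat b0) * coeff g b" for b
    by (cases b) (simp_all add: coeff_pderiv left_diff_distrib)
  have "?h = 0"
  proof (rule insert.IH)
    show "S \<subseteq> {..i}" using insert.prems(1) by blast
    show "b \<in> S" if "coeff ?h b \<noteq> 0" for b
      using that insert.prems(2)[of b] unfolding c by auto
    fix k assume k: "i < k + card S"
    let ?G = "\<lambda>k. coeff (shear 1 i g) k"
    have "coeff (shear 1 i ?h) k = (\<Sum>b\<le>i. of_nat k * (coeff g b * shear_coeff 1 i b k) -
        (if k = 0 then 0 else (of_nat (Suc i) - of_nat k) * (coeff g b * shear_coeff 1 i b (k - 1))) -
        of_nat b0 * (coeff g b * shear_coeff 1 i b k))"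
      unfolding coeff_shear
    proof (rule sum.cong[OF refl])
      fix b assume "b \<in> {..i}"
      then have "(of_nat b :: 'k) * shear_coeff 1 i b k = of_nat k * shear_coeff 1 i b k -
          (if k = 0 then 0 else (of_nat (Suc i) - of_nat k) * shear_coeff 1 i b (k - 1))"
        by (intro shear_coeff_euler) simp
      then have "coeff g b * (of_nat b * shear_coeff 1 i b k) = coeff g b * (of_nat k * shear_coeff 1 i b k -
          (if k = 0 then 0 else (of_nat (Suc i) - of_nat k) * shear_coeff 1 i b (k - 1)))"
        by (rule arg_cong)
      then show "coeff ?h b * shear_coeff 1 i b k = of_nat k * (coeff g b * shear_coeff 1 i b k) -
        (if k = 0 then 0 else (of_nat (Suc i) - of_nat k) * (coeff g b * shear_coeff 1 i b (k - 1))) -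
        of_nat b0 * (coeff g b * shear_coeff 1 i b k)"
        unfolding c by (cases "k = 0") (simp_all add: algebra_simps)
    qed
    also have "\<dots> = of_nat k * ?G k - (if k = 0 then 0 else (of_nat (Suc i) - of_nat k) * ?G (k - 1)) - of_nat b0 * ?G k"
      unfolding coeff_shear by (cases "k = 0") (simp_all only: sum_subtractf sum_distrib_left simp_thms if_True if_False sum.neutral_const)
    also have "?G k = 0" using k insert.hyps by (intro insert.prems(3)) simp
    also have "(if k = 0 then 0 else (of_nat (Suc i) - of_nat k) * ?G (k - 1)) = 0"
    proof (cases "k = 0")
      case False
      then have "?G (k - 1) = 0" using k insert.hyps by (intro insert.prems(3)) simp
      then show ?thesis by simp
    qed simp
    finally show "coeff (shear 1 i ?h) k = 0" by simp
  qed
  have zero: "coeff g b = 0" if "b \<noteq> b0" for b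
  proof (rule ccontr)
    assume b: "coeff g b \<noteq> 0"
    then have le: "b \<le> i" "b0 \<le> i" using insert.prems(1,2) by auto
    have "coeff ?h b = 0" using \<open>?h = 0\<close> by simp
    then have eq: "of_nat b = (of_nat b0 :: 'k)" using b unfolding c by simp
    have "\<not> CHAR('k) dvd (max b b0 - min b b0)"
    proof
      assume d: "CHAR('k) dvd (max b b0 - min b b0)"
      have "0 < max b b0 - min b b0" "max b b0 - min b b0 \<le> i" using le that by auto
      then show False using char dvd_imp_le[OF d] d by auto
    qed
    then show False
      using eq that of_nat_eq_iff_char_dvd[where ?'a = 'k, of "min b b0" "max b b0"]
      by (auto simp: max_def min_def split: if_splits)
  qed
  have b0: "b0 \<le> i" using insert.prems(1) by blast
  have "coeff (shear 1 i g) i = (\<Sum>b\<in>{b0}. coeff g b * shear_coeff 1 i b i)"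
    unfolding coeff_shear by (rule sum.mono_neutral_right) (use b0 zero in auto)
  also have "\<dots> = coeff g b0" using b0 by (simp add: shear_coeff_def)
  finally have "coeff g b0 = 0" using insert.prems(3)[of i] insert.hyps by simp
  then show ?case using zero by (intro poly_eqI) (metis coeff_0)
qed

text \<open>A form of degree \<open>i\<close> in a monomial ideal has at most as many terms as the ideal has monomials
  of that degree.\<close>

lemma transversal_E_ideal:
  assumes P: "is_partition P" and char: "CHAR('k::field) = 0 \<or> i < CHAR('k)"
  shows "transversal (1 :: 'k) (diagonal_lengths K P) i (E_ideal P)"
  unfolding transversal_def
proof (intro allI impI)
  fix g :: "'k poly"
  assume g: "degree g \<le> i" "homog i g \<in> E_ideal P" and 0: "\<forall>b. diagonal_lengths K P i \<le> b \<longrightarrow> coeff (shear 1 i g) b = 0"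
  let ?S = "{b. hgt P b \<le> i}"
  note n = height_fun_hgt[OF P]
  show "g = 0"
  proof (rule fewnomial_zero[OF char finite_height_le[OF n]])
    show "?S \<subseteq> {..i}" using order_trans[OF height_funD(1)[OF n]] by blast
    show "b \<in> ?S" if "coeff g b \<noteq> 0" for b
      using g(2) that le_degree[OF that] g(1) unfolding E_ideal_in_jordan_cell(2)[OF P] by simp
    show "coeff (shear 1 i g) k = 0" if "i < k + card ?S" for k
      using 0 that unfolding diagonal_lengths_eq[OF P] by simp
  qed
qed

text \<open>The big cell is dense.  Near any ideal there is one in the same cell that the substitution of
  \<open>x + y\<close> for \<open>x\<close> makes transversal, since this open condition holds for the monomial ideal of the
  cell; and the substitutions of \<open>x + s y\<close> form a curve from the former ideal into the big cell.
  Hence the generic ideals of the big cell are generic in \<open>G_T\<close>.\<close>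

lemma kappa_T_eq:
  fixes T :: "nat \<Rightarrow> nat"
  assumes inf: "infinite (UNIV :: 'k::field set)" and char: "CHAR('k) = 0 \<or> J < CHAR('k)"
    and T0: "\<And>k. J < k \<Longrightarrow> T k = 0"
    and P: "is_partition P" "diagonal_lengths TYPE('k) P = T"
  shows "\<exists>P0. is_partition P0 \<and> (\<forall>i. {b. hgt P0 b \<le> i} = {T i..i}) \<and>
    kappa_T TYPE('k) T = cell_gens TYPE('k) (hgt P0) (Suc J)"
proof -
  let ?Z = "zariski T :: 'k bipoly set topology"
  let ?Big = "\<lambda>s :: 'k. {I \<in> G_T T. \<forall>i<Suc J. transversal s T i I}"
  have big_all: "transversal s T i I" if "I \<in> ?Big s" for s i I
    using that T0[of i] transversal_trivial[of T i s I] by (cases "i < Suc J") auto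
  have diag: "diagonal_lengths TYPE('k) Q = T" if "is_partition Q" "I \<in> jordan_cell Q" "I \<in> G_T T"
    for Q and I :: "'k bipoly set"
  proof -
    have "I \<in> G_T (diagonal_lengths TYPE('k) Q)" using jordan_cell_subset_G_T[OF that(1)] that(2) by (rule subsetD)
    then show ?thesis using that(3) by (simp add: G_T_def)
  qed
  have E: "E_ideal Q \<in> ?Big 1 \<inter> jordan_cell Q" if Q: "is_partition Q" "diagonal_lengths TYPE('k) Q = T" for Q
  proof -
    have "transversal 1 T i (E_ideal Q :: 'k bipoly set)" if "i < Suc J" for i
    proof -
      have "CHAR('k) = 0 \<or> i < CHAR('k)" using char that by linarith
      from transversal_E_ideal[OF Q(1) this, of "TYPE('k)"] show ?thesis unfolding Q(2) .
    qed
    moreover have "(E_ideal Q :: 'k bipoly set) \<in> jordan_cell Q" by (rule E_ideal_in_jordan_cell(1)[OF Q(1)])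
    ultimately show ?thesis using jordan_cell_subset_G_T[OF Q(1), of "TYPE('k)"] unfolding Q(2) by blast
  qed
  have frame: "\<exists>B. frame T I B" if q: "is_partition Q" "I \<in> jordan_cell Q" "I \<in> G_T T" for Q and I :: "'k bipoly set"
  proof -
    obtain \<alpha> where \<alpha>: "admissible (hgt Q) \<alpha>" "I = cell_ideal (hgt Q) \<alpha>"
      using jordan_cell_is_cell_ideal[OF q(1,2)] by blast
    show ?thesis
      using frame_cell_frame[OF q(1) \<alpha>(1), of "TYPE('k)"] unfolding \<alpha>(2)[symmetric] diag[OF q] by blast
  qed
  have move: "shear_ideal 1 I \<in> ?Big 0" if I: "I \<in> ?Big 1" "I \<in> jordan_cell Q" and Q: "is_partition Q" for I Q
  proof -
    have IG: "I \<in> G_T T" using I(1) by blast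
    then have gr: "graded_ideal I" by (simp add: G_T_def)
    obtain B where "frame T I B" using frame[OF Q I(2) IG] by blast
    then have "shear_ideal 1 I \<in> G_T T" using frame_shear(1)[OF IG] by blast
    then show ?thesis using transversal_shear_ideal[OF gr] I(1) by blast
  qed
  have lead: "lead_exps I i = {T i..i}" if "I \<in> ?Big 0" for I i
    using big_all[OF that, of i] that lead_exps_transversal[of I T i] by blast
  have "shear_ideal 1 (E_ideal P) \<in> ?Big 0" using move E[OF P] P(1) by blast
  then obtain I0 where I0: "I0 \<in> ?Big 0" by blast
  then have "I0 \<in> G_T T" by blast
  then obtain P0 where P0: "is_partition P0" "I0 \<in> jordan_cell P0" using G_T_in_some_cell T0 by blast
  have diag0: "diagonal_lengths TYPE('k) P0 = T" by (rule diag[OF P0 \<open>I0 \<in> G_T T\<close>])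
  have hgt0: "{b. hgt P0 b \<le> i} = {T i..i}" for i
    using P0(2) lead[OF I0, of i] unfolding jordan_cell_iff[OF P0(1)] by blast
  have big_cell: "?Big 0 = jordan_cell P0"
  proof (intro subset_antisym subsetI)
    fix I assume I: "I \<in> ?Big 0"
    then have "graded_ideal I" by (simp add: G_T_def)
    then show "I \<in> jordan_cell P0" unfolding jordan_cell_iff[OF P0(1)] hgt0 using lead[OF I] by blast
  next
    fix I :: "'k bipoly set" assume I: "I \<in> jordan_cell P0"
    then have IG: "I \<in> G_T T" using jordan_cell_subset_G_T[OF P0(1), of "TYPE('k)"] unfolding diag0 by blast
    have "lead_exps I i = {T i..i}" for i using I unfolding jordan_cell_iff[OF P0(1)] hgt0 by blast
    then show "I \<in> ?Big 0" using IG lead_exps_transversal[OF IG] by blast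
  qed
  let ?G = "generic_part TYPE('k) T (hgt P0) (Suc J)"
  have G: "openin ?Z ?G" by (rule openin_generic_part)
  have Gmeet: "?G \<inter> jordan_cell P0 \<noteq> {}" using generic_part_meets_cell[OF P0(1), where K = "TYPE('k)" and ?'k = 'k] unfolding diag0 .
  have "kappa_T TYPE('k) T = cell_gens TYPE('k) (hgt P0) (Suc J)"
    unfolding kappa_T_def
  proof (rule generic_gens_eqI)
    show "openin ?Z (?Big 0 \<inter> ?G)" by (rule openin_Int[OF openin_transversal_all G])
    show "?Big 0 \<inter> ?G \<noteq> {}" using Gmeet unfolding big_cell by blast
    show "min_gens I = cell_gens TYPE('k) (hgt P0) (Suc J)" if I: "I \<in> ?Big 0 \<inter> ?G" for I
    proof (rule min_gens_generic_part[OF P0(1), where K = "TYPE('k)"])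
      show "I \<in> ?G" using I by blast
      show "I \<in> jordan_cell P0" using I unfolding big_cell by blast
      show "diagonal_lengths TYPE('k) P0 k = 0" if "Suc J \<le> k" for k using T0 that unfolding diag0 by simp
    qed
    show "?Z closure_of (?Big 0 \<inter> ?G) = topspace ?Z"
      unfolding dense_intersects_open
    proof (intro allI impI)
      fix V assume V: "openin ?Z V \<and> V \<noteq> {}"
      then obtain I where I: "I \<in> V" by blast
      then have IG: "I \<in> G_T T" using V openin_subset[of ?Z V] by auto
      obtain Q where Q: "is_partition Q" "I \<in> jordan_cell Q" using G_T_in_some_cell[OF IG] T0 by blast
      note diagQ = diag[OF Q IG]
      \<comment> \<open>move within the cell of \<open>I\<close>, towards its monomial ideal\<close>
      have "V \<inter> ?Big 1 \<inter> jordan_cell Q \<noteq> {}"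
      proof (rule cell_meets_both[OF inf Q(1), where K = "TYPE('k)", unfolded diagQ])
        show "openin ?Z V" using V by blast
        show "V \<inter> jordan_cell Q \<noteq> {}" using I Q(2) by blast
        show "openin ?Z (?Big 1)" by (rule openin_transversal_all)
        show "?Big 1 \<inter> jordan_cell Q \<noteq> {}" using E[OF Q(1) diagQ] by blast
      qed
      then obtain I1 where I1: "I1 \<in> V" "I1 \<in> ?Big 1" "I1 \<in> jordan_cell Q" by blast
      have I1G: "I1 \<in> G_T T" using I1(2) by blast
      then have gr: "graded_ideal I1" by (simp add: G_T_def)
      obtain B where B: "frame T I1 B" using frame[OF Q(1) I1(3) I1G] by blast
      \<comment> \<open>then along the substitutions, towards the big cell\<close>
      have "\<exists>s. shear_ideal s I1 \<in> V \<inter> ?Big 0"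
      proof (rule curve_meets_both[OF inf _ openin_transversal_all])
        show "openin ?Z V" using V by blast
        show "shear_ideal s I1 \<in> G_T T" "frame T (shear_ideal s I1) (shear_frame s B)" for s
          by (rule frame_shear[OF I1G B])+
        show "polyfun (\<lambda>s. lookup (shear_frame s B i r) m)" for i r m by (rule polyfun_shear_frame)
        show "shear_ideal 0 I1 \<in> V" using I1(1) unfolding shear_ideal_0[OF gr] .
        show "shear_ideal 1 I1 \<in> ?Big 0" by (rule move[OF I1(2,3) Q(1)])
      qed
      then have "V \<inter> jordan_cell P0 \<noteq> {}" unfolding big_cell by blast
      then have "V \<inter> ?G \<inter> jordan_cell P0 \<noteq> {}"
        using V G Gmeet by (intro cell_meets_both[OF inf P0(1), where K = "TYPE('k)", unfolded diag0]) blast+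
      then show "?Big 0 \<inter> ?G \<inter> V \<noteq> {}" unfolding big_cell by blast
    qed
  qed
  then show ?thesis using P0(1) hgt0 by blast
qed

section \<open>Matrices of full rank\<close>

lemma rows_indep_reindex:
  assumes "inj_on f A" "\<And>c b. c \<in> A \<Longrightarrow> b \<in> B \<Longrightarrow> hess_entry \<beta> (f c) (f b) = hess_entry \<alpha> c b"
  shows "rows_indep \<beta> (f ` A) (f ` B) \<longleftrightarrow> rows_indep \<alpha> A B"
proof -
  have sum: "(\<Sum>c\<in>f ` A. u c * hess_entry \<beta> c (f b)) = (\<Sum>c\<in>A. u (f c) * hess_entry \<alpha> c b)" if "b \<in> B" for u b
    unfolding sum.reindex[OF assms(1)] comp_def using assms(2) that by (intro sum.cong refl) simp
  show ?thesis
  proof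
    assume r: "rows_indep \<beta> (f ` A) (f ` B)"
    show "rows_indep \<alpha> A B"
      unfolding rows_indep_iff
    proof (intro allI impI ballI)
      fix u c assume u: "\<forall>b\<in>B. (\<Sum>c\<in>A. u c * hess_entry \<alpha> c b) = 0" and c: "c \<in> A"
      let ?u = "\<lambda>x. u (the_inv_into A f x)"
      have "(\<Sum>c\<in>A. ?u (f c) * hess_entry \<alpha> c b) = (\<Sum>c\<in>A. u c * hess_entry \<alpha> c b)" for b
        by (intro sum.cong refl) (simp add: the_inv_into_f_f[OF assms(1)])
      then have "\<forall>b\<in>f ` B. (\<Sum>c\<in>f ` A. ?u c * hess_entry \<beta> c b) = 0" using u sum by simp
      from r[unfolded rows_indep_iff, THEN spec, of ?u, THEN mp, OF this]
      have "?u (f c) = 0" using c by blast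
      then show "u c = 0" using c by (simp add: the_inv_into_f_f[OF assms(1)])
    qed
  next
    assume r: "rows_indep \<alpha> A B"
    show "rows_indep \<beta> (f ` A) (f ` B)"
      unfolding rows_indep_iff
    proof (intro allI impI)
      fix u assume "\<forall>b\<in>f ` B. (\<Sum>c\<in>f ` A. u c * hess_entry \<beta> c b) = 0"
      then have "\<forall>b\<in>B. (\<Sum>c\<in>A. u (f c) * hess_entry \<alpha> c b) = 0" using sum by simp
      then have "\<forall>c\<in>A. u (f c) = 0" using r[unfolded rows_indep_iff, THEN spec, of "\<lambda>c. u (f c)"] by simp
      then show "\<forall>c\<in>f ` A. u c = 0" by simp
    qed
  qed
qed

text \<open>The pattern of fixed and free entries only depends on which columns precede, and which directly
  follow, each row.\<close>

lemma gen_rank_reindex: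
  assumes inj: "inj_on f (A \<union> B)"
    and le: "\<And>c b. c \<in> A \<Longrightarrow> b \<in> B \<Longrightarrow> f b \<le> f c \<longleftrightarrow> b \<le> c"
    and adj: "\<And>c b. c \<in> A \<Longrightarrow> b \<in> B \<Longrightarrow> f b = Suc (f c) \<longleftrightarrow> b = Suc c"
  shows "gen_rank TYPE('k::field) (f ` A) (f ` B) = gen_rank TYPE('k) A B"
proof -
  let ?g = "the_inv_into (A \<union> B) f"
  have g: "?g (f x) = x" if "x \<in> A \<union> B" for x using that by (rule the_inv_into_f_f[OF inj])
  have iff: "(\<exists>\<beta> :: nat \<Rightarrow> nat \<Rightarrow> 'k. rows_indep \<beta> (f ` A') (f ` B)) \<longleftrightarrow> (\<exists>\<alpha> :: nat \<Rightarrow> nat \<Rightarrow> 'k. rows_indep \<alpha> A' B)"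
    if A': "A' \<subseteq> A" for A'
  proof -
    have inj': "inj_on f A'" by (rule inj_on_subset[OF inj]) (use A' in blast)
    have entry: "hess_entry \<beta> (f c) (f b) = hess_entry (\<lambda>c b. \<beta> (f c) (f b)) c b"
      if "c \<in> A'" "b \<in> B" for \<beta> :: "nat \<Rightarrow> nat \<Rightarrow> 'k" and c b
      using that A' le[of c b] adj[of c b] by (auto simp: hess_entry_def)
    show ?thesis
    proof
      assume "\<exists>\<beta> :: nat \<Rightarrow> nat \<Rightarrow> 'k. rows_indep \<beta> (f ` A') (f ` B)"
      then show "\<exists>\<alpha> :: nat \<Rightarrow> nat \<Rightarrow> 'k. rows_indep \<alpha> A' B"
        using rows_indep_reindex[OF inj' entry] by blast
    next
      assume "\<exists>\<alpha> :: nat \<Rightarrow> nat \<Rightarrow> 'k. rows_indep \<alpha> A' B"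
      then obtain \<alpha> :: "nat \<Rightarrow> nat \<Rightarrow> 'k" where \<alpha>: "rows_indep \<alpha> A' B" ..
      let ?\<beta> = "\<lambda>c b. \<alpha> (?g c) (?g b)"
      have "hess_entry ?\<beta> (f c) (f b) = hess_entry \<alpha> c b" if "c \<in> A'" "b \<in> B" for c b
      proof -
        have "?g (f c) = c" "?g (f b) = b" using that A' by (blast intro: g)+
        then show ?thesis unfolding entry[OF that] by (simp add: hess_entry_def)
      qed
      then have "rows_indep ?\<beta> (f ` A') (f ` B)" using \<alpha> by (subst rows_indep_reindex[OF inj'])
      then show "\<exists>\<beta> :: nat \<Rightarrow> nat \<Rightarrow> 'k. rows_indep \<beta> (f ` A') (f ` B)" by (rule exI[of _ ?\<beta>])
    qed
  qed
  have card: "card (f ` A') = card A'" if "A' \<subseteq> A" for A'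
    by (rule card_image, rule inj_on_subset[OF inj]) (use that in blast)
  have "{card A' | A'. A' \<subseteq> f ` A \<and> (\<exists>\<beta> :: nat \<Rightarrow> nat \<Rightarrow> 'k. rows_indep \<beta> A' (f ` B))} =
      {card A' | A'. A' \<subseteq> A \<and> (\<exists>\<alpha> :: nat \<Rightarrow> nat \<Rightarrow> 'k. rows_indep \<alpha> A' B)}" (is "?L = ?R")
  proof (intro subset_antisym subsetI)
    fix m assume "m \<in> ?L"
    then obtain C where C: "m = card C" "C \<subseteq> f ` A" "\<exists>\<beta> :: nat \<Rightarrow> nat \<Rightarrow> 'k. rows_indep \<beta> C (f ` B)" by blast
    then obtain A' where A': "A' \<subseteq> A" "C = f ` A'" by (meson subset_imageE)
    then have "\<exists>\<alpha> :: nat \<Rightarrow> nat \<Rightarrow> 'k. rows_indep \<alpha> A' B" using C(3) iff by blast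
    then show "m \<in> ?R" using A'(1) C(1) card[OF A'(1)] unfolding A'(2) by blast
  next
    fix m assume "m \<in> ?R"
    then obtain A' where A': "m = card A'" "A' \<subseteq> A" "\<exists>\<alpha> :: nat \<Rightarrow> nat \<Rightarrow> 'k. rows_indep \<alpha> A' B" by blast
    then have "\<exists>\<beta> :: nat \<Rightarrow> nat \<Rightarrow> 'k. rows_indep \<beta> (f ` A') (f ` B)" using iff by blast
    moreover have "f ` A' \<subseteq> f ` A" using A'(2) by blast
    ultimately show "m \<in> ?L" using A'(1) card[OF A'(2)] by (intro CollectI exI[of _ "f ` A'"]) simp
  qed
  then show ?thesis unfolding gen_rank_def by simp
qed

definition full_rank :: "'k::field itself \<Rightarrow> nat set \<Rightarrow> nat set \<Rightarrow> bool" where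
  "full_rank K A B \<longleftrightarrow> gen_rank K A B = min (card A) (card B)"

text \<open>In the big cell all columns but the last precede all rows, so that any matching gives an
  invertible minor; the last row and the last column meet in one of the fixed ones.\<close>

lemma full_rank_big_cell:
  fixes T :: "nat \<Rightarrow> nat"
  assumes n: "height_fun n" and D: "\<And>i. {b. n b \<le> i} = {T i..i}"
    and T: "T i \<le> i" "T (Suc i) \<le> T i"
  shows "full_rank TYPE('k::field) {c. n c = i} {b. n b = Suc i}"
proof -
  let ?A = "{c. n c = i}" and ?B = "{b. n b = Suc i}"
  have finA: "finite ?A" and finB: "finite ?B" by (rule finite_height_eq[OF n])+
  have le: "n b \<le> k \<longleftrightarrow> T k \<le> b \<and> b \<le> k" for b k using D[of k] by (auto simp: set_eq_iff)
  have A: "T i \<le> c \<and> c \<le> i" if "c \<in> ?A" for c using le[of c i] that by simp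
  have iA: "i \<in> ?A"
    using le[of i i] height_funD(1)[OF n, of i] T(1) by simp
  have iB: "Suc i \<in> ?B"
    using le[of "Suc i" "Suc i"] height_funD(1)[OF n, of "Suc i"] T by simp
  have B: "b < T i \<or> b = Suc i" if "b \<in> ?B" for b
    using le[of b "Suc i"] le[of b i] that by auto
  let ?q = "min (card ?A) (card ?B)"
  have q: "0 < card ?A" "0 < card ?B" using iA iB finA finB by (auto simp: card_gt_0_iff)
  have "?q - 1 \<le> card (?A - {i})" using iA by simp
  then obtain A' where A': "A' \<subseteq> ?A - {i}" "card A' = ?q - 1" using obtain_subset_with_card_n by metis
  have "?q - 1 \<le> card (?B - {Suc i})" using iB by simp
  then obtain B' where B': "B' \<subseteq> ?B - {Suc i}" "card B' = ?q - 1" using obtain_subset_with_card_n by metis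
  have finA': "finite A'" and finB': "finite B'" using A'(1) B'(1) finA finB finite_subset by blast+
  obtain \<sigma> where \<sigma>: "bij_betw \<sigma> A' B'"
    using finite_same_card_bij[OF finA' finB'] A'(2) B'(2) by auto
  define \<alpha> :: "nat \<Rightarrow> nat \<Rightarrow> 'k" where "\<alpha> c b = (if c \<in> A' \<and> b = \<sigma> c then 1 else 0)" for c b
  have small: "\<sigma> c < T i" if "c \<in> A'" for c
    using bij_betwE[OF \<sigma>] that B'(1) B by blast
  have entry: "hess_entry \<alpha> c b = (if c \<in> A' \<and> b = \<sigma> c then 1 else if c = i \<and> b = Suc i then 1 else 0)"
    if c: "c \<in> insert i A'" and b: "b \<in> insert (Suc i) B'" for c b
  proof -
    have cA: "c \<in> ?A" using c iA A'(1) by blast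
    have bB: "b \<in> ?B" using b iB B'(1) by blast
    show ?thesis
      using A[OF cA] B[OF bB] small[of c] c A'(1) unfolding hess_entry_def \<alpha>_def by auto
  qed
  have "rows_indep \<alpha> (insert i A') ?B"
    unfolding rows_indep_iff
  proof (intro allI impI)
    fix u assume u: "\<forall>b\<in>?B. (\<Sum>c\<in>insert i A'. u c * hess_entry \<alpha> c b) = 0"
    have iA': "i \<notin> A'" using A'(1) by blast
    have u': "u c = 0" if c: "c \<in> A'" for c
    proof -
      have bB: "\<sigma> c \<in> B'" using bij_betwE[OF \<sigma>] c by blast
      have "(\<Sum>c'\<in>insert i A'. u c' * hess_entry \<alpha> c' (\<sigma> c)) = (\<Sum>c'\<in>{c}. u c' * hess_entry \<alpha> c' (\<sigma> c))"
      proof (rule sum.mono_neutral_right)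
        show "\<forall>c'\<in>insert i A' - {c}. u c' * hess_entry \<alpha> c' (\<sigma> c) = 0"
        proof
          fix c' assume c': "c' \<in> insert i A' - {c}"
          have "\<sigma> c' \<noteq> \<sigma> c" if "c' \<in> A'"
            using that c c' inj_onD[OF bij_betw_imp_inj_on[OF \<sigma>], of c' c] by blast
          moreover have "\<sigma> c \<noteq> Suc i" using small[OF c] T(1) by simp
          ultimately show "u c' * hess_entry \<alpha> c' (\<sigma> c) = 0" using entry[of c' "\<sigma> c"] c' bB by auto
        qed
      qed (use c finA' in auto)
      also have "\<dots> = u c" using entry[of c "\<sigma> c"] c bB by simp
      finally show ?thesis using u bB B'(1) by auto
    qed
    have "(\<Sum>c\<in>insert i A'. u c * hess_entry \<alpha> c (Suc i)) = u i * hess_entry \<alpha> i (Suc i)"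
      using finA' iA' u' by simp
    also have "\<dots> = u i" by (simp add: hess_entry_def)
    finally have "u i = 0" using u iB by auto
    then show "\<forall>c\<in>insert i A'. u c = 0" using u' by blast
  qed
  moreover have "insert i A' \<subseteq> ?A" using iA A'(1) by blast
  ultimately have "card (insert i A') \<le> gen_rank TYPE('k) ?A ?B" by (intro gen_rank_ge[OF finA])
  moreover have "card (insert i A') = ?q" using A' finA' q by (subst card_insert_disjoint) auto
  moreover have "gen_rank TYPE('k) ?A ?B \<le> card ?A" by (rule gen_rank_le_card[OF finA])
  moreover have "gen_rank TYPE('k) ?A ?B \<le> card ?B" by (rule gen_rank_le_columns[OF n])
  ultimately show ?thesis unfolding full_rank_def by simp
qed

section \<open>Words\<close>

text \<open>A partition is encoded by the word of its heights, in which letters increase by at most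
  one from each position to the next.\<close>

abbreviation rising :: "nat list \<Rightarrow> bool" where
  "rising \<equiv> successively (\<lambda>x y. y \<le> Suc x)"

definition positions :: "'a list \<Rightarrow> 'a \<Rightarrow> nat set" where
  "positions w x = {b. b < length w \<and> w ! b = x}"

definition pair_word :: "nat \<Rightarrow> nat list \<Rightarrow> bool list" where
  "pair_word i w = map (\<lambda>x. x = i) (filter (\<lambda>x. x = i \<or> x = Suc i) w)"

text \<open>Full rank in degree \<open>i\<close> can be read off from the subword of the letters \<open>i\<close> and
  \<open>i + 1\<close>: an \<open>i\<close> directly before an \<open>i + 1\<close> in the subword is directly before it in the word,
  since a rising word passes through \<open>i\<close> on its way up to \<open>i + 1\<close>.\<close>

lemma full_rank_pair_word:
  assumes rise: "rising w"
  shows "full_rank TYPE('k::field) (positions w i) (positions w (Suc i)) \<longleftrightarrow>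
    full_rank TYPE('k) (positions (pair_word i w) True) (positions (pair_word i w) False)"
proof -
  define q where "q x \<longleftrightarrow> x = i \<or> x = Suc i" for x
  define f where "f b = length (filter q (take b w))" for b
  have fSuc: "f (Suc b) = (if q (w ! b) then Suc (f b) else f b)" if "b < length w" for b
    using that by (simp add: f_def take_Suc_conv_app_nth)
  have mono: "f b \<le> f c" if "b \<le> c" "c \<le> length w" for b c
    using that
  proof (induction rule: dec_induct)
    case (step c)
    then show ?case using fSuc[of c] by (auto split: if_splits)
  qed simp
  have strict: "f b < f c" if "b < c" "c < length w" "q (w ! b)" for b c
    using mono[of "Suc b" c] fSuc[of b] that by simp
  let ?v = "filter q w"
  have nth: "f b < length ?v \<and> ?v ! f b = w ! b" if "b < length w" "q (w ! b)" for b
  proof -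
    have "w = take b w @ w ! b # drop (Suc b) w" using that(1) by (rule id_take_nth_drop)
    then have "?v = filter q (take b w) @ w ! b # filter q (drop (Suc b) w)"
      using that(2) by (metis filter.simps(2) filter_append)
    then show ?thesis unfolding f_def by (metis add_Suc_right length_Cons length_append less_add_Suc1 nth_append_length)
  qed
  have pw: "pair_word i w = map (\<lambda>x. x = i) ?v" unfolding pair_word_def q_def ..
  let ?Q = "{b. b < length w \<and> q (w ! b)}"
  have injQ: "inj_on f ?Q"
  proof (rule inj_onI, rule ccontr)
    fix b c assume "b \<in> ?Q" "c \<in> ?Q" "f b = f c" "b \<noteq> c"
    then show False using strict[of b c] strict[of c b] by (cases "b < c") auto
  qed
  have img: "f ` ?Q = {..<length ?v}"
  proof (rule card_subset_eq)
    show "card (f ` ?Q) = card {..<length ?v}"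
      unfolding card_image[OF injQ] length_filter_conv_card by simp
  qed (use nth in auto)
  have AQ: "positions w i \<subseteq> ?Q" "positions w (Suc i) \<subseteq> ?Q" by (auto simp: positions_def q_def)
  have vmem: "?v ! k = i \<or> ?v ! k = Suc i" if "k < length ?v" for k
    using nth_mem[OF that] by (auto simp: q_def)
  have imgA: "f ` positions w x = {k. k < length ?v \<and> ?v ! k = x}" if x: "x = i \<or> x = Suc i" for x
  proof (intro subset_antisym subsetI)
    fix k assume "k \<in> f ` positions w x"
    then obtain b where "k = f b" "b < length w" "w ! b = x" by (auto simp: positions_def)
    then show "k \<in> {k. k < length ?v \<and> ?v ! k = x}" using nth[of b] x by (auto simp: q_def)
  next
    fix k assume k: "k \<in> {k. k < length ?v \<and> ?v ! k = x}"
    then obtain b where b: "b \<in> ?Q" "k = f b" using img by blast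
    then have "w ! b = x" using nth[of b] k by simp
    then show "k \<in> f ` positions w x" using b by (auto simp: positions_def)
  qed
  have A: "positions (pair_word i w) True = f ` positions w i"
    using imgA[of i] by (auto simp: pw positions_def)
  have B: "positions (pair_word i w) False = f ` positions w (Suc i)"
  proof -
    have "positions (pair_word i w) False = {k. k < length ?v \<and> ?v ! k = Suc i}"
      unfolding pw positions_def
    proof (rule Collect_cong)
      fix k
      show "k < length (map (\<lambda>x. x = i) ?v) \<and> map (\<lambda>x. x = i) ?v ! k = False \<longleftrightarrow>
          k < length ?v \<and> ?v ! k = Suc i"
        using vmem[of k] by (cases "k < length ?v") auto
    qed
    then show ?thesis using imgA[of "Suc i"] by simp
  qed
  have rank: "gen_rank TYPE('k) (f ` positions w i) (f ` positions w (Suc i)) =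
      gen_rank TYPE('k) (positions w i) (positions w (Suc i))"
  proof (rule gen_rank_reindex)
    show "inj_on f (positions w i \<union> positions w (Suc i))" by (rule inj_on_subset[OF injQ]) (use AQ in blast)
    fix c b assume c: "c \<in> positions w i" and b: "b \<in> positions w (Suc i)"
    then have c': "c < length w" "w ! c = i" and b': "b < length w" "w ! b = Suc i" by (auto simp: positions_def)
    have ne: "b \<noteq> c" using b' c' by auto
    show "f b \<le> f c \<longleftrightarrow> b \<le> c"
    proof (cases "b \<le> c")
      case True
      then show ?thesis using mono[of b c] c' by simp
    next
      case False
      then show ?thesis using strict[of c b] c' b' by (simp add: q_def)
    qed
    show "f b = Suc (f c) \<longleftrightarrow> b = Suc c"
    proof
      assume "b = Suc c"
      then show "f b = Suc (f c)" using fSuc[of c] c' by (simp add: q_def)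
    next
      assume eq: "f b = Suc (f c)"
      show "b = Suc c"
      proof (rule ccontr)
        assume "b \<noteq> Suc c"
        moreover have "c < b" using strict[of b c] b' c' eq ne by (cases "b < c") (auto simp: q_def)
        ultimately have cb: "Suc c < b" by simp
        have notq: "\<not> q (w ! k)" if "Suc c \<le> k" "k < b" for k
        proof
          assume "q (w ! k)"
          then have "f c < f k" "f k < f b" using strict[of c k] strict[of k b] that b' c' by (auto simp: q_def)
          then show False using eq by simp
        qed
        have small: "w ! k < i" if "Suc c \<le> k" "k < b" for k
          using that
        proof (induction rule: dec_induct)
          case base
          have "w ! Suc c \<le> Suc i" using successively_nth[OF rise, of c] c' cb b' by simp
          then show ?case using notq[of "Suc c"] cb by (auto simp: q_def)
        next
          case (step k)
          have "w ! Suc k \<le> Suc (w ! k)" using successively_nth[OF rise, of k] step b' by simp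
          then show ?case using notq[of "Suc k"] step by (auto simp: q_def)
        qed
        obtain k where k: "b = Suc k" "Suc c \<le> k" using cb by (cases b) auto
        then have "w ! b \<le> Suc (w ! k)" using successively_nth[OF rise, of k] b' by simp
        then show False using small[of k] k b' by simp
      qed
    qed
  qed
  have "card (f ` positions w x) = card (positions w x)" if "x = i \<or> x = Suc i" for x
    by (rule card_image, rule inj_on_subset[OF injQ]) (use that AQ in blast)
  then show ?thesis unfolding full_rank_def A B rank by simp
qed

subsection \<open>Counting words by their pair words\<close>

definition words :: "nat \<Rightarrow> nat \<Rightarrow> (nat \<Rightarrow> nat) \<Rightarrow> nat list set" where
  "words lo hi h = {w. w \<noteq> [] \<and> last w = hi \<and> set w \<subseteq> {lo..hi} \<and> rising w \<and>
     (\<forall>i\<in>{lo..hi}. count_list w i = h i)}"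

definition pair_words :: "nat \<Rightarrow> nat \<Rightarrow> bool list set" where
  "pair_words a b = {v. v \<noteq> [] \<and> \<not> last v \<and> count_list v True = a \<and> count_list v False = b}"

text \<open>In a rising word that does not end with its least letter \<open>lo\<close>, every run of letters \<open>lo\<close> is
  followed by \<open>lo + 1\<close>.  Hence the word arises from the word \<open>u\<close> of its other letters by inserting
  the \<open>lo\<close> directly before letters \<open>lo + 1\<close>, as told by the pair word \<open>v\<close>, in which \<open>True\<close>
  stands for \<open>lo\<close> and \<open>False\<close> for \<open>lo + 1\<close>.\<close>

fun insert_least :: "nat \<Rightarrow> nat list \<Rightarrow> bool list \<Rightarrow> nat list" where
  "insert_least lo [] v = []"
| "insert_least lo (x # u) [] = x # insert_least lo u []"
| "insert_least lo (x # u) (True # v) =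
     (if x = Suc lo then lo # insert_least lo (x # u) v else x # insert_least lo u (True # v))"
| "insert_least lo (x # u) (False # v) =
     (if x = Suc lo then x # insert_least lo u v else x # insert_least lo u (False # v))"

lemma pair_word_simps [simp]:
  "pair_word i [] = []"
  "pair_word i (x # w) = (if x = i then True # pair_word i w else
     if x = Suc i then False # pair_word i w else pair_word i w)"
  by (simp_all add: pair_word_def)

lemma count_pair_word:
  "count_list (pair_word i w) True = count_list w i"
  "count_list (pair_word i w) False = count_list w (Suc i)"
  by (induction w) simp_all

lemma pair_word_filter: "lo < i \<Longrightarrow> pair_word i (filter (\<lambda>x. x \<noteq> lo) w) = pair_word i w"
  by (induction w) auto

lemma count_filter_neq: "i \<noteq> lo \<Longrightarrow> count_list (filter (\<lambda>x. x \<noteq> lo) w) i = count_list w i"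
  by (induction w) auto

lemma insert_least_inverse:
  assumes "lo \<notin> set u" "v = [] \<or> \<not> last v" "count_list u (Suc lo) = count_list v False"
  shows "filter (\<lambda>x. x \<noteq> lo) (insert_least lo u v) = u \<and> pair_word lo (insert_least lo u v) = v"
  using assms
proof (induction lo u v rule: insert_least.induct)
  case (1 lo v)
  have "v = []"
  proof (rule ccontr)
    assume v: "v \<noteq> []"
    then have "last v = False" using 1(2) by blast
    then have "False \<in> set v" using last_in_set[OF v] by metis
    then show False using 1(3) by (metis count_list.simps(1) count_list_0_iff)
  qed
  then show ?case by simp
qed (auto split: if_splits)

lemma insert_least_Cons:
  assumes "u \<noteq> []"
  shows "insert_least lo u v \<noteq> [] \<and> (hd (insert_least lo u v) = lo \<or> hd (insert_least lo u v) = hd u) \<and>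
    last (insert_least lo u v) = last u"
  using assms
proof (induction lo u v rule: insert_least.induct)
  case (2 lo x u)
  then show ?case by (cases "u = []") simp_all
next
  case (3 lo x u v)
  show ?case
  proof (cases "x = Suc lo")
    case True
    then show ?thesis using 3(1) by simp
  next
    case False
    then show ?thesis using 3(2) by (cases "u = []") simp_all
  qed
next
  case (4 lo x u v)
  show ?case
  proof (cases "x = Suc lo")
    case True
    then show ?thesis using 4(1) by (cases "u = []") simp_all
  next
    case False
    then show ?thesis using 4(2) by (cases "u = []") simp_all
  qed
qed simp

lemma rising_insert_least:
  assumes "rising u" "\<forall>x\<in>set u. lo < x"
  shows "rising (insert_least lo u v)"
  using assms
proof (induction lo u v rule: insert_least.induct)
  case (2 lo x u)
  then show ?case
    using insert_least_Cons[of u lo "[]"] by (cases u) (auto simp: successively_Cons)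
next
  case (3 lo x u v)
  show ?case
  proof (cases "x = Suc lo")
    case True
    have "rising (insert_least lo (x # u) v)" using 3 True by simp
    then show ?thesis using True insert_least_Cons[of "x # u" lo v] by (auto simp: successively_Cons)
  next
    case False
    then show ?thesis
      using 3 insert_least_Cons[of u lo "True # v"] by (cases u) (auto simp: successively_Cons)
  qed
next
  case (4 lo x u v)
  show ?case
  proof (cases "x = Suc lo")
    case True
    then show ?thesis using 4 insert_least_Cons[of u lo v] by (cases u) (auto simp: successively_Cons)
  next
    case False
    then show ?thesis
      using 4 insert_least_Cons[of u lo "False # v"] by (cases u) (auto simp: successively_Cons)
  qed
qed simp

lemma set_insert_least: "set (insert_least lo u v) \<subseteq> insert lo (set u)"
  by (induction lo u v rule: insert_least.induct) auto

lemma run_of_least: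
  assumes "rising w" "\<forall>x\<in>set w. lo \<le> x" "w \<noteq> []" "lo < last w" "hd w \<le> Suc lo"
  shows "\<exists>u. filter (\<lambda>x. x \<noteq> lo) w = Suc lo # u"
  using assms
proof (induction w)
  case (Cons x w)
  show ?case
  proof (cases "x = lo")
    case True
    then have "w \<noteq> []" using Cons.prems by auto
    then have "\<exists>u. filter (\<lambda>x. x \<noteq> lo) w = Suc lo # u"
      using Cons.prems True by (intro Cons.IH) (auto simp: successively_Cons)
    then show ?thesis using True by simp
  next
    case False
    then have "x = Suc lo" using Cons.prems by auto
    then show ?thesis by simp
  qed
qed simp

lemma insert_least_of_parts:
  assumes "rising w" "\<forall>x\<in>set w. lo \<le> x" "w = [] \<or> lo < last w"
  shows "insert_least lo (filter (\<lambda>x. x \<noteq> lo) w) (pair_word lo w) = w \<and> (pair_word lo w = [] \<or> \<not> last (pair_word lo w))"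
  using assms
proof (induction w)
  case (Cons x w)
  have IH: "insert_least lo (filter (\<lambda>x. x \<noteq> lo) w) (pair_word lo w) = w"
    "pair_word lo w = [] \<or> \<not> last (pair_word lo w)"
    using Cons by (auto simp: successively_Cons split: if_splits)
  consider "x = lo" | "x = Suc lo" | "x \<noteq> lo" "x \<noteq> Suc lo" by blast
  then show ?case
  proof cases
    case 1
    then have w: "w \<noteq> []" using Cons.prems by auto
    then have "\<exists>u. filter (\<lambda>x. x \<noteq> lo) w = Suc lo # u"
      using Cons.prems 1 by (intro run_of_least) (auto simp: successively_Cons)
    then obtain u where u: "filter (\<lambda>x. x \<noteq> lo) w = Suc lo # u" ..
    then have "Suc lo \<in> set w" by (metis (mono_tags, lifting) filter_is_subset list.set_intros(1) subsetD)
    then have "pair_word lo w \<noteq> []" using count_pair_word(2)[of lo w] by (metis count_list.simps(1) count_list_0_iff)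
    then show ?thesis using 1 u IH by simp
  next
    case 2
    then show ?thesis using IH by auto
  next
    case 3
    have "insert_least lo (x # u) v = x # insert_least lo u v" for u v
      using 3(2) by (cases v; cases "hd v") simp_all
    then show ?thesis using 3 IH by simp
  qed
qed simp

lemma rising_filter_least:
  assumes "rising w" "\<forall>x\<in>set w. lo \<le> x"
  shows "rising (filter (\<lambda>x. x \<noteq> lo) w) \<and>
    (\<forall>y u. filter (\<lambda>x. x \<noteq> lo) w = y # u \<longrightarrow> y = hd w \<or> hd w = lo \<and> y = Suc lo)"
  using assms
proof (induction w)
  case (Cons x w)
  have r: "w = [] \<or> hd w \<le> Suc x" "rising w" using Cons.prems by (auto simp: successively_Cons)
  have IH: "rising (filter (\<lambda>x. x \<noteq> lo) w)"
    "\<And>y u. filter (\<lambda>x. x \<noteq> lo) w = y # u \<Longrightarrow> y = hd w \<or> hd w = lo \<and> y = Suc lo"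
    using Cons.IH[OF r(2)] Cons.prems(2) by auto
  show ?case
  proof (cases "filter (\<lambda>x. x \<noteq> lo) w")
    case Nil
    then show ?thesis by simp
  next
    case (Cons y u)
    then have wne: "w \<noteq> []" and ylo: "y \<noteq> lo" "lo \<le> y" "lo \<le> x"
      using Cons.prems(2) filter_eq_ConsD[OF Cons] by auto
    then have "y \<le> Suc x" using IH(2)[OF Cons] r(1) by auto
    moreover have "x = lo \<Longrightarrow> y = Suc lo" using calculation ylo by simp
    ultimately show ?thesis using IH(1) Cons by (auto simp: successively_Cons)
  qed
qed simp

lemma finite_words: "finite (words lo hi h)"
proof (rule finite_subset)
  show "words lo hi h \<subseteq> {w. set w \<subseteq> {lo..hi} \<and> length w = (\<Sum>i\<in>{lo..hi}. h i)}"
  proof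
    fix w assume w: "w \<in> words lo hi h"
    then have "length w = (\<Sum>i\<in>{lo..hi}. count_list w i)"
      by (intro sum_count_set[symmetric]) (auto simp: words_def)
    also have "\<dots> = (\<Sum>i\<in>{lo..hi}. h i)" using w by (intro sum.cong) (auto simp: words_def)
    finally show "w \<in> {w. set w \<subseteq> {lo..hi} \<and> length w = (\<Sum>i\<in>{lo..hi}. h i)}" using w by (simp add: words_def)
  qed
  show "finite {w. set w \<subseteq> {lo..hi} \<and> length w = (\<Sum>i\<in>{lo..hi}. h i)}" by (rule finite_lists_length_eq) simp
qed

text \<open>Splitting off the least letter pairs a word with the word of its other letters and the pair word of
  the two least letters; the other pair words do not see the least letter.\<close>

lemma card_words:
  assumes "lo \<le> hi" "\<And>i. lo \<le> i \<Longrightarrow> i \<le> hi \<Longrightarrow> 0 < h i"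
  shows "card {w \<in> words lo hi h. \<forall>i\<in>{lo..<hi}. Q i (pair_word i w)} =
    (\<Prod>i\<in>{lo..<hi}. card {v \<in> pair_words (h i) (h (Suc i)). Q i v})"
  using assms
proof (induction "hi - lo" arbitrary: lo)
  case 0
  then have "lo = hi" by simp
  have "words hi hi h = {replicate (h hi) hi}"
  proof (intro subset_antisym subsetI)
    fix w assume w: "w \<in> words hi hi h"
    then have all: "\<forall>x\<in>set w. x = hi" by (auto simp: words_def)
    then have "w = replicate (length w) hi" by (simp add: replicate_length_same)
    moreover have "length w = count_list w hi"
      using all unfolding count_list_eq_length_filter by (metis filter_True)
    ultimately show "w \<in> {replicate (h hi) hi}" using w by (simp add: words_def)
  next
    fix w assume w: "w \<in> {replicate (h hi) hi}"
    have "0 < h hi" using 0 \<open>lo = hi\<close> by simp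
    moreover have "count_list (replicate m hi) hi = m" for m by (induction m) simp_all
    moreover have "rising (replicate m hi)" for m by (simp add: successively_conv_nth)
    ultimately show "w \<in> words hi hi h" using w by (simp add: words_def)
  qed
  then show ?case using \<open>lo = hi\<close> by simp
next
  case (Suc k)
  then have lt: "lo < hi" by simp
  let ?X = "{w \<in> words lo hi h. \<forall>i\<in>{lo..<hi}. Q i (pair_word i w)}"
  let ?Y = "{u \<in> words (Suc lo) hi h. \<forall>i\<in>{Suc lo..<hi}. Q i (pair_word i u)}"
  let ?Z = "{v \<in> pair_words (h lo) (h (Suc lo)). Q lo v}"
  let ?F = "\<lambda>w. (filter (\<lambda>x. x \<noteq> lo) w, pair_word lo w)"
  let ?G = "\<lambda>(u, v). insert_least lo u v"
  have X: "insert_least lo (filter (\<lambda>x. x \<noteq> lo) w) (pair_word lo w) = w \<and> (pair_word lo w = [] \<or> \<not> last (pair_word lo w))"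
    if "w \<in> words lo hi h" for w
    using that lt by (intro insert_least_of_parts) (auto simp: words_def)
  have FX: "?F w \<in> ?Y \<times> ?Z" if w: "w \<in> ?X" for w
  proof -
    have ww: "w \<in> words lo hi h" using w by blast
    let ?u = "filter (\<lambda>x. x \<noteq> lo) w"
    have cnt: "count_list (pair_word lo w) True = h lo" "count_list (pair_word lo w) False = h (Suc lo)"
      using ww lt by (auto simp: words_def count_pair_word)
    then have "pair_word lo w \<noteq> []" using Suc.prems(2)[of "Suc lo"] lt by auto
    then have Z: "pair_word lo w \<in> ?Z" using X[OF ww] cnt w lt by (auto simp: pair_words_def)
    have "hi \<in> set ?u" using ww lt by (auto simp: words_def intro: last_in_set)
    then have ne: "?u \<noteq> []" by (metis empty_iff empty_set)
    have "last w = last ?u" using insert_least_Cons[OF ne, of lo "pair_word lo w"] X[OF ww] by metis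
    moreover have "rising ?u"
    proof -
      have "rising w" "\<forall>x\<in>set w. lo \<le> x" using ww by (auto simp: words_def)
      then show ?thesis using rising_filter_least by blast
    qed
    moreover have "count_list ?u i = h i" if "i \<in> {Suc lo..hi}" for i
      using ww that count_filter_neq[of i lo w] by (auto simp: words_def)
    moreover have "set ?u \<subseteq> {Suc lo..hi}" using ww by (auto simp: words_def)
    moreover have "last w = hi" using ww by (simp add: words_def)
    ultimately have "?u \<in> words (Suc lo) hi h" using ne by (simp add: words_def)
    moreover have "Q i (pair_word i ?u)" if "i \<in> {Suc lo..<hi}" for i
      using w that pair_word_filter[of lo i w] by simp
    ultimately show ?thesis using Z by simp
  qed
  have GY: "?G p \<in> ?X \<and> ?F (?G p) = p" if p: "p \<in> ?Y \<times> ?Z" for p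
  proof -
    obtain u v where uv: "p = (u, v)" by (cases p)
    have u: "u \<in> words (Suc lo) hi h" "\<And>i. i \<in> {Suc lo..<hi} \<Longrightarrow> Q i (pair_word i u)" and
      v: "v \<in> pair_words (h lo) (h (Suc lo))" "Q lo v" using p uv by auto
    let ?w = "insert_least lo u v"
    have une: "u \<noteq> []" and above: "\<forall>x\<in>set u. lo < x" using u(1) by (auto simp: words_def)
    have inv: "filter (\<lambda>x. x \<noteq> lo) ?w = u" "pair_word lo ?w = v"
      using insert_least_inverse[of lo u v] above u(1) v(1) lt by (auto simp: words_def pair_words_def)
    have "count_list ?w i = h i" if "i \<in> {lo..hi}" for i
    proof (cases "i = lo")
      case True
      then show ?thesis using count_pair_word(1)[of lo ?w] v(1) unfolding inv by (simp add: pair_words_def)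
    next
      case False
      then show ?thesis using count_filter_neq[of i lo ?w] that u(1) unfolding inv by (auto simp: words_def)
    qed
    moreover have "rising ?w" using u(1) above by (intro rising_insert_least) (auto simp: words_def)
    moreover have "set ?w \<subseteq> {lo..hi}"
    proof -
      have "set u \<subseteq> {Suc lo..hi}" using u(1) by (simp add: words_def)
      then have "set ?w \<subseteq> insert lo {Suc lo..hi}" using set_insert_least[of lo u v] by blast
      also have "\<dots> \<subseteq> {lo..hi}" using lt by auto
      finally show ?thesis .
    qed
    ultimately have "?w \<in> words lo hi h"
      using insert_least_Cons[OF une, of lo v] u(1) by (simp add: words_def)
    moreover have "Q i (pair_word i ?w)" if "i \<in> {lo..<hi}" for i
    proof (cases "i = lo")
      case True
      then show ?thesis using v(2) inv(2) by simp
    next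
      case False
      then show ?thesis using that u(2)[of i] pair_word_filter[of lo i ?w] unfolding inv by simp
    qed
    ultimately show ?thesis using inv uv by simp
  qed
  have "bij_betw ?F ?X (?Y \<times> ?Z)"
  proof (rule bij_betw_byWitness[where f' = ?G])
    show "\<forall>w\<in>?X. ?G (?F w) = w"
    proof
      fix w assume "w \<in> ?X"
      then have "w \<in> words lo hi h" by blast
      then show "?G (?F w) = w" using X by simp
    qed
    show "\<forall>p\<in>?Y \<times> ?Z. ?F (?G p) = p" using GY by blast
    show "?F ` ?X \<subseteq> ?Y \<times> ?Z" by (rule image_subsetI) (rule FX)
    show "?G ` (?Y \<times> ?Z) \<subseteq> ?X"
    proof (rule image_subsetI)
      fix p assume "p \<in> ?Y \<times> ?Z"
      then show "?G p \<in> ?X" by (rule GY[THEN conjunct1])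
    qed
  qed
  then have "card ?X = card (?Y \<times> ?Z)" by (rule bij_betw_same_card)
  also have "\<dots> = card ?Y * card ?Z" by (rule card_cartesian_product)
  also have "card ?Y = (\<Prod>i\<in>{Suc lo..<hi}. card {v \<in> pair_words (h i) (h (Suc i)). Q i v})"
    using Suc.hyps(2) Suc.prems by (intro Suc.hyps(1)) auto
  also have "\<dots> * card ?Z = (\<Prod>i\<in>{lo..<hi}. card {v \<in> pair_words (h i) (h (Suc i)). Q i v})"
    using lt by (simp add: prod.atLeast_Suc_lessThan mult.commute)
  finally show ?case .
qed

section \<open>Partitions with given diagonal lengths\<close>

text \<open>The sequences \<open>(1, ..., d, t_d, ..., t_J, 0, ...)\<close>, where \<open>J\<close> is any bound for the support.  The
  case \<open>d = 0\<close> is the zero sequence, which occurs among the slices.\<close>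

definition hilbert_seq :: "(nat \<Rightarrow> nat) \<Rightarrow> nat \<Rightarrow> nat \<Rightarrow> bool" where
  "hilbert_seq T d J \<longleftrightarrow> (\<forall>k<d. T k = Suc k) \<and> T d \<le> d \<and> (\<forall>k\<ge>d. T (Suc k) \<le> T k) \<and>
     (\<forall>k>J. T k = 0) \<and> d \<le> Suc J"

text \<open>The number of \<open>b\<close> with \<open>hgt P b = i\<close>, for \<open>P\<close> of diagonal lengths \<open>T\<close>.\<close>

definition letter_count :: "(nat \<Rightarrow> nat) \<Rightarrow> nat \<Rightarrow> nat" where
  "letter_count T i = (case i of 0 \<Rightarrow> 1 - T 0 | Suc i' \<Rightarrow> Suc (T i') - T (Suc i'))"

text \<open>The later heights are determined: \<open>hgt P b = b\<close> for \<open>b > J\<close>, if the diagonal lengths vanish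
  beyond \<open>J\<close>.\<close>

definition height_word :: "nat \<Rightarrow> nat list \<Rightarrow> nat list" where
  "height_word J P = map (hgt P) [0..<J + 2]"

context
  fixes T :: "nat \<Rightarrow> nat" and d J :: nat
  assumes T: "hilbert_seq T d J"
begin

lemma hilbert_seq_simps:
  "k < d \<Longrightarrow> T k = Suc k" "T d \<le> d" "d \<le> k \<Longrightarrow> T (Suc k) \<le> T k" "J < k \<Longrightarrow> T k = 0" "d \<le> Suc J"
  using T by (auto simp: hilbert_seq_def)

lemma hilbert_seq_le: "d \<le> k \<Longrightarrow> T k \<le> d" "T k \<le> Suc k" "T (Suc k) \<le> Suc (T k)"
proof -
  show 1: "T k \<le> d" if "d \<le> k" for k
    using that by (induction rule: dec_induct) (auto intro: hilbert_seq_simps order_trans[OF hilbert_seq_simps(3)])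
  show 2: "T k \<le> Suc k" for k using 1[of k] hilbert_seq_simps(1)[of k] by (cases "k < d") auto
  show "T (Suc k) \<le> Suc (T k)"
    using 2[of "Suc k"] hilbert_seq_simps(1)[of k] hilbert_seq_simps(3)[of k] by (cases "k < d") auto
qed

lemma letter_count_0: "i < d \<Longrightarrow> letter_count T i = 0"
  using hilbert_seq_simps(1)[of i] hilbert_seq_simps(1)[of "i - 1"] by (cases i) (auto simp: letter_count_def)

lemma letter_count_pos: "d \<le> i \<Longrightarrow> 0 < letter_count T i"
proof (cases i)
  case 0
  assume "d \<le> i"
  then show ?thesis using 0 hilbert_seq_simps(2) by (simp add: letter_count_def)
next
  case (Suc i')
  assume "d \<le> i"
  then show ?thesis
    using Suc hilbert_seq_simps(2) hilbert_seq_simps(1)[of i'] hilbert_seq_simps(3)[of i']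
    by (cases "i' < d") (auto simp: letter_count_def le_Suc_eq)
qed

lemma letter_count_above: "Suc J < i \<Longrightarrow> letter_count T i = 1"
  using hilbert_seq_simps(4)[of i] hilbert_seq_simps(4)[of "i - 1"] by (cases i) (auto simp: letter_count_def)

lemma sum_letter_count: "(\<Sum>i\<le>k. letter_count T i) = Suc k - T k"
proof (induction k)
  case (Suc k)
  then show ?case
    using hilbert_seq_le(2)[of k] hilbert_seq_le(3)[of k] by (simp add: letter_count_def)
qed (simp add: letter_count_def)

lemma partitions_of_diag_iff:
  "P \<in> partitions_of_diag K T \<longleftrightarrow> is_partition P \<and> (\<forall>i. card {b. hgt P b = i} = letter_count T i)"
proof (cases "is_partition P")
  case True
  note n = height_fun_hgt[OF True]
  have "diagonal_lengths K P = T \<longleftrightarrow> (\<forall>i. card {b. hgt P b \<le> i} = Suc i - T i)"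
  proof
    assume "diagonal_lengths K P = T"
    then have "i + 1 - card {b. hgt P b \<le> i} = T i" for i using diagonal_lengths_eq[OF True, of K i] by simp
    then show "\<forall>i. card {b. hgt P b \<le> i} = Suc i - T i"
      using card_height_le[OF n] by (metis Suc_eq_plus1 diff_diff_cancel)
  next
    assume "\<forall>i. card {b. hgt P b \<le> i} = Suc i - T i"
    then have "diagonal_lengths K P i = T i" for i
      using diagonal_lengths_eq[OF True, of K i] hilbert_seq_le(2)[of i] by simp
    then show "diagonal_lengths K P = T" by (rule ext)
  qed
  also have "\<dots> \<longleftrightarrow> (\<forall>i. card {b. hgt P b \<le> i} = (\<Sum>k\<le>i. letter_count T k))"
    unfolding sum_letter_count ..
  also have "\<dots> \<longleftrightarrow> (\<forall>i. card {b. hgt P b = i} = letter_count T i)" (is "?L \<longleftrightarrow> ?R")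
  proof
    assume L: ?L
    show ?R
    proof
      fix i
      show "card {b. hgt P b = i} = letter_count T i"
      proof (cases i)
        case 0
        then show ?thesis using L[rule_format, of 0] by simp
      next
        case (Suc i')
        then show ?thesis
          using L[rule_format, of i] L[rule_format, of i'] card_height_Suc[OF n, of i'] by simp
      qed
    qed
  next
    assume R: ?R
    have "card {b. hgt P b \<le> i} = (\<Sum>k\<le>i. letter_count T k)" for i
    proof (induction i)
      case 0
      then show ?case using R[rule_format, of 0] by simp
    next
      case (Suc i)
      then show ?case using R[rule_format, of "Suc i"] card_height_Suc[OF n, of i] by simp
    qed
    then show ?L by blast
  qed
  finally show ?thesis using True by (simp add: partitions_of_diag_def)
qed (simp add: partitions_of_diag_def)

lemma hgt_of_diag:
  assumes P: "P \<in> partitions_of_diag K T"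
  shows "b \<le> k \<Longrightarrow> J < k \<Longrightarrow> hgt P b \<le> k" and "J < b \<Longrightarrow> hgt P b = b"
    and "d \<le> hgt P b"
proof -
  have part: "is_partition P" and cnt: "\<And>i. card {b. hgt P b = i} = letter_count T i"
    using P by (auto simp: partitions_of_diag_iff)
  note n = height_fun_hgt[OF part]
  have full: "{b. hgt P b \<le> k} = {..k}" if "J < k" for k
  proof (rule card_subset_eq)
    show "{b. hgt P b \<le> k} \<subseteq> {..k}" using order_trans[OF height_funD(1)[OF n]] by blast
    have "k + 1 - card {b. hgt P b \<le> k} = T k"
      using P diagonal_lengths_eq[OF part, of K k] by (simp add: partitions_of_diag_def)
    then show "card {b. hgt P b \<le> k} = card {..k}"
      using card_height_le[OF n, of k] hilbert_seq_simps(4)[OF that] by simp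
  qed simp
  show "b \<le> k \<Longrightarrow> J < k \<Longrightarrow> hgt P b \<le> k" using full[of k] by blast
  show "J < b \<Longrightarrow> hgt P b = b" using full[of b] height_funD(1)[OF n, of b] by (simp add: set_eq_iff le_antisym)
  show "d \<le> hgt P b"
  proof (rule ccontr)
    assume "\<not> d \<le> hgt P b"
    then have "card {b'. hgt P b' = hgt P b} = 0" using cnt letter_count_0 by simp
    then have "{b'. hgt P b' = hgt P b} = {}" using finite_height_eq[OF n] by (metis card_0_eq)
    then show False by blast
  qed
qed

lemma positions_height_word:
  assumes P: "P \<in> partitions_of_diag K T" and i: "i \<le> Suc J"
  shows "positions (height_word J P) i = {b. hgt P b = i}"
proof -
  have part: "is_partition P" using P by (simp add: partitions_of_diag_def)
  have "b < J + 2" if "hgt P b = i" for b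
    using that i height_funD(1)[OF height_fun_hgt[OF part], of b] by simp
  then show ?thesis by (auto simp: positions_def height_word_def simp del: upt_Suc)
qed

lemma rising_height_word:
  assumes "is_partition P"
  shows "rising (height_word J P)"
  using height_funD(2)[OF height_fun_hgt[OF assms]]
  by (simp add: height_word_def successively_conv_nth del: upt_Suc)

lemma card_positions: "card (positions w i) = count_list w i"
proof -
  have "count_list w i = card {b. b < length w \<and> i = w ! b}"
    unfolding count_list_eq_length_filter length_filter_conv_card ..
  also have "{b. b < length w \<and> i = w ! b} = positions w i" by (auto simp: positions_def)
  finally show ?thesis ..
qed

text \<open>A rising word of length \<open>J + 2\<close> with last letter \<open>J + 1\<close> lies above the diagonal, because it
  climbs by at most one at a time; so it is a list of heights.\<close>

lemma height_word_bij:
  "bij_betw (height_word J) (partitions_of_diag K T) (words d (Suc J) (letter_count T))"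
  unfolding bij_betw_def
proof
  show "inj_on (height_word J) (partitions_of_diag K T)"
  proof (rule inj_onI)
    fix P Q assume PQ: "P \<in> partitions_of_diag K T" "Q \<in> partitions_of_diag K T" "height_word J P = height_word J Q"
    have "hgt P b = hgt Q b" for b
    proof (cases "b < J + 2")
      case True
      then show ?thesis
        using arg_cong[OF PQ(3), of "\<lambda>w. w ! b"] by (simp add: height_word_def del: upt_Suc)
    next
      case False
      then show ?thesis using hgt_of_diag(2)[OF PQ(1)] hgt_of_diag(2)[OF PQ(2)] by simp
    qed
    then show "P = Q" using PQ(1,2) by (intro hgt_inject) (auto simp: partitions_of_diag_def)
  qed
  show "height_word J ` partitions_of_diag K T = words d (Suc J) (letter_count T)"
  proof (intro subset_antisym subsetI)
    fix w assume "w \<in> height_word J ` partitions_of_diag K T"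
    then obtain P where P: "P \<in> partitions_of_diag K T" "w = height_word J P" by blast
    have part: "is_partition P" using P by (simp add: partitions_of_diag_def)
    have "count_list w i = letter_count T i" if "i \<le> Suc J" for i
      using positions_height_word[OF P(1) that] P(1)
      unfolding card_positions[symmetric] P(2) by (simp add: partitions_of_diag_iff)
    moreover have "last w = Suc J" "w \<noteq> []"
      using hgt_of_diag(2)[OF P(1), of "Suc J"] unfolding P(2) height_word_def by (simp_all add: last_map)
    moreover have "set w \<subseteq> {d..Suc J}"
      using hgt_of_diag(3)[OF P(1)] hgt_of_diag(1)[OF P(1), of _ "Suc J"]
      unfolding P(2) height_word_def by auto
    ultimately show "w \<in> words d (Suc J) (letter_count T)"
      using rising_height_word[OF part] unfolding P(2) by (simp add: words_def)
  next
    fix w assume w: "w \<in> words d (Suc J) (letter_count T)"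
    have setw: "set w \<subseteq> {d..Suc J}" and cnt: "\<And>i. d \<le> i \<Longrightarrow> i \<le> Suc J \<Longrightarrow> count_list w i = letter_count T i"
      and rise: "rising w" and lastw: "w \<noteq> []" "last w = Suc J"
      using w by (auto simp: words_def)
    have "length w = (\<Sum>i\<in>{d..Suc J}. count_list w i)" using setw by (intro sum_count_set[symmetric]) auto
    also have "\<dots> = (\<Sum>i\<in>{d..Suc J}. letter_count T i)" using cnt by (intro sum.cong) auto
    also have "\<dots> = (\<Sum>i\<le>Suc J. letter_count T i)"
      by (rule sum.mono_neutral_left) (auto simp: letter_count_0)
    also have "\<dots> = J + 2" unfolding sum_letter_count using hilbert_seq_simps(4)[of "Suc J"] by simp
    finally have len: "length w = J + 2" .
    then have wl: "w ! Suc J = Suc J" using lastw by (simp add: last_conv_nth)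
    have step: "w ! Suc b \<le> Suc (w ! b)" if "b < Suc J" for b
      using successively_nth[OF rise, of b] that len by simp
    have ge: "b \<le> w ! b" if "b \<le> Suc J" for b
      using that
    proof (induction rule: inc_induct)
      case (step b)
      then show ?case using \<open>\<And>b. b < Suc J \<Longrightarrow> w ! Suc b \<le> Suc (w ! b)\<close>[of b] by simp
    qed (simp add: wl)
    define n where "n b = (if b < J + 2 then w ! b else b)" for b
    have "height_fun n"
      unfolding height_fun_def
    proof (intro conjI allI)
      fix b
      show "b \<le> n b" using ge[of b] by (simp add: n_def)
      show "n (Suc b) \<le> Suc (n b)" using step[of b] wl by (cases "b = Suc J") (auto simp: n_def)
      show "\<exists>M. \<forall>b\<ge>M. n b = b" by (rule exI[of _ "J + 2"]) (simp add: n_def)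
    qed
    then obtain P where P: "is_partition P" "hgt P = n" using ex_partition_hgt by blast
    have "height_word J P = w"
      by (rule nth_equalityI) (simp_all add: height_word_def P(2) n_def len del: upt_Suc)
    moreover have "card {b. hgt P b = i} = letter_count T i" for i
    proof (cases "i \<le> Suc J")
      case True
      then have "{b. hgt P b = i} = positions w i"
        unfolding P(2) n_def positions_def len by auto
      then have c: "card {b. hgt P b = i} = count_list w i" by (simp add: card_positions)
      show ?thesis
      proof (cases "d \<le> i")
        case True
        then show ?thesis using c cnt \<open>i \<le> Suc J\<close> by simp
      next
        case False
        then have "i \<notin> set w" using setw by auto
        then show ?thesis using c False letter_count_0 by simp
      qed
    next
      case False
      have "w ! b \<noteq> i" if "b < J + 2" for b
        using subsetD[OF setw nth_mem[of b w]] that len False by auto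
      then have "{b. hgt P b = i} = {i}" unfolding P(2) n_def using False by auto
      then show ?thesis using letter_count_above[of i] False by simp
    qed
    ultimately show "w \<in> height_word J ` partitions_of_diag K T"
      using P(1) partitions_of_diag_iff by (intro image_eqI[of _ _ P]) auto
  qed
qed

lemma full_rank_outside:
  assumes "is_partition P" "card {b. hgt P b = i} = 0"
  shows "full_rank TYPE('k::field) {b. hgt P b = i} {b. hgt P b = Suc i}"
  using gen_rank_le_card[OF finite_height_eq[OF height_fun_hgt[OF assms(1)], of i], of "{b. hgt P b = Suc i}", where ?'k = 'k]
    assms(2) by (simp add: full_rank_def)

text \<open>Both numbers of generators are sums over the degrees of the number of columns minus the rank.  In
  the big cell every rank is the largest possible, so the sums agree only if all terms do.\<close>

lemma special_iff_not_full_rank: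
  assumes inf: "infinite (UNIV :: 'k::field set)" and char: "CHAR('k) = 0 \<or> J < CHAR('k)"
    and P: "P \<in> partitions_of_diag TYPE('k) T"
  shows "kappa_T TYPE('k) T < kappa_P TYPE('k) P \<longleftrightarrow>
    \<not> (\<forall>i\<in>{d..<Suc J}. full_rank TYPE('k) {b. hgt P b = i} {b. hgt P b = Suc i})"
proof -
  have part: "is_partition P" and diag: "diagonal_lengths TYPE('k) P = T"
    and cnt: "\<And>i. card {b. hgt P b = i} = letter_count T i"
    using P partitions_of_diag_iff[of P "TYPE('k)"] by (auto simp: partitions_of_diag_def)
  obtain P0 where P0: "is_partition P0" "\<And>i. {b. hgt P0 b \<le> i} = {T i..i}"
      "kappa_T TYPE('k) T = cell_gens TYPE('k) (hgt P0) (Suc J)"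
    using kappa_T_eq[OF inf char hilbert_seq_simps(4) part diag] by blast
  note n = height_fun_hgt[OF part] and n0 = height_fun_hgt[OF P0(1)]
  have "P0 \<in> partitions_of_diag TYPE('k) T"
    using P0(1) hilbert_seq_le(2) by (simp add: partitions_of_diag_def fun_eq_iff diagonal_lengths_eq P0(2))
  then have cnt0: "card {b. hgt P0 b = i} = letter_count T i" for i by (simp add: partitions_of_diag_iff)
  let ?r = "\<lambda>P i. step_rank TYPE('k) (hgt P) i"
  let ?m = "\<lambda>i. min (letter_count T i) (letter_count T (Suc i))"
  have r0: "?r P0 i = ?m i" for i
  proof (cases "i < d")
    case True
    then show ?thesis
      using full_rank_outside[OF P0(1), of i, where ?'k = 'k] cnt0 letter_count_0 by (simp add: full_rank_def)
  next
    case False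
    have "full_rank TYPE('k) {b. hgt P0 b = i} {b. hgt P0 b = Suc i}"
      using hilbert_seq_le(1)[of i] False hilbert_seq_simps(3)[of i] by (intro full_rank_big_cell[OF n0 P0(2)]) auto
    then show ?thesis by (simp add: full_rank_def cnt0)
  qed
  have r: "?r P i \<le> ?m i" for i
    using gen_rank_le_card[OF finite_height_eq[OF n, of i], where ?'k = 'k] gen_rank_le_columns[OF n, of i, where ?'k = 'k]
    by (simp add: cnt[symmetric])
  have kP: "kappa_P TYPE('k) P = letter_count T 0 + (\<Sum>i<Suc J. letter_count T (Suc i) - ?r P i)"
    using kappa_P_eq[OF inf part, of "Suc J"] hilbert_seq_simps(4) diag by (simp only: cell_gens_def cnt Suc_le_eq)
  have kT: "kappa_T TYPE('k) T = letter_count T 0 + (\<Sum>i<Suc J. letter_count T (Suc i) - ?m i)"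
    unfolding P0(3) cell_gens_def cnt0 r0 ..
  have le: "letter_count T (Suc i) - ?m i \<le> letter_count T (Suc i) - ?r P i" for i
    using r[of i] by (rule diff_le_mono2)
  have "kappa_T TYPE('k) T < kappa_P TYPE('k) P \<longleftrightarrow> (\<exists>i<Suc J. ?r P i \<noteq> ?m i)"
  proof
    assume less: "kappa_T TYPE('k) T < kappa_P TYPE('k) P"
    show "\<exists>i<Suc J. ?r P i \<noteq> ?m i"
    proof (rule ccontr)
      assume "\<not> (\<exists>i<Suc J. ?r P i \<noteq> ?m i)"
      then have "(\<Sum>i<Suc J. letter_count T (Suc i) - ?r P i) = (\<Sum>i<Suc J. letter_count T (Suc i) - ?m i)"
        by (intro sum.cong) auto
      then show False using less unfolding kP kT by linarith
    qed
  next
    assume "\<exists>i<Suc J. ?r P i \<noteq> ?m i"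
    then obtain i where i: "i < Suc J" "?r P i < ?m i" using r by (metis le_neq_implies_less)
    have "(\<Sum>i<Suc J. letter_count T (Suc i) - ?m i) < (\<Sum>i<Suc J. letter_count T (Suc i) - ?r P i)"
    proof (rule sum_strict_mono_ex1)
      show "\<exists>i\<in>{..<Suc J}. letter_count T (Suc i) - ?m i < letter_count T (Suc i) - ?r P i"
        using i by (intro bexI[of _ i]) auto
    qed (use le in auto)
    then show "kappa_T TYPE('k) T < kappa_P TYPE('k) P" unfolding kP kT by simp
  qed
  also have "\<dots> \<longleftrightarrow> \<not> (\<forall>i\<in>{d..<Suc J}. full_rank TYPE('k) {b. hgt P b = i} {b. hgt P b = Suc i})"
  proof -
    have "?r P i = ?m i" if "i < d" for i
      using full_rank_outside[OF part, of i, where ?'k = 'k] that cnt letter_count_0 by (simp add: full_rank_def)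
    moreover have "full_rank TYPE('k) {b. hgt P b = i} {b. hgt P b = Suc i} \<longleftrightarrow> ?r P i = ?m i" for i
      by (simp add: full_rank_def cnt)
    ultimately show ?thesis by (metis atLeastLessThan_iff not_le)
  qed
  finally show ?thesis .
qed

definition full_word :: "'k::field itself \<Rightarrow> bool list \<Rightarrow> bool" where
  "full_word K v \<longleftrightarrow> full_rank K (positions v True) (positions v False)"

lemma card_partitions:
  "finite (partitions_of_diag K T)"
  "card (partitions_of_diag K T) =
    (\<Prod>i\<in>{d..<Suc J}. card (pair_words (letter_count T i) (letter_count T (Suc i))))"
proof -
  show "finite (partitions_of_diag K T)"
    using bij_betw_finite[OF height_word_bij] finite_words by blast
  have "card (partitions_of_diag K T) = card (words d (Suc J) (letter_count T))"
    by (rule bij_betw_same_card[OF height_word_bij])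
  also have "\<dots> = (\<Prod>i\<in>{d..<Suc J}. card (pair_words (letter_count T i) (letter_count T (Suc i))))"
    using card_words[of d "Suc J" "letter_count T" "\<lambda>_ _. True"] hilbert_seq_simps(5) letter_count_pos by simp
  finally show "card (partitions_of_diag K T) =
    (\<Prod>i\<in>{d..<Suc J}. card (pair_words (letter_count T i) (letter_count T (Suc i))))" .
qed

lemma card_nonspecial:
  assumes inf: "infinite (UNIV :: 'k::field set)" and char: "CHAR('k) = 0 \<or> J < CHAR('k)"
  shows "card (partitions_of_diag TYPE('k) T - special_partitions TYPE('k) T) =
    (\<Prod>i\<in>{d..<Suc J}. card {v \<in> pair_words (letter_count T i) (letter_count T (Suc i)). full_word TYPE('k) v})"
proof -
  let ?W = "{w \<in> words d (Suc J) (letter_count T). \<forall>i\<in>{d..<Suc J}. full_word TYPE('k) (pair_word i w)}"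
  have iff: "P \<notin> special_partitions TYPE('k) T \<longleftrightarrow> height_word J P \<in> ?W"
    if P: "P \<in> partitions_of_diag TYPE('k) T" for P
  proof -
    have part: "is_partition P" using P by (simp add: partitions_of_diag_def)
    have "full_word TYPE('k) (pair_word i (height_word J P)) \<longleftrightarrow>
        full_rank TYPE('k) {b. hgt P b = i} {b. hgt P b = Suc i}" if "i \<in> {d..<Suc J}" for i
      using full_rank_pair_word[OF rising_height_word[OF part], of i, where ?'k = 'k]
        positions_height_word[OF P, of i] positions_height_word[OF P, of "Suc i"] that
      by (simp add: full_word_def)
    moreover have "height_word J P \<in> words d (Suc J) (letter_count T)"
      using bij_betwE[OF height_word_bij] P by blast
    ultimately show ?thesis
      using special_iff_not_full_rank[OF inf char P] P by (simp add: special_partitions_def)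
  qed
  have "bij_betw (height_word J) (partitions_of_diag TYPE('k) T - special_partitions TYPE('k) T) ?W"
  proof (rule bij_betw_subset[OF height_word_bij[of "TYPE('k)"] Diff_subset])
    show "height_word J ` (partitions_of_diag TYPE('k) T - special_partitions TYPE('k) T) = ?W"
    proof (intro subset_antisym subsetI)
      fix w assume "w \<in> height_word J ` (partitions_of_diag TYPE('k) T - special_partitions TYPE('k) T)"
      then show "w \<in> ?W" using iff by blast
    next
      fix w assume w: "w \<in> ?W"
      then have "w \<in> height_word J ` partitions_of_diag TYPE('k) T"
        using bij_betw_imp_surj_on[OF height_word_bij] by blast
      then show "w \<in> height_word J ` (partitions_of_diag TYPE('k) T - special_partitions TYPE('k) T)"
        using w iff by blast
    qed
  qed
  then have "card (partitions_of_diag TYPE('k) T - special_partitions TYPE('k) T) = card ?W"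
    by (rule bij_betw_same_card)
  also have "\<dots> = (\<Prod>i\<in>{d..<Suc J}. card {v \<in> pair_words (letter_count T i) (letter_count T (Suc i)). full_word TYPE('k) v})"
    using hilbert_seq_simps(5) letter_count_pos by (intro card_words) auto
  finally show ?thesis .
qed

end

text \<open>The slice \<open>T_i\<close> has the letters \<open>i\<close> and \<open>i + 1\<close> of \<open>T\<close>, with the same multiplicities, and
  no others that matter.\<close>

lemma hilbert_seq_slice:
  assumes T: "hilbert_seq t d j" and i: "d \<le> i" "0 < i"
  shows "hilbert_seq (T_slice t i) (t (i - 1) - t (i + 1)) (t (i - 1) - t (i + 1))"
    and "letter_count (T_slice t i) (t (i - 1) - t (i + 1)) = letter_count t i"
    and "letter_count (T_slice t i) (Suc (t (i - 1) - t (i + 1))) = letter_count t (Suc i)"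
proof -
  have t1: "t (Suc i) \<le> t i" using hilbert_seq_simps(3)[OF T i(1)] .
  have t0: "t i \<le> t (i - 1)"
  proof (cases "d \<le> i - 1")
    case True
    then show ?thesis using hilbert_seq_simps(3)[OF T, of "i - 1"] i by simp
  next
    case False
    then have "d = i" using i by simp
    then show ?thesis using hilbert_seq_simps(2)[OF T] hilbert_seq_simps(1)[OF T, of "i - 1"] i by simp
  qed
  show "hilbert_seq (T_slice t i) (t (i - 1) - t (i + 1)) (t (i - 1) - t (i + 1))"
    using t0 t1 by (auto simp: hilbert_seq_def T_slice_def)
  show "letter_count (T_slice t i) (t (i - 1) - t (i + 1)) = letter_count t i"
    "letter_count (T_slice t i) (Suc (t (i - 1) - t (i + 1))) = letter_count t (Suc i)"
    using t0 t1 i by (cases i; cases "t (i - 1) - t (i + 1)"; simp add: letter_count_def T_slice_def)+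
qed

text \<open>Expand the product of the \<open>A l - S l\<close> and sort the subsets by size.\<close>

lemma prod_complement_expansion:
  fixes S A :: "'a \<Rightarrow> int"
  assumes X: "finite X"
  shows "(\<Prod>l\<in>X. A l) - (\<Prod>l\<in>X. A l - S l) = (\<Sum>i = 1..card X. (- 1) ^ (i + 1) *
    (\<Sum>L | L \<subseteq> X \<and> card L = i. (\<Prod>l\<in>L. S l) * (\<Prod>l\<in>X - L. A l)))"
proof -
  let ?f = "\<lambda>L. (\<Prod>l\<in>L. S l) * (\<Prod>l\<in>X - L. A l)"
  have "(\<Prod>l\<in>X. A l - S l) = (\<Prod>l\<in>X. (- S l) + A l)" by simp
  also have "\<dots> = (\<Sum>L\<in>Pow X. (\<Prod>l\<in>L. - S l) * (\<Prod>l\<in>X - L. A l))" by (rule prod_add[OF X])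
  also have "\<dots> = (\<Sum>L\<in>Pow X. (- 1) ^ card L * ?f L)"
    by (intro sum.cong refl) (simp add: prod_uminus mult.assoc)
  also have "\<dots> = (\<Sum>i\<in>{0..card X}. \<Sum>L | L \<in> Pow X \<and> card L = i. (- 1) ^ card L * ?f L)"
    by (rule sum.group[symmetric]) (use X card_mono in auto)
  also have "\<dots> = (\<Sum>i = 0..card X. (- 1) ^ i * (\<Sum>L | L \<subseteq> X \<and> card L = i. ?f L))"
    unfolding sum_distrib_left Pow_iff by (intro sum.cong refl) simp
  also have "\<dots> = (\<Sum>L | L \<subseteq> X \<and> card L = 0. ?f L) +
      (\<Sum>i = 1..card X. (- 1) ^ i * (\<Sum>L | L \<subseteq> X \<and> card L = i. ?f L))"
    by (simp add: sum.atLeast_Suc_atMost)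
  also have "{L. L \<subseteq> X \<and> card L = 0} = {{}}" using X finite_subset by fastforce
  finally show ?thesis by (simp add: sum_negf)
qed

theorem corollary6p3:
  fixes d j :: nat and t :: "nat \<Rightarrow> nat"
  defines "A \<equiv> \<lambda>i. card (partitions_of_diag TYPE('k::field) (T_slice t i))"
    and "S \<equiv> \<lambda>i. card (special_partitions TYPE('k) (T_slice t i))"
  assumes "CHAR('k) = 0 \<or> infinite (UNIV :: 'k set) \<and> j < CHAR('k)"
    and "1 \<le> d" and "d \<le> j + 1"
    and "\<And>i. i < d \<Longrightarrow> t i = i + 1"
    and "\<And>i. d \<le> i \<Longrightarrow> i \<le> j \<Longrightarrow> t i \<le> t (i - 1)"
    and "0 < t j"
    and "\<And>i. j < i \<Longrightarrow> t i = 0"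
  shows "int (card (special_partitions TYPE('k) t)) =
    (\<Sum>i = 1..j + 1 - d. (- 1) ^ (i + 1) *
       (\<Sum>L \<in> {L. L \<subseteq> {d..j} \<and> card L = i}.
          (\<Prod>l\<in>L. int (S l)) * (\<Prod>l\<in>{d..j} - L. int (A l))))"
proof -
  let ?X = "{d..j}"
  have T: "hilbert_seq t d j"
    unfolding hilbert_seq_def
  proof (intro conjI allI impI)
    show "t k = Suc k" if "k < d" for k using assms(6)[OF that] by simp
    show "t d \<le> d"
      using assms(4,5) assms(6)[of "d - 1"] assms(7)[of d] assms(9)[of d] by (cases "d \<le> j") auto
    show "t (Suc k) \<le> t k" if "d \<le> k" for k
      using assms(7)[of "Suc k"] assms(9)[of "Suc k"] that by (cases "Suc k \<le> j") auto
    show "t k = 0" if "j < k" for k using assms(9)[OF that] .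
    show "d \<le> Suc j" using assms(5) by simp
  qed
  have inf: "infinite (UNIV :: 'k set)"
    using assms(3) finite_imp_CHAR_pos[where ?'a = 'k] by auto
  have char: "CHAR('k) = 0 \<or> j < CHAR('k)" using assms(3) by blast
  let ?V = "\<lambda>l. pair_words (letter_count t l) (letter_count t (Suc l))"
  let ?N = "\<lambda>l. card {v \<in> ?V l. full_word TYPE('k) v}"
  have AS: "A l = card (?V l) \<and> int (A l) - int (S l) = int (?N l)" if l: "l \<in> ?X" for l
  proof -
    let ?d = "t (l - 1) - t (l + 1)"
    let ?P = "partitions_of_diag TYPE('k) (T_slice t l)" and ?S = "special_partitions TYPE('k) (T_slice t l)"
    have l0: "d \<le> l" "0 < l" using l assms(4) by auto
    note slice = hilbert_seq_slice[OF T l0]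
    have one: "prod f {?d..<Suc ?d} = f ?d" for f :: "nat \<Rightarrow> nat" by simp
    have "t (l - 1) \<le> d"
      using hilbert_seq_le(1)[OF T, of "l - 1"] hilbert_seq_simps(1)[OF T, of "l - 1"] by (cases "d \<le> l - 1") auto
    then have "CHAR('k) = 0 \<or> ?d < CHAR('k)" using char l by auto
    from card_nonspecial[OF slice(1) inf this]
    have "card (?P - ?S) = ?N l" unfolding one slice(2,3) .
    moreover have "card ?P = card (?V l)"
      using card_partitions(2)[OF slice(1), of "TYPE('k)"] unfolding one slice(2,3) .
    moreover have sub: "?S \<subseteq> ?P" by (auto simp: special_partitions_def)
    moreover have "card ?S \<le> card ?P" using card_partitions(1)[OF slice(1)] sub by (rule card_mono)
    moreover have "card (?P - ?S) = card ?P - card ?S"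
      using card_partitions(1)[OF slice(1)] sub by (intro card_Diff_subset) (auto intro: finite_subset)
    ultimately show ?thesis unfolding assms(1,2) by simp
  qed
  let ?P = "partitions_of_diag TYPE('k) t" and ?S = "special_partitions TYPE('k) t"
  have X: "{d..<Suc j} = ?X" by auto
  have sub: "?S \<subseteq> ?P" by (auto simp: special_partitions_def)
  have "card ?S \<le> card ?P" using card_partitions(1)[OF T] sub by (rule card_mono)
  moreover have "card (?P - ?S) = card ?P - card ?S"
    using card_partitions(1)[OF T] sub by (intro card_Diff_subset) (auto intro: finite_subset)
  ultimately have "int (card ?S) = int (card ?P) - int (card (?P - ?S))" by simp
  also have "\<dots> = (\<Prod>l\<in>?X. int (card (?V l))) - (\<Prod>l\<in>?X. int (?N l))"
    unfolding card_partitions(2)[OF T] card_nonspecial[OF T inf char] X by simp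
  also have "\<dots> = (\<Prod>l\<in>?X. int (A l)) - (\<Prod>l\<in>?X. int (A l) - int (S l))"
  proof -
    have "(\<Prod>l\<in>?X. int (card (?V l))) = (\<Prod>l\<in>?X. int (A l))"
      by (rule prod.cong[OF refl]) (simp only: AS)
    moreover have "(\<Prod>l\<in>?X. int (?N l)) = (\<Prod>l\<in>?X. int (A l) - int (S l))"
      by (rule prod.cong[OF refl], rule AS[THEN conjunct2, symmetric])
    ultimately show ?thesis by simp
  qed
  also have "\<dots> = (\<Sum>i = 1..card ?X. (- 1) ^ (i + 1) *
      (\<Sum>L | L \<subseteq> ?X \<and> card L = i. (\<Prod>l\<in>L. int (S l)) * (\<Prod>l\<in>?X - L. int (A l))))"
    by (rule prod_complement_expansion) simp
  finally show ?thesis by simp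
qed

end
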